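(* (a) Let $E$ be an elliptic curve over $\mathbb{R}$ and $P_1,\ldots,P_n\in E(\mathbb{R})$ linearly independent, with attached $q,u_1,\ldots,u_n$ such that $u_1,\ldots,u_k<0$ and $u_{k+1},\ldots,u_n>0$ for some $0\le k\le n$. Then the signs of the array $(\Psi_{\mathbf{v}}(\mathbf{P};E))_{\mathbf{v}\in\mathbb{N}^n}$ are uniformly distributed. (b) Let $W:\mathbb{Z}^n\to\mathbb{R}$ be a non-singular, non-degenerate elliptic net with $W(\mathbf{v})\ne0$ for $\mathbf{v}\ne\mathbf{0}$, whose associated elliptic curve and points have attached $u_1,\ldots,u_n$ with $u_1,\ldots,u_k<0$ and $u_{k+1},\ldots,u_n>0$ for some $0\le k\le n$. Then the signs of $(W(\mathbf{v}))_{\mathbf{v}\in\mathbb{N}^n}$ are uniformly distributed.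
   Context: For an array $(S(\mathbf{v}))_{\mathbf{v}\in\mathbb{N}^n}$ of integers and $m\ge2$, let $C(m,j;V_1,\ldots,V_n)=\#\{\mathbf{v}:1\le v_i\le V_i\ (1\le i\le n),\ S(\mathbf{v})\equiv j\pmod m\}$; the array is uniformly distributed mod $m$ if $C(m,j;V_1,\ldots,V_n)/(V_1\cdots V_n)\to1/m$ as $V_1,\ldots,V_n\to\infty$, for each $j=0,\ldots,m-1$. The signs of an array $S$ of nonzero reals are uniformly distributed if $(\mathrm{Parity}[S(\mathbf{v})])$ is uniformly distributed mod 2, where $x/|x|=(-1)^{\mathrm{Parity}[x]}$. Net polynomials: for $E/\mathbb{R}$ with period lattice $\Lambda$ and sigma function $\sigma(z;\Lambda)=z\prod_{0\ne\omega\in\Lambda}(1-z/\omega)e^{z/\omega+\frac12(z/\omega)^2}$, and $P_i$ corresponding to $z_i\in\mathbb{C}/\Lambda$, $\Psi_{\mathbf{v}}(\mathbf{P};E)=(-1)^{\sum_i v_i^2-\sum_{i<j}v_iv_j-1}\sigma(\sum_i v_iz_i;\Lambda)\big/\big(\prod_i\sigma(z_i;\Lambda)^{2v_i^2-\sum_j v_iv_j}\prod_{i<j}\sigma(z_i+z_j;\Lambda)^{v_iv_j}\big)$; these are nonzero reals for $\mathbf{v}\neq\mathbf 0$ when the $P_i\in E(\mathbb{R})$ are linearly independent. Tate parametrization: unique real $q$, $0<|q|<1$, and an $\mathbb{R}$-analytic isomorphism $\psi:\mathbb{R}^*/q^{\mathbb{Z}}\to E(\mathbb{R})$ (restriction of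 an isomorphism $\mathbb{C}^*/q^{\mathbb{Z}}\to E(\mathbb{C})$ commuting with conjugation coming from Tate's uniformization of $E_q\cong_{\mathbb{R}}E$); $u_i$ is the representative of $\psi^{-1}(P_i)$ with $q<|u_i|<1$ if $q>0$, $q^2<u_i<1$ if $q<0$. Elliptic nets: maps $W:\mathbb{Z}^n\to R$ with $W(\mathbf 0)=0$ and $W(\mathbf{p}+\mathbf{q}+\mathbf{s})W(\mathbf{p}-\mathbf{q})W(\mathbf{r}+\mathbf{s})W(\mathbf{r})+W(\mathbf{q}+\mathbf{r}+\mathbf{s})W(\mathbf{q}-\mathbf{r})W(\mathbf{p}+\mathbf{s})W(\mathbf{p})+W(\mathbf{r}+\mathbf{p}+\mathbf{s})W(\mathbf{r}-\mathbf{p})W(\mathbf{q}+\mathbf{s})W(\mathbf{q})=0$; non-degenerate means $W(\mathbf{e}_i),W(2\mathbf{e}_i)\ne0$, $W(\mathbf{e}_i\pm\mathbf{e}_j)\ne0$ ($i\neq j$), and $W(3\mathbf e_1)\ne0$ if $n=1$. A quadratic form is $f:\mathbb{Z}^n\to\mathbb{R}^*$ with $f(\mathbf{a}+\mathbf{b}+\mathbf{c})f(\mathbf{a}+\mathbf{b})^{-1}f(\mathbf{b}+\mathbf{c})^{-1}f(\mathbf{c}+\mathbf{a})^{-1}f(\mathbf{a})f(\mathbf{b})f(\mathbf{c})=1$. By a theorem of Stange a non-degenerate $W:\mathbb{Z}^n\to\mathbb{R}$ satisfies $W(\mathbf{v})=f(\mathbf{v})\Psi_{\mathbf{v}}(\mathbf{P};E)$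 for a cubic $E/\mathbb{R}$ in Weierstrass form, points $P_i$ on it ("associated" to $W$), and a quadratic form $f$; $W$ is non-singular if $E$ is an elliptic curve. *)

theory Defs
  imports "HOL-Analysis.Analysis"
begin

record wcurve =
  wa1 :: real
  wa2 :: real
  wa3 :: real
  wa4 :: real
  wa6 :: real

definition wb2 :: "wcurve \<Rightarrow> real" where "wb2 E = wa1 E ^ 2 + 4 * wa2 E"
definition wb4 :: "wcurve \<Rightarrow> real" where "wb4 E = 2 * wa4 E + wa1 E * wa3 E"
definition wb6 :: "wcurve \<Rightarrow> real" where "wb6 E = wa3 E ^ 2 + 4 * wa6 E"
definition wb8 :: "wcurve \<Rightarrow> real" where
  "wb8 E = wa1 E ^ 2 * wa6 E + 4 * wa2 E * wa6 E - wa1 E * wa3 E * wa4 E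
           + wa2 E * wa3 E ^ 2 - wa4 E ^ 2"
definition wc4 :: "wcurve \<Rightarrow> real" where "wc4 E = wb2 E ^ 2 - 24 * wb4 E"
definition wc6 :: "wcurve \<Rightarrow> real" where
  "wc6 E = - (wb2 E ^ 3) + 36 * wb2 E * wb4 E - 216 * wb6 E"
definition wdisc :: "wcurve \<Rightarrow> real" where
  "wdisc E = - (wb2 E ^ 2 * wb8 E) - 8 * wb4 E ^ 3 - 27 * wb6 E ^ 2
             + 9 * wb2 E * wb4 E * wb6 E"

definition elliptic_curve :: "wcurve \<Rightarrow> bool" where
  "elliptic_curve E \<longleftrightarrow> wdisc E \<noteq> 0"

datatype 'a ppoint = Inf | Pt 'a 'a

definition on_curve :: "wcurve \<Rightarrow> 'a::real_field ppoint \<Rightarrow> bool" where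
  "on_curve E P = (case P of Inf \<Rightarrow> True
     | Pt x y \<Rightarrow> y ^ 2 + of_real (wa1 E) * x * y + of_real (wa3 E) * y
                 = x ^ 3 + of_real (wa2 E) * x ^ 2 + of_real (wa4 E) * x + of_real (wa6 E))"

text \<open>Chord-tangent group law on E(R) (Silverman, Alg. III.2.3).\<close>
fun pt_add :: "wcurve \<Rightarrow> real ppoint \<Rightarrow> real ppoint \<Rightarrow> real ppoint" where
  "pt_add E Inf Q = Q"
| "pt_add E P Inf = P"
| "pt_add E (Pt x1 y1) (Pt x2 y2) =
     (if x1 = x2 \<and> y1 + y2 + wa1 E * x2 + wa3 E = 0 then Inf
      else
        (let lam = (if x1 \<noteq> x2 then (y2 - y1) / (x2 - x1)
                    else (3 * x1 ^ 2 + 2 * wa2 E * x1 + wa4 E - wa1 E * y1)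
                         / (2 * y1 + wa1 E * x1 + wa3 E));
             nu = (if x1 \<noteq> x2 then (y1 * x2 - y2 * x1) / (x2 - x1)
                   else (- (x1 ^ 3) + wa4 E * x1 + 2 * wa6 E - wa3 E * y1)
                        / (2 * y1 + wa1 E * x1 + wa3 E));
             x3 = lam ^ 2 + wa1 E * lam - wa2 E - x1 - x2
         in Pt x3 (- (lam + wa1 E) * x3 - nu - wa3 E)))"

fun pt_neg :: "wcurve \<Rightarrow> real ppoint \<Rightarrow> real ppoint" where
  "pt_neg E Inf = Inf"
| "pt_neg E (Pt x y) = Pt x (- y - wa1 E * x - wa3 E)"

fun pt_nmult :: "wcurve \<Rightarrow> nat \<Rightarrow> real ppoint \<Rightarrow> real ppoint" where
  "pt_nmult E 0 P = Inf"
| "pt_nmult E (Suc m) P = pt_add E P (pt_nmult E m P)"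

definition pt_smult :: "wcurve \<Rightarrow> int \<Rightarrow> real ppoint \<Rightarrow> real ppoint" where
  "pt_smult E c P = (if 0 \<le> c then pt_nmult E (nat c) P else pt_neg E (pt_nmult E (nat (- c)) P))"

definition pt_lincomb :: "wcurve \<Rightarrow> nat \<Rightarrow> (nat \<Rightarrow> int) \<Rightarrow> (nat \<Rightarrow> real ppoint) \<Rightarrow> real ppoint" where
  "pt_lincomb E n c P = fold (\<lambda>i acc. pt_add E acc (pt_smult E (c i) (P i))) [0..<n] Inf"

definition lin_indep :: "wcurve \<Rightarrow> nat \<Rightarrow> (nat \<Rightarrow> real ppoint) \<Rightarrow> bool" where
  "lin_indep E n P \<longleftrightarrow> (\<forall>c. pt_lincomb E n c P = Inf \<longrightarrow> (\<forall>i<n. c i = 0))"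

definition is_lattice :: "complex set \<Rightarrow> bool" where
  "is_lattice L \<longleftrightarrow> (\<exists>w1 w2. Im (w2 / w1) \<noteq> 0 \<and>
       L = {of_int a * w1 + of_int b * w2 | a b :: int. True})"

definition eisen :: "nat \<Rightarrow> complex set \<Rightarrow> complex" where
  "eisen k L = infsum (\<lambda>w. 1 / w ^ k) (L - {0})"

definition g2 :: "complex set \<Rightarrow> complex" where "g2 L = 60 * eisen 4 L"
definition g3 :: "complex set \<Rightarrow> complex" where "g3 L = 140 * eisen 6 L"

text \<open>The period lattice of E (Silverman VI.3):
  E is isomorphic to y^2 = 4x^3 - (c4/12) x - c6/216.\<close>
definition period_lattice :: "wcurve \<Rightarrow> complex set \<Rightarrow> bool" where
  "period_lattice E L \<longleftrightarrow> is_lattice L \<and> g2 L = of_real (wc4 E / 12) \<and> g3 L = of_real (wc6 E / 216)"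

definition wp :: "complex set \<Rightarrow> complex \<Rightarrow> complex" where
  "wp L z = 1 / z ^ 2 + infsum (\<lambda>w. 1 / (z - w) ^ 2 - 1 / w ^ 2) (L - {0})"

definition wp' :: "complex set \<Rightarrow> complex \<Rightarrow> complex" where
  "wp' L z = - 2 * infsum (\<lambda>w. 1 / (z - w) ^ 3) L"

definition weier_pt :: "wcurve \<Rightarrow> complex set \<Rightarrow> complex \<Rightarrow> complex ppoint" where
  "weier_pt E L z = (if z \<in> L then Inf else
     (let x = wp L z - of_real (wb2 E / 12)
      in Pt x ((wp' L z - of_real (wa1 E) * x - of_real (wa3 E)) / 2)))"

text \<open>Weierstrass sigma function (absolutely convergent product, taken over growing discs).\<close>
definition sigma :: "complex set \<Rightarrow> complex \<Rightarrow> complex" where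
  "sigma L z = lim (\<lambda>N::nat. z * (\<Prod>w\<in>{w\<in>L. w \<noteq> 0 \<and> norm w \<le> real N}.
        (1 - z / w) * exp (z / w + (z / w) ^ 2 / 2)))"

text \<open>Net polynomials Psi_v(P;E), with z i the elliptic logarithm of P_i and L the period lattice.\<close>
definition netpoly :: "complex set \<Rightarrow> nat \<Rightarrow> (nat \<Rightarrow> complex) \<Rightarrow> (nat \<Rightarrow> int) \<Rightarrow> complex" where
  "netpoly L n z v =
     (-1) powi ((\<Sum>i<n. v i ^ 2) - (\<Sum>i<n. \<Sum>j\<in>{i<..<n}. v i * v j) - 1)
     * sigma L (\<Sum>i<n. of_int (v i) * z i)
     / ((\<Prod>i<n. sigma L (z i) powi (2 * v i ^ 2 - (\<Sum>j<n. v i * v j)))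
        * (\<Prod>i<n. \<Prod>j\<in>{i<..<n}. sigma L (z i + z j) powi (v i * v j)))"

definition tate_s :: "nat \<Rightarrow> real \<Rightarrow> real" where
  "tate_s k q = suminf (\<lambda>m. real (Suc m) ^ k * q ^ Suc m / (1 - q ^ Suc m))"

definition tate_curve :: "real \<Rightarrow> wcurve" where
  "tate_curve q = \<lparr> wa1 = 1, wa2 = 0, wa3 = 0, wa4 = - 5 * tate_s 3 q,
                     wa6 = - (5 * tate_s 3 q + 7 * tate_s 5 q) / 12 \<rparr>"

definition tate_pt :: "real \<Rightarrow> real \<Rightarrow> real ppoint" where
  "tate_pt q u = (if \<exists>m::int. u = q powi m then Inf else
     Pt (infsum (\<lambda>m::int. q powi m * u / (1 - q powi m * u) ^ 2) UNIV - 2 * tate_s 1 q)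
        (infsum (\<lambda>m::int. (q powi m * u) ^ 2 / (1 - q powi m * u) ^ 3) UNIV + tate_s 1 q))"

text \<open>Real change of Weierstrass coordinates x = w^2 x' + r, y = w^3 y' + s w^2 x' + t
  taking E' to E (Silverman III.1).\<close>
definition is_iso :: "wcurve \<Rightarrow> wcurve \<Rightarrow> real \<Rightarrow> real \<Rightarrow> real \<Rightarrow> real \<Rightarrow> bool" where
  "is_iso E' E w r s t \<longleftrightarrow> w \<noteq> 0 \<and>
     w * wa1 E' = wa1 E + 2 * s \<and>
     w ^ 2 * wa2 E' = wa2 E - s * wa1 E + 3 * r - s ^ 2 \<and>
     w ^ 3 * wa3 E' = wa3 E + r * wa1 E + 2 * t \<and>
     w ^ 4 * wa4 E' = wa4 E - s * wa3 E + 2 * r * wa2 E - (t + r * s) * wa1 E + 3 * r ^ 2 - 2 * s * t \<and>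
     w ^ 6 * wa6 E' = wa6 E + r * wa4 E + r ^ 2 * wa2 E + r ^ 3 - t * wa3 E - t ^ 2 - r * t * wa1 E"

fun iso_map :: "real \<Rightarrow> real \<Rightarrow> real \<Rightarrow> real \<Rightarrow> real ppoint \<Rightarrow> real ppoint" where
  "iso_map w r s t Inf = Inf"
| "iso_map w r s t (Pt x y) = Pt (w ^ 2 * x + r) (w ^ 3 * y + s * w ^ 2 * x + t)"

text \<open>q and u_0..u_{n-1} are attached to E and P: psi = (real isomorphism E_q -> E) o (Tate map),
  and u i is the normalized representative of psi^{-1}(P i).\<close>
definition attached :: "wcurve \<Rightarrow> nat \<Rightarrow> (nat \<Rightarrow> real ppoint) \<Rightarrow> real \<Rightarrow> (nat \<Rightarrow> real) \<Rightarrow> bool" where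
  "attached E n P q u \<longleftrightarrow> 0 < \<bar>q\<bar> \<and> \<bar>q\<bar> < 1 \<and>
     (\<exists>w r s t. is_iso (tate_curve q) E w r s t \<and>
        (\<forall>i<n. (if 0 < q then q < \<bar>u i\<bar> \<and> \<bar>u i\<bar> < 1 else q ^ 2 < u i \<and> u i < 1)
               \<and> iso_map w r s t (tate_pt q (u i)) = P i))"

definition Zn :: "nat \<Rightarrow> (nat \<Rightarrow> int) set" where
  "Zn n = {v. \<forall>i\<ge>n. v i = 0}"

definition vbox :: "nat \<Rightarrow> (nat \<Rightarrow> nat) \<Rightarrow> (nat \<Rightarrow> int) set" where
  "vbox n V = {v. (\<forall>i<n. 1 \<le> v i \<and> v i \<le> int (V i)) \<and> (\<forall>i\<ge>n. v i = 0)}"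

definition unif_distrib_mod :: "nat \<Rightarrow> ((nat \<Rightarrow> int) \<Rightarrow> int) \<Rightarrow> int \<Rightarrow> bool" where
  "unif_distrib_mod n S m \<longleftrightarrow> (\<forall>j. 0 \<le> j \<and> j < m \<longrightarrow>
     (\<forall>\<epsilon>>0. \<exists>N. \<forall>V. (\<forall>i<n. N \<le> V i) \<longrightarrow>
        \<bar>real (card {v \<in> vbox n V. S v mod m = j}) / (\<Prod>i<n. real (V i)) - 1 / real_of_int m\<bar> < \<epsilon>))"

definition parity :: "real \<Rightarrow> int" where
  "parity x = (if 0 < x then 0 else 1)"

definition signs_unif :: "nat \<Rightarrow> ((nat \<Rightarrow> int) \<Rightarrow> real) \<Rightarrow> bool" where
  "signs_unif n S \<longleftrightarrow> unif_distrib_mod n (\<lambda>v. parity (S v)) 2"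

definition vadd :: "(nat \<Rightarrow> int) \<Rightarrow> (nat \<Rightarrow> int) \<Rightarrow> nat \<Rightarrow> int" where
  "vadd a b = (\<lambda>i. a i + b i)"
definition vsub :: "(nat \<Rightarrow> int) \<Rightarrow> (nat \<Rightarrow> int) \<Rightarrow> nat \<Rightarrow> int" where
  "vsub a b = (\<lambda>i. a i - b i)"
definition unitv :: "nat \<Rightarrow> nat \<Rightarrow> int" where
  "unitv i = (\<lambda>j. if j = i then 1 else 0)"
definition vscale :: "int \<Rightarrow> (nat \<Rightarrow> int) \<Rightarrow> nat \<Rightarrow> int" where
  "vscale c a = (\<lambda>i. c * a i)"

definition elliptic_net :: "nat \<Rightarrow> ((nat \<Rightarrow> int) \<Rightarrow> real) \<Rightarrow> bool" where
  "elliptic_net n W \<longleftrightarrow> W (\<lambda>_. 0) = 0 \<and>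
     (\<forall>p\<in>Zn n. \<forall>q\<in>Zn n. \<forall>r\<in>Zn n. \<forall>s\<in>Zn n.
        W (vadd (vadd p q) s) * W (vsub p q) * W (vadd r s) * W r
      + W (vadd (vadd q r) s) * W (vsub q r) * W (vadd p s) * W p
      + W (vadd (vadd r p) s) * W (vsub r p) * W (vadd q s) * W q = 0)"

definition nondegenerate :: "nat \<Rightarrow> ((nat \<Rightarrow> int) \<Rightarrow> real) \<Rightarrow> bool" where
  "nondegenerate n W \<longleftrightarrow>
     (\<forall>i<n. W (unitv i) \<noteq> 0 \<and> W (vscale 2 (unitv i)) \<noteq> 0) \<and>
     (\<forall>i<n. \<forall>j<n. i \<noteq> j \<longrightarrow> W (vadd (unitv i) (unitv j)) \<noteq> 0 \<and> W (vsub (unitv i) (unitv j)) \<noteq> 0) \<and>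
     (n = 1 \<longrightarrow> W (vscale 3 (unitv 0)) \<noteq> 0)"

definition quadratic_form :: "nat \<Rightarrow> ((nat \<Rightarrow> int) \<Rightarrow> real) \<Rightarrow> bool" where
  "quadratic_form n f \<longleftrightarrow> (\<forall>v\<in>Zn n. f v \<noteq> 0) \<and>
     (\<forall>a\<in>Zn n. \<forall>b\<in>Zn n. \<forall>c\<in>Zn n.
        f (vadd (vadd a b) c) * inverse (f (vadd a b)) * inverse (f (vadd b c))
        * inverse (f (vadd c a)) * f a * f b * f c = 1)"

end

theory Submission
  imports Defs "HOL-Complex_Analysis.Complex_Analysis"
begin

text \<open>
  Write \<open>\<sigma>\<close> for the sigma function of the period lattice \<open>L\<close>. The invariants of \<open>L\<close> are real and
  determine \<open>L\<close> (they determine the Laurent expansion of \<open>\<wp>\<close> through its differential equation, and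
  \<open>L\<close> is the set of poles), so \<open>L\<close> is stable under conjugation. Since \<open>(\<wp>, \<wp>')\<close> is injective modulo
  \<open>L\<close>, the elliptic logarithm of a real point is \<open>x + k\<mu>/2\<close> with \<open>x\<close> real, \<open>k\<close> an integer and \<open>\<mu>\<close> a
  generator of the purely imaginary periods.

  Up to a factor that is the exponential of a quadratic form in \<open>(k, x)\<close>, the number \<open>\<sigma>(x + k\<mu>/2)\<close>
  is a real number \<open>g\<^sub>k(x)\<close>, and quadratic factors cancel in the net polynomials. Quasi-periodicity
  shows that \<open>g\<^sub>k\<^sub>+\<^sub>2\<close> and \<open>g\<^sub>k\<close> have opposite signs and that, as a function of \<open>x\<close>, the sign of \<open>g\<^sub>k\<close> is
  either a square wave whose half period is the real period \<open>\<omega>\<close> or, for odd \<open>k\<close> and rectangular \<open>L\<close>,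
  constant.

  All other factors of the net polynomial or of the elliptic net have signs depending only on \<open>v\<close>
  modulo 2. So along a line \<open>v + 2je\<^sub>d\<close> the sign is a square wave with an irrational step (the \<open>d\<close>-th
  point is not torsion) or alternates, provided \<open>d\<close> is chosen with \<open>k\<^sub>d\<close> odd whenever some \<open>k\<^sub>i\<close> is odd.
  In both cases the signs cancel along the line, uniformly in \<open>v\<close>. That the elliptic logarithms of
  linearly independent points are linearly independent modulo \<open>L\<close> is the addition theorem.
\<close>

subsection \<open>Lattices\<close>

text \<open>Two obstacles shape the argument. When \<open>L\<close> is rectangular and
  \<open>k\<close> is odd, the sign on the corresponding line does not depend on \<open>x\<close>,
  so irrationality gives nothing there. A step by \<open>2 * e_d\<close> changes \<open>k\<close> by
  \<open>2 * k_d\<close> and therefore multiplies the sign by \<open>(-1) ^ k_d\<close>; this is the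
  reason for wanting \<open>k_d\<close> odd. Where there is a square wave, the same factor amounts
  to moving its argument by the integer \<open>k_d\<close>, and the total step
  \<open>2 * x_d / om + k_d\<close> is again irrational. The second obstacle is the factor
  \<open>f\<close> of an elliptic net. The functional equation of a quadratic form does not make its
  sign periodic modulo 2: for \<open>n = 1\<close> the map \<open>(-1) ^ (v * (v - 1) / 2)\<close>
  satisfies it and has period 4. Evenness of \<open>f\<close> rules this out, and evenness follows
  because the net and the net polynomial are both odd in \<open>v\<close>. The rhombic case calls
  for the value of the exponential in Legendre's relation at the real and imaginary periods. It is
  read off from the constants in the transformation law of sigma for two periods and for their
  sum.\<close>

lemma summable_int_powr: "(\<lambda>a::int. (1 + \<bar>real_of_int a\<bar>) powr (-3/2)) summable_on UNIV"
proof -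
  have "summable (\<lambda>n. real (Suc n) powr (-3/2))"
    by (subst summable_Suc_iff) (simp add: summable_real_powr_iff)
  then have nat: "(\<lambda>n. (1 + real n) powr (-3/2)) summable_on UNIV"
    by (subst summable_on_UNIV_nonneg_real_iff) (auto simp: add_ac)
  have "(\<lambda>a::int. (1 + \<bar>real_of_int a\<bar>) powr (-3/2)) summable_on (range int \<union> range (\<lambda>n. - int n))"
  proof (rule summable_on_union)
    show "(\<lambda>a::int. (1 + \<bar>real_of_int a\<bar>) powr (-3/2)) summable_on range int"
      using nat by (subst summable_on_reindex) (auto simp: o_def inj_on_def)
    show "(\<lambda>a::int. (1 + \<bar>real_of_int a\<bar>) powr (-3/2)) summable_on range (\<lambda>n. - int n)"
      using nat by (subst summable_on_reindex) (auto simp: o_def inj_on_def)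
  qed
  moreover have "range int \<union> range (\<lambda>n. - int n) = UNIV"
    by (auto intro: int_cases2)
  ultimately show ?thesis by simp
qed

text \<open>A summable majorant gives uniform convergence along the net of finite subsets, so
  holomorphy and all derivatives pass to the limit. The second part is termwise differentiation in
  unconditional form.\<close>

lemma infsum_holomorphic:
  fixes f :: "'a \<Rightarrow> complex \<Rightarrow> complex"
  assumes B: "open B" and f: "\<And>w. w \<in> A \<Longrightarrow> f w holomorphic_on B"
    and le: "\<And>w z. w \<in> A \<Longrightarrow> z \<in> B \<Longrightarrow> norm (f w z) \<le> M w"
    and M: "M summable_on A"
  shows "(\<lambda>z. \<Sum>\<^sub>\<infinity>w\<in>A. f w z) holomorphic_on B"
    and "z \<in> B \<Longrightarrow> ((\<lambda>w. (deriv ^^ m) (f w) z) has_sum (deriv ^^ m) (\<lambda>z. \<Sum>\<^sub>\<infinity>w\<in>A. f w z) z) A"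
proof -
  let ?F = "\<lambda>z. \<Sum>\<^sub>\<infinity>w\<in>A. f w z"
  have ul: "uniform_limit B (\<lambda>X z. \<Sum>w\<in>X. f w z) ?F (finite_subsets_at_top A)"
    by (rule Weierstrass_m_test_general[OF le M]) auto
  have holX: "eventually (\<lambda>X. (\<lambda>z. \<Sum>w\<in>X. f w z) holomorphic_on B) (finite_subsets_at_top A)"
    by (rule eventually_finite_subsets_at_top_weakI) (auto intro!: holomorphic_intros f)
  have "?F holomorphic_on ball z r" if "cball z r \<subseteq> B" for z r
  proof (rule holomorphic_uniform_limit)
    show "uniform_limit (cball z r) (\<lambda>X z. \<Sum>w\<in>X. f w z) ?F (finite_subsets_at_top A)"
      by (rule uniform_limit_on_subset[OF ul that])
    show "\<forall>\<^sub>F X in finite_subsets_at_top A. continuous_on (cball z r) (\<lambda>z. \<Sum>w\<in>X. f w z)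
             \<and> (\<lambda>z. \<Sum>w\<in>X. f w z) holomorphic_on ball z r"
      using holX
    proof eventually_elim
      case (elim X)
      have "(\<lambda>z. \<Sum>w\<in>X. f w z) holomorphic_on cball z r"
        using elim that holomorphic_on_subset by blast
      then show ?case
        using holomorphic_on_imp_continuous_on holomorphic_on_subset ball_subset_cball by blast
    qed
  qed auto
  then show "?F holomorphic_on B"
    using B by (metis holomorphic_on_open open_contains_cball open_ball centre_in_ball)
  assume z: "z \<in> B"
  have "((\<lambda>X. (deriv ^^ m) (\<lambda>z. \<Sum>w\<in>X. f w z) z) \<longlongrightarrow> (deriv ^^ m) ?F z) (finite_subsets_at_top A)"
    by (rule higher_deriv_complex_uniform_limit[OF ul holX _ B z]) auto
  moreover have "\<forall>\<^sub>F X in finite_subsets_at_top A.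
     (deriv ^^ m) (\<lambda>z. \<Sum>w\<in>X. f w z) z = (\<Sum>w\<in>X. (deriv ^^ m) (f w) z)"
  proof (rule eventually_finite_subsets_at_top_weakI)
    fix X assume X: "finite X" "X \<subseteq> A"
    then show "(deriv ^^ m) (\<lambda>z. \<Sum>w\<in>X. f w z) z = (\<Sum>w\<in>X. (deriv ^^ m) (f w) z)"
    proof (induction X rule: finite_induct)
      case (insert w X)
      have "(deriv ^^ m) (\<lambda>z. f w z + (\<Sum>w\<in>X. f w z)) z
            = (deriv ^^ m) (f w) z + (deriv ^^ m) (\<lambda>z. \<Sum>w\<in>X. f w z) z"
        by (rule higher_deriv_add[where S = B]) (use B z insert.prems in \<open>auto intro!: f holomorphic_intros\<close>)
      then show ?case using insert by simp
    qed (simp add: higher_deriv_const)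
  qed
  ultimately show "((\<lambda>w. (deriv ^^ m) (f w) z) has_sum (deriv ^^ m) ?F z) A"
    unfolding has_sum_def by (rule Lim_transform_eventually)
qed

text \<open>The derivative of the left-hand side is \<open>- u^2 / (1 - u)\<close>, of norm at most
  \<open>2 * norm u ^ 2\<close> on the half disc. The cubic order is what makes the logarithms of
  the sigma factors summable over a lattice.\<close>

lemma norm_Ln_expansion_le:
  fixes u :: complex
  assumes "norm u \<le> 1/2"
  shows "norm (Ln (1 - u) + u + u^2/2) \<le> 2 * norm u ^ 3"
proof -
  let ?f = "\<lambda>u::complex. Ln (1 - u) + u + u^2/2"
  have Re: "Re (1 - x) > 0" if "x \<in> cball 0 (norm u)" for x
    using that assms abs_Re_le_cmod[of x] by auto
  have "norm (?f u - ?f 0) \<le> (2 * norm u ^ 2) * norm (u - 0)"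
  proof (rule field_differentiable_bound)
    show "convex (cball (0::complex) (norm u))" by simp
    fix x :: complex assume x: "x \<in> cball 0 (norm u)"
    then have nx: "norm x \<le> norm u" by simp
    have nz: "1 - x \<noteq> 0" and *: "1 - x \<notin> \<real>\<^sub>\<le>\<^sub>0" using Re[OF x] by (auto simp: complex_nonpos_Reals_iff)
    have "1 / 2 \<le> 1 - norm x" using nx assms by simp
    also have "1 - norm x \<le> norm (1 - x)" by (metis norm_one norm_triangle_ineq2)
    finally have n1: "1/2 \<le> norm (1 - x)" .
    have "(?f has_field_derivative - 1 / (1 - x) + 1 + x) (at x within cball 0 (norm u))"
      using * by (auto intro!: derivative_eq_intros simp: inverse_eq_divide)
    also have "- 1 / (1 - x) + 1 + x = - (x^2) / (1 - x)"
      using nz by (simp add: field_simps power2_eq_square)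
    finally show "(?f has_field_derivative - (x^2) / (1 - x)) (at x within cball 0 (norm u))" .
    have "norm (- (x^2) / (1 - x)) = norm x ^ 2 / norm (1 - x)"
      by (simp add: norm_divide norm_power)
    also have "\<dots> \<le> norm u ^ 2 / (1/2)"
      by (intro frac_le power_mono nx n1) auto
    finally show "norm (- (x^2) / (1 - x)) \<le> 2 * norm u ^ 2" by simp
  qed auto
  then show ?thesis by (simp add: power2_eq_square power3_eq_cube)
qed

text \<open>Logarithmic differentiation with the derivative of each factor written as factor times
  \<open>g w\<close>, so that no division occurs.\<close>

lemma has_field_derivative_prod_log:
  fixes f :: "'a \<Rightarrow> complex \<Rightarrow> complex"
  assumes "finite F" "\<And>w. w \<in> F \<Longrightarrow> (f w has_field_derivative f w z * g w) (at z)"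
  shows "((\<lambda>z. \<Prod>w\<in>F. f w z) has_field_derivative (\<Prod>w\<in>F. f w z) * (\<Sum>w\<in>F. g w)) (at z)"
  using assms
  by (induction F rule: finite_induct) (auto intro!: derivative_eq_intros simp: algebra_simps)

section \<open>Lattices of rank two: closure, coordinates, discreteness, convergence\<close>

locale period_lat =
  fixes L :: "complex set" and w1 w2 :: complex
  assumes Im_ratio: "Im (w2 / w1) \<noteq> 0"
    and L_eq: "L = {of_int a * w1 + of_int b * w2 | a b :: int. True}"
begin

lemma nz[simp]: "w1 \<noteq> 0" "w2 \<noteq> 0" using Im_ratio by auto

lemma zero_in[simp]: "0 \<in> L"
  unfolding L_eq by (rule CollectI, rule exI[of _ 0], rule exI[of _ 0]) simp

lemma w1_in[simp]: "w1 \<in> L"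
  unfolding L_eq by (rule CollectI, rule exI[of _ 1], rule exI[of _ 0]) simp

lemma w2_in[simp]: "w2 \<in> L"
  unfolding L_eq by (rule CollectI, rule exI[of _ 0], rule exI[of _ 1]) simp

lemma add_in: assumes "x \<in> L" "y \<in> L" shows "x + y \<in> L"
proof -
  obtain a b c d :: int where "x = of_int a * w1 + of_int b * w2" "y = of_int c * w1 + of_int d * w2"
    using assms unfolding L_eq by auto
  then have "x + y = of_int (a + c) * w1 + of_int (b + d) * w2" by (simp add: algebra_simps)
  then show ?thesis unfolding L_eq by blast
qed

lemma minus_in: assumes "x \<in> L" shows "- x \<in> L"
proof -
  obtain a b :: int where "x = of_int a * w1 + of_int b * w2"
    using assms unfolding L_eq by auto
  then have "- x = of_int (- a) * w1 + of_int (- b) * w2" by (simp add: algebra_simps)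
  then show ?thesis unfolding L_eq by blast
qed

lemma minus_in_iff[simp]: "- x \<in> L \<longleftrightarrow> x \<in> L"
  using minus_in[of x] minus_in[of "-x"] by auto

lemma diff_in: assumes "x \<in> L" "y \<in> L" shows "x - y \<in> L"
  using add_in[OF assms(1) minus_in[OF assms(2)]] by simp

lemma mult_int_in: assumes "x \<in> L" shows "of_int c * x \<in> L"
proof -
  obtain a b :: int where "x = of_int a * w1 + of_int b * w2"
    using assms unfolding L_eq by auto
  then have "of_int c * x = of_int (c * a) * w1 + of_int (c * b) * w2" by (simp add: algebra_simps)
  then show ?thesis unfolding L_eq by blast
qed

lemma add_in_iff: "w \<in> L \<Longrightarrow> z + w \<in> L \<longleftrightarrow> z \<in> L"
  using add_in diff_in by (metis add_diff_cancel_right')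

lemma diff_in_iff: "w \<in> L \<Longrightarrow> z - w \<in> L \<longleftrightarrow> z \<in> L"
  using add_in diff_in by (metis diff_add_cancel)

text \<open>Both coordinates are controlled by an imaginary part after division by
  \<open>w1\<close>. Uniqueness of coordinates, finiteness in discs and convergence of lattice sums
  all rest on this linear growth.\<close>

lemma norm_lower_bound:
  obtains c where "c > 0" "\<And>a b :: real. c * \<bar>a\<bar> \<le> norm (of_real a * w1 + of_real b * w2)"
    "\<And>a b :: real. c * \<bar>b\<bar> \<le> norm (of_real a * w1 + of_real b * w2)"
proof
  define t where "t = w2 / w1"
  have t: "t \<noteq> 0" "Im t \<noteq> 0" using Im_ratio by (auto simp: t_def)
  let ?c = "norm w1 * min \<bar>Im t\<bar> (\<bar>Im t\<bar> / norm t)"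
  show "?c > 0" using t by simp
  have eq: "norm (of_real a * w1 + of_real b * w2) = norm w1 * norm (of_real a + of_real b * t)" for a b
    unfolding t_def norm_mult[symmetric] by (simp add: distrib_left mult_ac)
  fix a b :: real
  have "\<bar>Im t\<bar> * \<bar>b\<bar> \<le> norm (of_real a + of_real b * t)"
    using abs_Im_le_cmod[of "of_real a + of_real b * t"] by (simp add: abs_mult mult.commute)
  then have "min \<bar>Im t\<bar> (\<bar>Im t\<bar> / norm t) * \<bar>b\<bar> \<le> norm (of_real a + of_real b * t)"
    by (smt (verit) mult_right_mono abs_ge_zero)
  then show "?c * \<bar>b\<bar> \<le> norm (of_real a * w1 + of_real b * w2)"
    unfolding eq by (simp add: mult.assoc mult_left_mono)
  \<comment> \<open>Multiplying by \<open>cnj t\<close> makes the \<open>b\<close> term real, which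
    isolates \<open>a\<close> in the imaginary part.\<close>
  have "\<bar>a\<bar> * \<bar>Im t\<bar> = \<bar>Im (of_real a * cnj t + of_real b * (t * cnj t))\<bar>"
    by (simp add: abs_mult)
  also have "\<dots> \<le> norm (of_real a * cnj t + of_real b * (t * cnj t))" by (rule abs_Im_le_cmod)
  also have "\<dots> = norm (of_real a + of_real b * t) * norm t"
    by (subst complex_mod_cnj[of t, symmetric], subst norm_mult[symmetric]) (simp add: algebra_simps)
  finally have "\<bar>Im t\<bar> / norm t * \<bar>a\<bar> \<le> norm (of_real a + of_real b * t)"
    using t by (simp add: field_simps)
  then have "min \<bar>Im t\<bar> (\<bar>Im t\<bar> / norm t) * \<bar>a\<bar> \<le> norm (of_real a + of_real b * t)"
    by (smt (verit) mult_right_mono abs_ge_zero)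
  then show "?c * \<bar>a\<bar> \<le> norm (of_real a * w1 + of_real b * w2)"
    unfolding eq by (simp add: mult.assoc mult_left_mono)
qed

lemma inj_coords: "inj (\<lambda>(a::int, b::int). of_int a * w1 + of_int b * w2)"
proof -
  obtain c where c: "c > 0" "\<And>a b :: real. c * \<bar>a\<bar> \<le> norm (of_real a * w1 + of_real b * w2)"
    "\<And>a b :: real. c * \<bar>b\<bar> \<le> norm (of_real a * w1 + of_real b * w2)"
    using norm_lower_bound by blast
  show ?thesis
  proof (rule injI, clarify)
    fix a b a' b' :: int
    assume *: "of_int a * w1 + of_int b * w2 = of_int a' * w1 + of_int b' * w2"
    have z: "of_real (real_of_int (a - a')) * w1 + of_real (real_of_int (b - b')) * w2 = 0"
      using * by (simp add: algebra_simps)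
    show "a = a' \<and> b = b'"
      using c(2)[of "real_of_int (a - a')" "real_of_int (b - b')", unfolded z]
        c(3)[of "real_of_int (b - b')" "real_of_int (a - a')", unfolded z] c(1)
      by (auto simp: mult_le_0_iff)
  qed
qed

lemma half_notin: "w1 / 2 \<notin> L" "w2 / 2 \<notin> L"
proof -
  have dbl: "of_int (2 * a) * w1 + of_int (2 * b) * w2 = 2 * (of_int a * w1 + of_int b * w2)" for a b
    by (simp add: algebra_simps)
  have "of_int a * w1 + of_int b * w2 \<noteq> w1 / 2" for a b
  proof
    assume h: "of_int a * w1 + of_int b * w2 = w1 / 2"
    have "of_int (2 * a) * w1 + of_int (2 * b) * w2 = w1" unfolding dbl h by simp
    then have "(2 * a, 2 * b) = (1, 0::int)"
      using injD[OF inj_coords, of "(2*a, 2*b)" "(1, 0)"] by simp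
    then show False by simp presburger
  qed
  then show "w1 / 2 \<notin> L" unfolding L_eq mem_Collect_eq by metis
  have "of_int a * w1 + of_int b * w2 \<noteq> w2 / 2" for a b
  proof
    assume h: "of_int a * w1 + of_int b * w2 = w2 / 2"
    have "of_int (2 * a) * w1 + of_int (2 * b) * w2 = w2" unfolding dbl h by simp
    then have "(2 * a, 2 * b) = (0::int, 1)"
      using injD[OF inj_coords, of "(2*a, 2*b)" "(0, 1)"] by simp
    then show False by simp presburger
  qed
  then show "w2 / 2 \<notin> L" unfolding L_eq mem_Collect_eq by metis
qed

lemma finite_disc: "finite {w \<in> L. norm w \<le> R}"
proof -
  obtain c where c: "c > 0" "\<And>a b :: real. c * \<bar>a\<bar> \<le> norm (of_real a * w1 + of_real b * w2)"
    "\<And>a b :: real. c * \<bar>b\<bar> \<le> norm (of_real a * w1 + of_real b * w2)"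
    using norm_lower_bound by blast
  define K where "K = \<lceil>R / c\<rceil>"
  have bd: "\<bar>a\<bar> \<le> K" if "c * \<bar>real_of_int a\<bar> \<le> R" for a
  proof -
    have "\<bar>real_of_int a\<bar> \<le> R / c" using that c(1) by (simp add: field_simps)
    then show ?thesis unfolding K_def by linarith
  qed
  have "{w \<in> L. norm w \<le> R} \<subseteq> (\<lambda>(a::int, b::int). of_int a * w1 + of_int b * w2) ` ({-K..K} \<times> {-K..K})"
  proof clarify
    fix w assume w: "w \<in> L" "norm w \<le> R"
    then obtain a b :: int where ab: "w = of_int a * w1 + of_int b * w2" unfolding L_eq by auto
    have "\<bar>a\<bar> \<le> K" "\<bar>b\<bar> \<le> K"
      using bd[of a] bd[of b] c(2)[of a b] c(3)[of b a] w(2) ab by auto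
    then show "w \<in> (\<lambda>(a::int, b::int). of_int a * w1 + of_int b * w2) ` ({-K..K} \<times> {-K..K})"
      using ab by (intro image_eqI[of _ _ "(a, b)"]) auto
  qed
  then show ?thesis by (rule finite_subset) auto
qed

lemma countable_L: "countable L"
proof -
  have "L = (\<lambda>(a::int, b::int). of_int a * w1 + of_int b * w2) ` UNIV" unfolding L_eq by auto
  then show ?thesis by simp
qed

text \<open>The norm of a nonzero lattice point dominates a multiple of \<open>1 + |a|\<close> and
  of \<open>1 + |b|\<close>. Its cube hence dominates the product of their powers with exponent 3/2,
  and the double sum splits into a product of convergent sums.\<close>

lemma summable_norm3: "(\<lambda>w. 1 / norm w ^ 3) summable_on (L - {0})"
proof -
  obtain c where c: "c > 0" "\<And>a b :: real. c * \<bar>a\<bar> \<le> norm (of_real a * w1 + of_real b * w2)"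
    "\<And>a b :: real. c * \<bar>b\<bar> \<le> norm (of_real a * w1 + of_real b * w2)"
    using norm_lower_bound by blast
  let ?g = "\<lambda>(a::int, b::int). of_int a * w1 + of_int b * w2"
  let ?p = "\<lambda>a::int. (1 + \<bar>real_of_int a\<bar>) powr (-3/2)"
  have "(\<lambda>(a, b). ?p a * ?p b) summable_on (UNIV \<times> UNIV)"
  proof (rule summable_on_SigmaI[where g = "\<lambda>a. ?p a * infsum ?p UNIV"])
    show "((\<lambda>y. case (a, y) of (a, b) \<Rightarrow> ?p a * ?p b) has_sum ?p a * infsum ?p UNIV) UNIV" for a
      unfolding prod.case by (intro has_sum_cmult_right has_sum_infsum summable_int_powr)
    show "(\<lambda>a. ?p a * infsum ?p UNIV) summable_on UNIV"
      by (intro summable_on_cmult_left summable_int_powr)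
  qed auto
  then have s: "(\<lambda>x. 8 / c ^ 3 * (case x of (a, b) \<Rightarrow> ?p a * ?p b)) summable_on (UNIV - {(0,0)})"
    by (intro summable_on_cmult_right) (auto intro: summable_on_subset_banach)
  have "((\<lambda>w. 1 / norm w ^ 3) \<circ> ?g) summable_on (UNIV - {(0,0)})"
  proof (rule summable_on_comparison_test[OF s])
    fix x :: "int \<times> int" assume x: "x \<in> UNIV - {(0,0)}"
    obtain a b where ab: "x = (a, b)" by (cases x)
    let ?N = "norm (?g x)"
    have N: "c * \<bar>real_of_int a\<bar> \<le> ?N" "c * \<bar>real_of_int b\<bar> \<le> ?N" using c(2)[of a b] c(3)[of b a] ab by auto
    have "a \<noteq> 0 \<or> b \<noteq> 0" using x ab by auto
    then have "1 \<le> \<bar>a\<bar> \<or> 1 \<le> \<bar>b\<bar>" by linarith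
    then have "1 \<le> \<bar>real_of_int a\<bar> \<or> 1 \<le> \<bar>real_of_int b\<bar>" by linarith
    then have "c * 1 \<le> c * \<bar>real_of_int a\<bar> \<or> c * 1 \<le> c * \<bar>real_of_int b\<bar>"
      using c(1) by (simp only: mult_le_cancel_left_pos)
    then have cN: "c \<le> ?N" using N by linarith
    \<comment> \<open>Average of \<open>c \<le> ?N\<close> and \<open>c * |a| \<le> ?N\<close>; the
      resulting factor \<open>c / 2\<close> produces the constant \<open>8 / c ^ 3\<close>.\<close>
    have 1: "c * (1 + \<bar>real_of_int a\<bar>) / 2 \<le> ?N" "c * (1 + \<bar>real_of_int b\<bar>) / 2 \<le> ?N"
      using N cN by (auto simp: algebra_simps)
    let ?A = "c * (1 + \<bar>real_of_int a\<bar>) / 2" and ?B = "c * (1 + \<bar>real_of_int b\<bar>) / 2"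
    have "?A > 0" "?B > 0" using c(1) by (auto intro!: mult_pos_pos add_pos_nonneg)
    moreover have "?N > 0" using cN c(1) by linarith
    ultimately have pos: "?A > 0" "?B > 0" "?N > 0" by auto
    have "?A powr (3/2) * ?B powr (3/2) \<le> ?N powr (3/2) * ?N powr (3/2)"
      by (intro mult_mono powr_mono2 1) (use pos in auto)
    also have "\<dots> = ?N ^ 3" using pos(3) powr_add[of ?N "3/2" "3/2"] powr_realpow[of ?N 3] by simp
    finally have le: "?A powr (3/2) * ?B powr (3/2) \<le> ?N ^ 3" .
    have "(c * (1 + x) / 2) powr (3/2) = (c/2) powr (3/2) * (1 + x) powr (3/2)" if "x \<ge> 0" for x
      using c(1) that powr_mult[of "c/2" "1 + x" "3/2"] by simp
    from this[of "\<bar>real_of_int a\<bar>"] this[of "\<bar>real_of_int b\<bar>"]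
    have "?A powr (3/2) = (c/2) powr (3/2) * (1 + \<bar>real_of_int a\<bar>) powr (3/2)"
      "?B powr (3/2) = (c/2) powr (3/2) * (1 + \<bar>real_of_int b\<bar>) powr (3/2)" by simp_all
    moreover have "(c/2) powr (3/2) * (c/2) powr (3/2) = c ^ 3 / 8"
      using c(1) powr_add[of "c/2" "3/2" "3/2"] powr_realpow[of "c/2" 3] by (simp add: power_divide)
    ultimately have AB: "?A powr (3/2) * ?B powr (3/2) = c^3/8 * ((1 + \<bar>real_of_int a\<bar>) powr (3/2) * (1 + \<bar>real_of_int b\<bar>) powr (3/2))"
      by (simp add: mult_ac)
    have "1 / ?N ^ 3 \<le> 1 / (?A powr (3/2) * ?B powr (3/2))"
      using le pos by (intro divide_left_mono) (auto intro!: mult_pos_pos)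
    also have "\<dots> = 8 / c ^ 3 * (?p a * ?p b)"
      unfolding AB by (simp add: powr_minus divide_simps)
    finally show "((\<lambda>w. 1 / norm w ^ 3) \<circ> ?g) x \<le> 8 / c ^ 3 * (case x of (a, b) \<Rightarrow> ?p a * ?p b)"
      using ab by simp
  qed auto
  moreover have "inj_on ?g (UNIV - {(0,0)})" using inj_coords by (rule inj_on_subset) auto
  moreover have "?g ` (UNIV - {(0,0)}) = L - {0}"
  proof -
    have "?g ` (UNIV - {(0,0)}) = ?g ` UNIV - ?g ` {(0,0)}"
      by (rule image_set_diff[OF inj_coords])
    also have "?g ` UNIV = L" unfolding L_eq by auto
    finally show ?thesis by simp
  qed
  ultimately show ?thesis using summable_on_reindex[of ?g] by metis
qed

end

subsection \<open>The Weierstrass sigma, zeta and elliptic functions\<close>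

abbreviation sigma_factor :: "complex \<Rightarrow> complex \<Rightarrow> complex" where
  "sigma_factor w z \<equiv> (1 - z / w) * exp (z / w + (z / w) ^ 2 / 2)"

text \<open>A logarithm of one sigma factor. With the principal branch it is holomorphic for
  \<open>norm z < norm w\<close>, where \<open>1 - z / w\<close> has positive real part.\<close>

definition log_factor :: "complex \<Rightarrow> complex \<Rightarrow> complex" where
  "log_factor w z = Ln (1 - z / w) + z / w + (z / w)^2 / 2"

lemma log_factor_has_deriv:
  assumes "w \<noteq> 0" "norm z < norm w"
  shows "(log_factor w has_field_derivative (1 / w + z / w^2 - 1 / (w - z))) (at z)"
proof -
  have "norm (z / w) < 1" using assms by (simp add: norm_divide)
  then have "Re (z / w) < 1" using abs_Re_le_cmod[of "z / w"] by linarith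
  then have *: "1 - z / w \<notin> \<real>\<^sub>\<le>\<^sub>0" by (auto simp: complex_nonpos_Reals_iff)
  have "z \<noteq> w" using assms by auto
  then show ?thesis
    unfolding log_factor_def [abs_def] using * assms(1)
    by (auto intro!: derivative_eq_intros simp: field_simps power2_eq_square)
qed

text \<open>The polynomial corrections disappear after two differentiations, hence three formulas.
  Up to sign the second and third derivatives are the summands of \<open>wp\<close> and
  \<open>wp'\<close>, and the values at 0 from the third derivative on are multiples of the
  Eisenstein summands.\<close>

lemma log_factor_deriv_iter:
  assumes "norm z < norm w"
  shows "deriv (log_factor w) z = 1 / w + z / w^2 - 1 / (w - z)"
    and "(deriv ^^ 2) (log_factor w) z = 1 / w^2 - 1 / (w - z)^2"
    and "(deriv ^^ (m + 3)) (log_factor w) z = - fact (m + 2) / (w - z) ^ (m + 3)"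
proof -
  have ev: "\<forall>\<^sub>F x in nhds z. norm x < norm w" if "norm z < norm w" for z
  proof -
    have "\<forall>\<^sub>F x in nhds z. x \<in> ball 0 (norm w)"
      by (rule eventually_nhds_in_open) (use that in auto)
    then show ?thesis by simp
  qed
  have d1: "deriv (log_factor w) z = 1 / w + z / w^2 - 1 / (w - z)" if "norm z < norm w" for z
    using that by (intro DERIV_imp_deriv log_factor_has_deriv) auto
  have d2: "(deriv ^^ 2) (log_factor w) z = 1 / w^2 - 1 / (w - z)^2" if z: "norm z < norm w" for z
  proof -
    have nz: "w - z \<noteq> 0" "w \<noteq> 0" using z by auto
    have "(deriv ^^ 2) (log_factor w) z = deriv (deriv (log_factor w)) z" by (simp add: numeral_2_eq_2)
    also have "\<dots> = deriv (\<lambda>z. 1 / w + z / w^2 - 1 / (w - z)) z"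
      by (intro deriv_cong_ev refl eventually_mono[OF ev[OF z]] d1)
    also have "\<dots> = 1 / w^2 - 1 / (w - z)^2"
      using nz by (intro DERIV_imp_deriv) (auto intro!: derivative_eq_intros simp: power2_eq_square)
    finally show ?thesis .
  qed
  have d3: "(deriv ^^ (m + 3)) (log_factor w) z = - fact (m + 2) / (w - z) ^ (m + 3)"
    if z: "norm z < norm w" for z
    using z
  proof (induction m arbitrary: z)
    case 0
    then have nz: "w - z \<noteq> 0" by auto
    have "(deriv ^^ 3) (log_factor w) z = deriv ((deriv ^^ 2) (log_factor w)) z"
      by (simp add: numeral_3_eq_3 numeral_2_eq_2)
    also have "\<dots> = deriv (\<lambda>z. 1 / w^2 - 1 / (w - z)^2) z"
      by (intro deriv_cong_ev refl eventually_mono[OF ev[OF 0]] d2)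
    also have "\<dots> = - 2 / (w - z)^3"
      using nz by (intro DERIV_imp_deriv, auto intro!: derivative_eq_intros) (simp add: divide_simps eval_nat_numeral)
    finally show ?case by simp
  next
    case (Suc m)
    then have nz: "w - z \<noteq> 0" by auto
    have "(deriv ^^ (Suc m + 3)) (log_factor w) z = deriv ((deriv ^^ (m + 3)) (log_factor w)) z"
      by (simp only: add_Suc funpow.simps o_apply)
    also have "\<dots> = deriv (\<lambda>z. - fact (m + 2) / (w - z) ^ (m + 3)) z"
      by (intro deriv_cong_ev refl eventually_mono[OF ev[OF Suc.prems]] Suc.IH)
    also have "\<dots> = - fact (m + 2) * of_nat (m + 3) * (w - z) ^ (m + 2) / ((w - z) ^ (m + 3))\<^sup>2"
      using nz by (intro DERIV_imp_deriv) (auto intro!: derivative_eq_intros simp: power2_eq_square)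
    also have "\<dots> = - (fact (m + 2) * of_nat (m + 3)) / (w - z) ^ (Suc m + 3)"
      using nz by (simp add: divide_simps power2_eq_square power_add eval_nat_numeral)
    also have "fact (m + 2) * of_nat (m + 3) = (fact (Suc m + 2) :: complex)"
      by (simp add: algebra_simps)
    finally show ?case .
  qed
  show "deriv (log_factor w) z = 1 / w + z / w^2 - 1 / (w - z)" by (rule d1[OF assms])
  show "(deriv ^^ 2) (log_factor w) z = 1 / w^2 - 1 / (w - z)^2" by (rule d2[OF assms])
  show "(deriv ^^ (m + 3)) (log_factor w) z = - fact (m + 2) / (w - z) ^ (m + 3)" by (rule d3[OF assms])
qed

lemma exp_log_factor:
  assumes "norm z < norm w"
  shows "exp (log_factor w z) = sigma_factor w z"
proof -
  have "1 - z / w \<noteq> 0" using assms by (auto simp: field_simps)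
  then show ?thesis unfolding log_factor_def by (simp add: exp_add mult_ac)
qed

lemma norm_log_factor_le:
  assumes "w \<noteq> 0" "2 * norm z \<le> norm w"
  shows "norm (log_factor w z) \<le> 2 * norm z ^ 3 * (1 / norm w ^ 3)"
proof -
  have "norm (z / w) \<le> 1/2" using assms by (simp add: norm_divide field_simps)
  from norm_Ln_expansion_le[OF this] show ?thesis
    unfolding log_factor_def by (simp add: norm_divide power_divide)
qed

context period_lat
begin

abbreviation disc :: "nat \<Rightarrow> complex set" where "disc N \<equiv> {w \<in> L. w \<noteq> 0 \<and> norm w \<le> real N}"

text \<open>For arguments in the ball of radius \<open>R\<close>, the cut at \<open>2 * R\<close>
  ensures \<open>norm (z / w) \<le> 1/2\<close> on the tail, the range of the cubic logarithm
  estimate.\<close>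

definition head :: "real \<Rightarrow> complex set" where "head R = {w \<in> L. w \<noteq> 0 \<and> norm w < 2 * R}"
definition tail :: "real \<Rightarrow> complex set" where "tail R = {w \<in> L. w \<noteq> 0 \<and> 2 * R \<le> norm w}"
definition log_tail :: "real \<Rightarrow> complex \<Rightarrow> complex" where
  "log_tail R z = (\<Sum>\<^sub>\<infinity>w\<in>tail R. log_factor w z)"

lemma head_Un_tail: "head R \<union> tail R = L - {0}" "head R \<inter> tail R = {}"
  unfolding head_def tail_def by auto

lemma finite_head: "finite (head R)"
  by (rule finite_subset[OF _ finite_disc[of "2 * R"]]) (auto simp: head_def)

text \<open>On the ball the majorant \<open>2 * R ^ 3 / norm w ^ 3\<close> is independent of
  \<open>z\<close> and summable over the tail.\<close>

lemma
  shows log_tail_holomorphic: "log_tail R holomorphic_on ball 0 R"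
    and log_tail_has_sum: "z \<in> ball 0 R \<Longrightarrow>
      ((\<lambda>w. (deriv ^^ m) (log_factor w) z) has_sum (deriv ^^ m) (log_tail R) z) (tail R)"
proof -
  have 1: "log_factor w holomorphic_on ball 0 R" if "w \<in> tail R" for w
  proof (subst holomorphic_on_open)
    show "\<forall>x\<in>ball 0 R. \<exists>f'. (log_factor w has_field_derivative f') (at x)"
    proof
      fix x :: complex assume "x \<in> ball 0 R"
      then have "norm x < R" by simp
      moreover have "2 * R \<le> norm w" "w \<noteq> 0" using that by (auto simp: tail_def)
      moreover have "0 \<le> norm x" by simp
      ultimately have "norm x < norm w" by linarith
      then show "\<exists>f'. (log_factor w has_field_derivative f') (at x)"
        using log_factor_has_deriv[OF \<open>w \<noteq> 0\<close>] by blast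
    qed
  qed auto
  have 2: "norm (log_factor w z) \<le> 2 * R ^ 3 * (1 / norm w ^ 3)" if "w \<in> tail R" "z \<in> ball 0 R" for w z
  proof -
    have "norm (log_factor w z) \<le> 2 * norm z ^ 3 * (1 / norm w ^ 3)"
      using that by (intro norm_log_factor_le) (auto simp: tail_def)
    also have "\<dots> \<le> 2 * R ^ 3 * (1 / norm w ^ 3)"
      using that by (intro mult_right_mono mult_left_mono power_mono) auto
    finally show ?thesis .
  qed
  have 3: "(\<lambda>w. 2 * R ^ 3 * (1 / norm w ^ 3)) summable_on tail R"
    using head_Un_tail(1)[of R] summable_on_subset_banach[OF summable_norm3, of "tail R"]
    by (intro summable_on_cmult_right) auto
  have eq: "log_tail R = (\<lambda>z. \<Sum>\<^sub>\<infinity>w\<in>tail R. log_factor w z)" by (simp add: log_tail_def fun_eq_iff)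
  show "log_tail R holomorphic_on ball 0 R"
    unfolding eq by (rule infsum_holomorphic(1)[OF _ 1 2 3]) auto
  show "((\<lambda>w. (deriv ^^ m) (log_factor w) z) has_sum (deriv ^^ m) (log_tail R) z) (tail R)"
    if "z \<in> ball 0 R"
    unfolding eq by (rule infsum_holomorphic(2)[OF _ 1 2 3 that]) auto
qed

lemma norm_less_tail: "(z::complex) \<in> ball 0 R \<Longrightarrow> w \<in> tail R \<Longrightarrow> norm z < norm w"
  unfolding tail_def mem_ball dist_0_norm mem_Collect_eq
  by (elim conjE) (use norm_ge_zero[of z] in linarith)

text \<open>Connects unconditional sums with the limit over growing discs by which
  \<open>sigma\<close> is defined.\<close>

lemma filterlim_discs:
  assumes "A \<subseteq> L"
  shows "filterlim (\<lambda>N::nat. {w \<in> A. norm w \<le> real N}) (finite_subsets_at_top A) sequentially"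
  unfolding filterlim_finite_subsets_at_top
proof (intro allI impI)
  fix X assume X: "finite X \<and> X \<subseteq> A"
  obtain N where N: "\<And>w. w \<in> X \<Longrightarrow> norm w \<le> real N"
    using X by (metis finite_imp_bounded bounded_iff real_arch_simple order_trans)
  have fin: "finite {w \<in> A. norm w \<le> real n}" for n
    by (rule finite_subset[OF _ finite_disc[of "real n"]]) (use assms in auto)
  show "\<forall>\<^sub>F n in sequentially. finite {w \<in> A. norm w \<le> real n} \<and> X \<subseteq> {w \<in> A. norm w \<le> real n}
     \<and> {w \<in> A. norm w \<le> real n} \<subseteq> A"
    using eventually_ge_at_top[of N]
    by eventually_elim (use X N fin in \<open>force intro: order_trans\<close>)
qed

abbreviation sg :: "complex \<Rightarrow> complex" where "sg \<equiv> sigma L"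

text \<open>Once the disc contains the head, the partial product is the head product times the
  exponential of a partial sum of tail logarithms. This justifies the \<open>lim\<close> in the
  definition of \<open>sigma\<close>.\<close>

lemma sigma_partial_LIMSEQ:
  assumes z: "z \<in> ball 0 R"
  shows "(\<lambda>N::nat. z * (\<Prod>w\<in>disc N. sigma_factor w z))
      \<longlonglongrightarrow> z * (\<Prod>w\<in>head R. sigma_factor w z) * exp (log_tail R z)"
proof -
  let ?E = "\<lambda>w. sigma_factor w z"
  have R: "R > 0" using z norm_ge_zero[of z] by (simp del: norm_ge_zero)
  have "((\<lambda>w. log_factor w z) has_sum log_tail R z) (tail R)"
    using log_tail_has_sum[OF z, of 0] by simp
  then have "(\<lambda>N. \<Sum>w\<in>{w \<in> tail R. norm w \<le> real N}. log_factor w z) \<longlonglongrightarrow> log_tail R z"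
    unfolding has_sum_def by (rule filterlim_compose) (rule filterlim_discs, auto simp: tail_def)
  then have "(\<lambda>N. z * (\<Prod>w\<in>head R. ?E w) * exp (\<Sum>w\<in>{w \<in> tail R. norm w \<le> real N}. log_factor w z))
      \<longlonglongrightarrow> z * (\<Prod>w\<in>head R. ?E w) * exp (log_tail R z)"
    by (intro tendsto_intros)
  moreover have "\<forall>\<^sub>F N in sequentially. z * (\<Prod>w\<in>head R. ?E w) * exp (\<Sum>w\<in>{w \<in> tail R. norm w \<le> real N}. log_factor w z)
     = z * (\<Prod>w\<in>disc N. ?E w)"
    using eventually_ge_at_top[of "nat \<lceil>2 * R\<rceil>"]
  proof eventually_elim
    case (elim N)
    then have "2 * R \<le> real N" by linarith
    then have *: "disc N = head R \<union> {w \<in> tail R. norm w \<le> real N}"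
      unfolding head_def tail_def by auto
    have fin: "finite {w \<in> tail R. norm w \<le> real N}"
      by (rule finite_subset[OF _ finite_disc[of "real N"]]) (auto simp: tail_def)
    have "exp (\<Sum>w\<in>{w \<in> tail R. norm w \<le> real N}. log_factor w z)
       = (\<Prod>w\<in>{w \<in> tail R. norm w \<le> real N}. exp (log_factor w z))"
      using fin by (rule exp_sum)
    also have "\<dots> = (\<Prod>w\<in>{w \<in> tail R. norm w \<le> real N}. ?E w)"
      using norm_less_tail[OF z] by (intro prod.cong refl exp_log_factor) auto
    finally show ?case
      unfolding * using head_Un_tail(2)[of R]
      by (subst prod.union_disjoint) (use fin finite_head in auto)
  qed
  ultimately show ?thesis by (rule Lim_transform_eventually)
qed

lemma sigma_eq:
  assumes z: "z \<in> ball 0 R"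
  shows "sg z = z * (\<Prod>w\<in>head R. sigma_factor w z) * exp (log_tail R z)"
  unfolding sigma_def by (rule limI[OF sigma_partial_LIMSEQ[OF z]])

lemma sigma_LIMSEQ:
  "(\<lambda>N::nat. z * (\<Prod>w\<in>disc N. sigma_factor w z))
      \<longlonglongrightarrow> sg z"
proof -
  obtain R where R: "z \<in> ball 0 R" using gt_ex[of "norm z"] by auto
  show ?thesis using sigma_partial_LIMSEQ[OF R] sigma_eq[OF R] by simp
qed

lemma sigma_holomorphic: "sg holomorphic_on A"
proof -
  have "sg holomorphic_on ball 0 R" for R
  proof (rule holomorphic_transform)
    show "(\<lambda>z. z * (\<Prod>w\<in>head R. sigma_factor w z) * exp (log_tail R z))
       holomorphic_on ball 0 R"
      by (intro holomorphic_intros log_tail_holomorphic) (auto simp: head_def)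
  qed (rule sigma_eq[symmetric])
  then have "\<exists>f'. (sg has_field_derivative f') (at z)" for z
    using gt_ex[of "norm z"] by (metis holomorphic_on_open open_ball dist_0_norm mem_ball)
  then have "sg holomorphic_on UNIV" by (simp add: holomorphic_on_open)
  then show ?thesis using holomorphic_on_subset by blast
qed

text \<open>In the local product formula the exponential never vanishes, so only \<open>z\<close>
  itself and the finitely many head factors can produce a zero.\<close>

lemma sigma_eq_0_iff: "sg z = 0 \<longleftrightarrow> z \<in> L"
proof -
  obtain R where R: "norm z < R" using lt_ex by (meson gt_ex)
  then have "sg z = 0 \<longleftrightarrow> z = 0 \<or> (\<exists>w\<in>head R. 1 - z / w = 0)"
    using finite_head[of R] by (subst sigma_eq[of z R]) auto
  also have "\<dots> \<longleftrightarrow> z \<in> L"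
  proof -
    have "(\<exists>w\<in>head R. 1 - z / w = 0) \<longleftrightarrow> z \<in> head R"
      by (auto simp: head_def)
    also have "\<dots> \<longleftrightarrow> z \<in> L \<and> z \<noteq> 0"
      using R norm_ge_zero[of z] unfolding head_def by (auto simp del: norm_ge_zero)
    finally show ?thesis by auto
  qed
  finally show ?thesis .
qed

lemma open_compl: "open (- L)"
proof -
  have "closed L"
    unfolding closed_limpt
  proof (intro allI impI)
    fix x assume x: "x islimpt L"
    have "x islimpt {w \<in> L. norm w \<le> norm x + 1}"
      unfolding islimpt_approachable
    proof (intro allI impI)
      fix e :: real assume e: "e > 0"
      then obtain y where y: "y \<in> L" "y \<noteq> x" "dist y x < min e 1"
        using x unfolding islimpt_approachable by (meson min_less_iff_conj zero_less_one)
      have "norm y \<le> norm x + norm (y - x)" using norm_triangle_ineq[of x "y - x"] by simp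
      then show "\<exists>x'\<in>{w \<in> L. norm w \<le> norm x + 1}. x' \<noteq> x \<and> dist x' x < e"
        using y by (intro bexI[of _ y]) (auto simp: dist_norm)
    qed
    then show "x \<in> L" using finite_disc islimpt_finite by blast
  qed
  then show ?thesis by (rule open_Compl)
qed

text \<open>Removing a countable set leaves the plane connected. Hence a function with derivative
  zero off \<open>L\<close> is constant there, the source of most identities below.\<close>

lemma connected_compl: "connected (- L)"
proof -
  have "connected (UNIV - L)"
    by (rule connected_open_diff_countable) (auto simp: countable_L)
  then show ?thesis by (simp add: Compl_eq_Diff_UNIV)
qed

section \<open>Elliptic functions as derivatives of the logarithm of sigma\<close>

text \<open>The tails of the defining sums are derivatives of \<open>log_tail\<close>, already known
  to be holomorphic; no separate convergence argument for \<open>wp\<close> and \<open>wp'\<close>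
  remains.\<close>

lemma
  assumes z: "z \<in> ball 0 R" "z \<notin> L"
  shows wp_eq: "wp L z = 1 / z ^ 2 + (\<Sum>w\<in>head R. 1 / (z - w) ^ 2 - 1 / w ^ 2) - (deriv ^^ 2) (log_tail R) z"
    and wp'_eq: "wp' L z = - 2 / z ^ 3 - 2 * (\<Sum>w\<in>head R. 1 / (z - w) ^ 3) - (deriv ^^ 3) (log_tail R) z"
proof -
  have "((\<lambda>w. 1 / w ^ 2 - 1 / (w - z) ^ 2) has_sum (deriv ^^ 2) (log_tail R) z) (tail R)"
    using log_tail_has_sum[OF z(1), of 2]
    by (rule has_sum_cong[THEN iffD1, rotated]) (use norm_less_tail[OF z(1)] in \<open>auto simp: log_factor_deriv_iter(2)\<close>)
  then have "((\<lambda>w. - (1 / w ^ 2 - 1 / (w - z) ^ 2)) has_sum - (deriv ^^ 2) (log_tail R) z) (tail R)"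
    by (rule has_sum_uminusI)
  moreover have "(\<lambda>w. - (1 / w ^ 2 - 1 / (w - z) ^ 2)) = (\<lambda>w. 1 / (z - w) ^ 2 - 1 / w ^ 2)"
    by (auto simp: power2_commute)
  ultimately have "((\<lambda>w. 1 / (z - w) ^ 2 - 1 / w ^ 2) has_sum
      (\<Sum>w\<in>head R. 1 / (z - w) ^ 2 - 1 / w ^ 2) + - (deriv ^^ 2) (log_tail R) z) (head R \<union> tail R)"
    by (intro has_sum_Un_disjoint has_sum_finite finite_head) (auto simp: head_Un_tail)
  then show "wp L z = 1 / z ^ 2 + (\<Sum>w\<in>head R. 1 / (z - w) ^ 2 - 1 / w ^ 2) - (deriv ^^ 2) (log_tail R) z"
    unfolding wp_def head_Un_tail by (simp add: infsumI)
  have "((\<lambda>w. - 2 / (w - z) ^ 3) has_sum (deriv ^^ 3) (log_tail R) z) (tail R)"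
    using log_tail_has_sum[OF z(1), of 3]
    by (rule has_sum_cong[THEN iffD1, rotated])
       (use norm_less_tail[OF z(1)] log_factor_deriv_iter(3)[of z _ 0] in \<open>auto simp: eval_nat_numeral\<close>)
  then have "((\<lambda>w. 1/2 * (- 2 / (w - z) ^ 3)) has_sum 1/2 * (deriv ^^ 3) (log_tail R) z) (tail R)"
    by (rule has_sum_cmult_right)
  moreover have "(\<lambda>w. 1/2 * (- 2 / (w - z) ^ 3)) = (\<lambda>w. 1 / (z - w) ^ 3)"
  proof
    fix w
    have "(z - w) ^ 3 = - ((w - z) ^ 3)" by (simp add: eval_nat_numeral algebra_simps)
    then show "1/2 * (- 2 / (w - z) ^ 3) = 1 / (z - w) ^ 3" by simp
  qed
  ultimately have "((\<lambda>w. 1 / (z - w) ^ 3) has_sum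
      (\<Sum>w\<in>head R. 1 / (z - w) ^ 3) + 1/2 * (deriv ^^ 3) (log_tail R) z) (head R \<union> tail R)"
    by (intro has_sum_Un_disjoint has_sum_finite finite_head) (auto simp: head_Un_tail)
  then have "((\<lambda>w. 1 / (z - w) ^ 3) has_sum
      (\<Sum>w\<in>{0}. 1 / (z - w) ^ 3) + ((\<Sum>w\<in>head R. 1 / (z - w) ^ 3) + 1/2 * (deriv ^^ 3) (log_tail R) z))
      ({0} \<union> (head R \<union> tail R))"
    by (rule has_sum_Un_disjoint[OF has_sum_finite[of "{0}"], rotated]) (auto simp: head_Un_tail)
  moreover have "{0} \<union> (head R \<union> tail R) = L" unfolding head_Un_tail by auto
  ultimately have "infsum (\<lambda>w. 1 / (z - w) ^ 3) L
     = 1 / z ^ 3 + ((\<Sum>w\<in>head R. 1 / (z - w) ^ 3) + 1/2 * (deriv ^^ 3) (log_tail R) z)"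
    by (simp add: infsumI)
  then show "wp' L z = - 2 / z ^ 3 - 2 * (\<Sum>w\<in>head R. 1 / (z - w) ^ 3) - (deriv ^^ 3) (log_tail R) z"
    unfolding wp'_def by (simp add: algebra_simps)
qed

lemma log_tail_deriv:
  assumes "z \<in> ball 0 R"
  shows "((deriv ^^ m) (log_tail R) has_field_derivative (deriv ^^ Suc m) (log_tail R) z) (at z)"
  using holomorphic_derivI[OF holomorphic_higher_deriv[OF log_tail_holomorphic open_ball] open_ball assms]
  by simp

text \<open>The Weierstrass zeta function as logarithmic derivative of sigma. At lattice points it
  takes the default value 0 of division by zero, so the laws for it are stated off
  \<open>L\<close>.\<close>

definition zeta :: "complex \<Rightarrow> complex" where "zeta z = deriv sg z / sg z"

lemma sigma_has_deriv: "(sg has_field_derivative deriv sg z) (at z)"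
  using holomorphic_derivI[OF sigma_holomorphic open_UNIV] by simp

lemma sigma_has_deriv_zeta: "z \<notin> L \<Longrightarrow> (sg has_field_derivative sg z * zeta z) (at z)"
  using sigma_has_deriv[of z] sigma_eq_0_iff[of z] by (simp add: zeta_def)

lemma zeta_eq:
  assumes z: "z \<in> ball 0 R" "z \<notin> L"
  shows "zeta z = 1 / z + (\<Sum>w\<in>head R. 1 / w + z / w^2 - 1 / (w - z)) + deriv (log_tail R) z"
proof -
  let ?E = "\<lambda>w z. sigma_factor w z"
  let ?Z = "\<Sum>w\<in>head R. 1 / w + z / w^2 - 1 / (w - z)"
  have nz: "z \<noteq> 0" using z by auto
  have "((\<lambda>z. \<Prod>w\<in>head R. ?E w z) has_field_derivative
      (\<Prod>w\<in>head R. ?E w z) * ?Z) (at z)"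
  proof (rule has_field_derivative_prod_log[OF finite_head])
    fix w assume "w \<in> head R"
    then have "w \<noteq> 0" "w - z \<noteq> 0" using z by (auto simp: head_def)
    have "(?E w has_field_derivative - 1 / w * exp (z / w + (z / w) ^ 2 / 2)
        + (1 - z / w) * (exp (z / w + (z / w) ^ 2 / 2) * (1 / w + z / w^2))) (at z)"
      using \<open>w \<noteq> 0\<close> by (auto intro!: derivative_eq_intros simp: power2_eq_square)
    also have "- 1 / w * exp (z / w + (z / w) ^ 2 / 2)
        + (1 - z / w) * (exp (z / w + (z / w) ^ 2 / 2) * (1 / w + z / w^2))
       = exp (z / w + (z / w) ^ 2 / 2) * (- 1 / w + (1 - z / w) * (1 / w + z / w^2))"
      by (simp only: distrib_left distrib_right mult_ac)
    also have "- 1 / w + (1 - z / w) * (1 / w + z / w^2) = (1 - z / w) * (1 / w + z / w^2 - 1 / (w - z))"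
      using \<open>w \<noteq> 0\<close> \<open>w - z \<noteq> 0\<close> by (simp add: divide_simps algebra_simps power2_eq_square)
    finally show "(?E w has_field_derivative ?E w z * (1 / w + z / w^2 - 1 / (w - z))) (at z)"
      by (simp add: mult_ac)
  qed
  then have "((\<lambda>z. z * (\<Prod>w\<in>head R. ?E w z) * exp (log_tail R z)) has_field_derivative
      (z * (\<Prod>w\<in>head R. ?E w z) * exp (log_tail R z)) * (1 / z + ?Z + deriv (log_tail R) z)) (at z)"
    using nz log_tail_deriv[OF z(1), of 0] by (auto intro!: derivative_eq_intros simp: field_simps)
  then have "((\<lambda>z. z * (\<Prod>w\<in>head R. ?E w z) * exp (log_tail R z)) has_field_derivative
      sg z * (1 / z + ?Z + deriv (log_tail R) z)) (at z)"
    using sigma_eq[OF z(1)] by simp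
  then have "(sg has_field_derivative
      sg z * (1 / z + ?Z + deriv (log_tail R) z)) (at z)"
    by (rule has_field_derivative_transform_within_open[OF _ open_ball z(1)]) (rule sigma_eq[symmetric])
  then show ?thesis using z sigma_eq_0_iff[of z] by (simp add: zeta_def DERIV_imp_deriv)
qed

text \<open>The local formulas depend on the radius \<open>R\<close>; a derivative computed from the
  formula for one ball around 0 containing \<open>z\<close> is a derivative of the global
  function.\<close>

lemma has_deriv_from_ball:
  assumes z: "z \<notin> L"
    and eq: "\<And>x R. x \<in> ball 0 R \<Longrightarrow> x \<notin> L \<Longrightarrow> f x = F R x"
    and d: "\<And>R. z \<in> ball 0 R \<Longrightarrow> (F R has_field_derivative D) (at z)"
  shows "(f has_field_derivative D) (at z)"
proof -
  obtain R where R: "z \<in> ball 0 R" by (metis dist_0_norm mem_ball lt_ex gt_ex)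
  show ?thesis
    by (rule has_field_derivative_transform_within_open[OF d[OF R], where S = "ball 0 R \<inter> - L"])
       (use open_compl R z eq in auto)
qed

lemma zeta_deriv:
  assumes z: "z \<notin> L"
  shows "(zeta has_field_derivative - wp L z) (at z)"
proof (rule has_deriv_from_ball[OF z zeta_eq])
  fix R assume R: "z \<in> ball 0 R"
  let ?F = "\<lambda>z. 1 / z + (\<Sum>w\<in>head R. 1 / w + z / w^2 - 1 / (w - z)) + deriv (log_tail R) z"
    and ?D = "- 1 / z^2 + (\<Sum>w\<in>head R. 1 / w^2 - 1 / (w - z)^2) + (deriv ^^ 2) (log_tail R) z"
  have "(?F
     has_field_derivative ?D) (at z)"
    using log_tail_deriv[OF R, of 1] z
    by (auto intro!: derivative_eq_intros sum.cong simp: head_def numeral_2_eq_2 field_simps)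
  also have "?D = - wp L z"
    unfolding wp_eq[OF R z] by (simp add: sum_subtractf power2_commute)
  finally show "(?F
     has_field_derivative - wp L z) (at z)" .
qed auto

lemma wp_deriv:
  assumes z: "z \<notin> L"
  shows "(wp L has_field_derivative wp' L z) (at z)"
proof (rule has_deriv_from_ball[OF z wp_eq])
  fix R assume R: "z \<in> ball 0 R"
  let ?F = "\<lambda>z. 1 / z ^ 2 + (\<Sum>w\<in>head R. 1 / (z - w) ^ 2 - 1 / w ^ 2) - (deriv ^^ 2) (log_tail R) z"
    and ?D = "- 2 / z ^ 3 + (\<Sum>w\<in>head R. - 2 * (1 / (z - w) ^ 3)) - (deriv ^^ Suc 2) (log_tail R) z"
  have nz: "z \<noteq> 0" using z by auto
  have *: "((\<lambda>z. 1 / (z - w)^2 - 1 / w^2) has_field_derivative (- 2 * (1 / (z - w)^3))) (at z)" if "z \<noteq> w" for w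
    using that by (auto intro!: derivative_eq_intros) (simp add: divide_simps eval_nat_numeral)
  have **: "((\<lambda>z. 1 / z^2) has_field_derivative (- 2 / z^3)) (at z)"
    using *[of 0] nz by simp
  have S: "((\<lambda>z. \<Sum>w\<in>head R. 1 / (z - w) ^ 2 - 1 / w ^ 2) has_field_derivative
      (\<Sum>w\<in>head R. - 2 * (1 / (z - w) ^ 3))) (at z)"
    using z by (intro DERIV_sum *) (auto simp: head_def)
  have "(?F
     has_field_derivative ?D) (at z)"
    by (intro DERIV_add DERIV_diff ** S log_tail_deriv[OF R])
  also have "?D = wp' L z"
    unfolding wp'_eq[OF R z] sum_distrib_left[symmetric] by (simp add: numeral_3_eq_3 numeral_2_eq_2)
  finally show "(?F
     has_field_derivative wp' L z) (at z)" .
qed auto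

end

subsection \<open>Periodicity and quasi-periodicity\<close>

context period_lat
begin

lemma wp_minus: "wp L (- z) = wp L z"
proof -
  have "infsum (\<lambda>w. 1 / (- z - w) ^ 2 - 1 / w ^ 2) (L - {0}) = infsum (\<lambda>w. 1 / (z - w) ^ 2 - 1 / w ^ 2) (L - {0})"
    by (rule infsum_reindex_bij_witness[of _ uminus uminus]) (auto simp: power2_eq_square algebra_simps)
  then show ?thesis unfolding wp_def by simp
qed

lemma wp'_minus: "wp' L (- z) = - wp' L z"
proof -
  have "infsum (\<lambda>w. 1 / (- z - w) ^ 3) L = infsum (\<lambda>w. - (1 / (z - w) ^ 3)) L"
  proof (rule infsum_reindex_bij_witness[of _ uminus uminus])
    fix w assume "w \<in> L"
    have "(- z - w) ^ 3 = - ((z - - w) ^ 3)" by (simp add: power3_eq_cube algebra_simps)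
    then show "- (1 / (z - - w) ^ 3) = 1 / (- z - w) ^ 3" by simp
  qed auto
  then show ?thesis unfolding wp'_def by (simp add: infsum_uminus)
qed

lemma wp'_periodic:
  assumes "w \<in> L" shows "wp' L (z + w) = wp' L z"
proof -
  have "infsum (\<lambda>v. 1 / (z + w - v) ^ 3) L = infsum (\<lambda>v. 1 / (z - v) ^ 3) L"
    by (rule infsum_reindex_bij_witness[of _ "\<lambda>v. v + w" "\<lambda>v. v - w"])
       (use assms in \<open>auto simp: add_in_iff diff_in_iff algebra_simps\<close>)
  then show ?thesis unfolding wp'_def by simp
qed

lemma const_on_compl:
  assumes "\<And>z. z \<notin> L \<Longrightarrow> (f has_field_derivative 0) (at z)" "x \<notin> L" "y \<notin> L"
  shows "f x = (f y :: complex)"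
  using has_field_derivative_0_imp_constant_on[of "- L" f, OF _ connected_compl open_compl] assms
  unfolding constant_on_def by (metis ComplD ComplI)

text \<open>Periodicity of \<open>wp'\<close> is plain reindexing, so
  \<open>wp L (z + w) - wp L z\<close> is constant. Evaluating at \<open>- w / 2\<close> and using
  evenness gives 0. The test point must avoid \<open>L\<close>, which holds for the two
  generators.\<close>

lemma wp_periodic_half:
  assumes "w \<in> L" "w / 2 \<notin> L" "z \<notin> L"
  shows "wp L (z + w) = wp L z"
proof -
  have d: "((\<lambda>z. wp L (z + w) - wp L z) has_field_derivative 0) (at z)" if "z \<notin> L" for z
  proof -
    have "((\<lambda>z. wp L (z + w) - wp L z) has_field_derivative (wp' L (z + w) * 1 - wp' L z)) (at z)"
      using that assms(1)
      by (intro DERIV_diff wp_deriv DERIV_chain2[of "wp L" _ "\<lambda>z. z + w"])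
         (auto simp: add_in_iff intro!: derivative_eq_intros)
    then show ?thesis using assms(1) by (simp add: wp'_periodic)
  qed
  have "wp L (z + w) - wp L z = wp L (- (w / 2) + w) - wp L (- (w / 2))"
    by (rule const_on_compl[OF d]) (use assms in auto)
  also have "- (w / 2) + w = w / 2" by simp
  finally show ?thesis by (simp add: wp_minus)
qed

lemma periodic_all:
  assumes f1: "\<And>z. z \<notin> L \<Longrightarrow> f (z + w1) = f z" and f2: "\<And>z. z \<notin> L \<Longrightarrow> f (z + w2) = f z"
    and w: "w \<in> L" and z: "z \<notin> L"
  shows "f (z + w) = f z"
proof -
  have gen: "f (z + of_int a * v) = f z"
    if v: "\<And>z. z \<notin> L \<Longrightarrow> f (z + v) = f z" "v \<in> L" and z: "z \<notin> L" for a v z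
  proof (induction a rule: int_induct[where k = 0])
    case (step1 i)
    have "f (z + of_int (i + 1) * v) = f ((z + of_int i * v) + v)" by (simp add: algebra_simps)
    also have "\<dots> = f (z + of_int i * v)" using v z by (intro v(1)) (simp add: add_in_iff mult_int_in)
    finally show ?case using step1 by simp
  next
    case (step2 i)
    have "f (z + of_int i * v) = f ((z + of_int (i - 1) * v) + v)" by (simp add: algebra_simps)
    also have "\<dots> = f (z + of_int (i - 1) * v)" using z add_in_iff[OF mult_int_in[OF v(2), of "i - 1"], of z] by (intro v(1)) simp
    finally show ?case using step2 by simp
  qed simp
  obtain a b :: int where ab: "w = of_int a * w1 + of_int b * w2" using w unfolding L_eq by auto
  have "f (z + w) = f ((z + of_int a * w1) + of_int b * w2)" unfolding ab by (simp add: algebra_simps)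
  also have "\<dots> = f (z + of_int a * w1)"
    using z by (intro gen f2) (auto simp: add_in_iff mult_int_in)
  also have "\<dots> = f z" using z by (intro gen f1) auto
  finally show ?thesis .
qed

lemma wp_periodic: "w \<in> L \<Longrightarrow> z \<notin> L \<Longrightarrow> wp L (z + w) = wp L z"
  by (rule periodic_all[of "wp L", OF wp_periodic_half[OF w1_in half_notin(1)] wp_periodic_half[OF w2_in half_notin(2)]])

lemma sigma_minus: "sg (- z) = - sg z"
proof -
  have "(\<Prod>w\<in>disc N. sigma_factor w (- z))
     = (\<Prod>w\<in>disc N. sigma_factor w z)" for N
    by (rule prod.reindex_bij_witness[of _ uminus uminus]) auto
  then have "(\<lambda>N. - (z * (\<Prod>w\<in>disc N. sigma_factor w z)))
      \<longlonglongrightarrow> sg (- z)"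
    using sigma_LIMSEQ[of "- z"] by simp
  moreover have "(\<lambda>N. - (z * (\<Prod>w\<in>disc N. sigma_factor w z)))
      \<longlonglongrightarrow> - sg z"
    by (intro tendsto_intros sigma_LIMSEQ)
  ultimately show ?thesis by (rule LIMSEQ_unique)
qed

lemma zeta_minus: "z \<notin> L \<Longrightarrow> zeta (- z) = - zeta z"
proof -
  assume z: "z \<notin> L"
  have "((\<lambda>z. sg (- z)) has_field_derivative sg (- z) * zeta (- z) * (- 1)) (at z)"
    using z by (intro DERIV_chain2[of sg] sigma_has_deriv_zeta) (auto intro!: derivative_eq_intros)
  moreover have "((\<lambda>z. sg (- z)) has_field_derivative - (sg z * zeta z)) (at z)"
    unfolding sigma_minus using z by (intro DERIV_minus sigma_has_deriv_zeta)
  ultimately have "sg (- z) * zeta (- z) * (- 1) = - (sg z * zeta z)" by (rule DERIV_unique)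
  then have "sg z * zeta (- z) = sg z * (- zeta z)" by (simp add: sigma_minus)
  then show ?thesis using z sigma_eq_0_iff[of z] mult_left_cancel by blast
qed

text \<open>The quasi-period of zeta. The half period \<open>w1 / 2\<close> serves as a base point
  known to lie outside \<open>L\<close>; \<open>zeta_shift\<close> shows independence of this
  choice.\<close>

definition eta :: "complex \<Rightarrow> complex" where "eta w = zeta (w1 / 2 + w) - zeta (w1 / 2)"

lemma zeta_shift:
  assumes w: "w \<in> L" and z: "z \<notin> L"
  shows "zeta (z + w) = zeta z + eta w"
proof -
  have d: "((\<lambda>z. zeta (z + w) - zeta z) has_field_derivative 0) (at z)" if "z \<notin> L" for z
  proof -
    have "((\<lambda>z. zeta (z + w) - zeta z) has_field_derivative (- wp L (z + w) * 1 - (- wp L z))) (at z)"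
      using that w
      by (intro DERIV_diff zeta_deriv DERIV_chain2[of zeta _ "\<lambda>z. z + w"])
         (auto simp: add_in_iff intro!: derivative_eq_intros)
    then show ?thesis using w that by (simp add: wp_periodic)
  qed
  have "zeta (z + w) - zeta z = zeta (w1 / 2 + w) - zeta (w1 / 2)"
    by (rule const_on_compl[OF d]) (use z half_notin in auto)
  then show ?thesis unfolding eta_def by (simp add: algebra_simps)
qed

lemma eta_add: assumes "v \<in> L" "w \<in> L" shows "eta (v + w) = eta v + eta w"
proof -
  have "zeta (w1 / 2 + (v + w)) = zeta ((w1 / 2 + v) + w)" by (simp add: algebra_simps)
  also have "\<dots> = zeta (w1 / 2) + eta v + eta w"
    using assms half_notin by (simp add: zeta_shift add_in_iff)
  finally show ?thesis using zeta_shift[of "v + w" "w1 / 2"] assms half_notin add_in by simp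
qed

text \<open>The constant in the transformation law of sigma, evaluated at the base point
  \<open>w1 / 2\<close>. It equals 1 when \<open>w / 2\<close> is a lattice point and -1 for all
  other periods.\<close>

definition psi :: "complex \<Rightarrow> complex" where
  "psi w = sg (w1 / 2 + w) / (sg (w1 / 2) * exp (eta w * (w1 / 2 + w / 2)))"

text \<open>The quotient of both sides has logarithmic derivative
  \<open>zeta (z + w) - zeta z - eta w\<close>, which vanishes.\<close>

lemma sigma_shift:
  assumes w: "w \<in> L"
  shows "sg (z + w) = psi w * exp (eta w * (z + w / 2)) * sg z"
proof (cases "z \<in> L")
  case True
  then show ?thesis using w sigma_eq_0_iff[of z] sigma_eq_0_iff[of "z + w"] by (simp add: add_in_iff)
next
  case False
  let ?D = "\<lambda>z. sg z * exp (eta w * (z + w / 2))"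
  have d: "((\<lambda>z. sg (z + w) / ?D z) has_field_derivative 0) (at z)" if "z \<notin> L" for z
  proof -
    have s: "((\<lambda>z. sg (z + w)) has_field_derivative sg (z + w) * zeta (z + w) * 1) (at z)"
      using that w by (intro DERIV_chain2[of sg _ "\<lambda>z. z + w"] sigma_has_deriv_zeta)
         (auto simp: add_in_iff intro!: derivative_eq_intros)
    have "(?D has_field_derivative
        ?D z * (zeta z + eta w)) (at z)"
      using sigma_has_deriv_zeta[OF that] by (auto intro!: derivative_eq_intros simp: algebra_simps)
    moreover have nz: "?D z \<noteq> 0" using that sigma_eq_0_iff by simp
    ultimately have "((\<lambda>z. sg (z + w) / ?D z) has_field_derivative
       (sg (z + w) * zeta (z + w) * 1 * ?D z
       - sg (z + w) * (?D z * (zeta z + eta w)))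
        / (?D z * ?D z)) (at z)"
      by (intro DERIV_divide s)
    then show ?thesis using zeta_shift[OF w that] by (simp add: mult_ac)
  qed
  have "sg (z + w) / ?D z = psi w"
    unfolding psi_def by (rule const_on_compl[OF d]) (use False half_notin in auto)
  then show ?thesis using False sigma_eq_0_iff by (simp add: field_simps)
qed

text \<open>The shift law at \<open>z\<close> and at \<open>- z - w\<close>, joined by oddness of
  sigma, gives the square of \<open>psi w\<close>; the two exponents add up to zero.\<close>

lemma psi_sq: assumes w: "w \<in> L" shows "psi w ^ 2 = 1"
proof -
  define z where "z = w1 / 2"
  have z: "sg z \<noteq> 0" using half_notin sigma_eq_0_iff by (simp add: z_def)
  have "sg (- z - w + w) = psi w * exp (eta w * (- z - w + w / 2)) * sg (- z - w)"
    by (rule sigma_shift[OF w])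
  also have "sg (- z - w) = - sg (z + w)" using sigma_minus[of "z + w"] by simp
  also have "sg (z + w) = psi w * exp (eta w * (z + w / 2)) * sg z" by (rule sigma_shift[OF w])
  finally have "sg z = psi w ^ 2 * (exp (eta w * (- z - w + w / 2)) * exp (eta w * (z + w / 2))) * sg z"
    by (simp add: sigma_minus power2_eq_square mult_ac)
  also have "exp (eta w * (- z - w + w / 2)) * exp (eta w * (z + w / 2)) = 1"
    unfolding exp_add[symmetric] by (simp add: algebra_simps)
  finally show ?thesis using z by simp
qed

text \<open>At \<open>- w / 2\<close> the exponent in the shift law vanishes and the shifted point
  is \<open>w / 2\<close>, so oddness of a nonzero sigma value forces the sign.\<close>

lemma psi_half_notin: assumes w: "w \<in> L" "w / 2 \<notin> L" shows "psi w = - 1"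
proof -
  have "sg (- (w / 2) + w) = psi w * exp (eta w * (- (w / 2) + w / 2)) * sg (- (w / 2))"
    by (rule sigma_shift[OF w(1)])
  moreover have "- (w / 2) + w = w / 2" by simp
  ultimately have "sg (w / 2) = - psi w * sg (w / 2)" by (simp add: sigma_minus)
  then show ?thesis using w(2) sigma_eq_0_iff[of "w / 2"] by (metis minus_equation_iff mult_cancel_right2)
qed

text \<open>Shifting by \<open>v + w\<close> at once or in two stages. The exponential left over is
  the one in Legendre's relation; knowing the three constants determines its value.\<close>

lemma psi_add:
  assumes v: "v \<in> L" and w: "w \<in> L"
  shows "psi (v + w) = psi v * psi w * exp ((eta v * w - eta w * v) / 2)"
proof -
  define z where "z = w1 / 2"
  have z: "sg z \<noteq> 0" using half_notin sigma_eq_0_iff by (simp add: z_def)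
  have "sg (z + w + v) = psi v * exp (eta v * (z + w + v / 2)) * (psi w * exp (eta w * (z + w / 2)) * sg z)"
    using sigma_shift[OF v, of "z + w"] sigma_shift[OF w, of z] by simp
  also have "sg (z + w + v) = sg (z + (v + w))" by (simp add: algebra_simps)
  also have "\<dots> = psi (v + w) * exp ((eta v + eta w) * (z + (v + w) / 2)) * sg z"
    using sigma_shift[OF add_in[OF v w], of z] eta_add[OF v w] by simp
  finally have "psi (v + w) * exp ((eta v + eta w) * (z + (v + w) / 2))
      = psi v * psi w * (exp (eta v * (z + w + v / 2)) * exp (eta w * (z + w / 2)))"
    using z by (simp add: mult_ac)
  also have "exp (eta v * (z + w + v / 2)) * exp (eta w * (z + w / 2))
     = exp ((eta v * w - eta w * v) / 2) * exp ((eta v + eta w) * (z + (v + w) / 2))"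
    unfolding exp_add[symmetric] by (simp add: field_simps)
  finally show ?thesis by simp
qed

lemma psi_half_in: assumes "w / 2 \<in> L" shows "psi w = 1"
  using psi_add[OF assms assms] psi_sq[OF assms] by (simp add: power2_eq_square)

lemma psi_nz: "w \<in> L \<Longrightarrow> psi w \<noteq> 0"
  using psi_sq by fastforce

section \<open>Liouville's theorem for elliptic functions\<close>

lemma isolated_lattice_point:
  obtains r where "r > 0" "\<And>x. x \<in> ball w r \<Longrightarrow> x \<in> L \<Longrightarrow> x = w"
proof -
  obtain d where d: "d > 0" "\<And>x. x \<in> L \<Longrightarrow> norm x \<le> norm w + 1 \<Longrightarrow> x \<noteq> w \<Longrightarrow> d \<le> dist w x"
    using finite_set_avoid[OF finite_disc[of "norm w + 1"], of w] by auto
  have "x = w" if "x \<in> ball w (min d 1)" "x \<in> L" for x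
  proof (rule ccontr)
    assume "x \<noteq> w"
    have "norm x \<le> norm w + norm (w - x)" by (metis norm_minus_commute norm_triangle_sub)
    then have "norm x \<le> norm w + 1" using that by (auto simp: dist_norm)
    then show False using d(2)[OF that(2)] \<open>x \<noteq> w\<close> that(1) by auto
  qed
  then show ?thesis using that[of "min d 1"] d(1) by auto
qed

lemma real_coords: obtains x y :: real where "z = of_real x * w1 + of_real y * w2"
proof -
  define t where "t = w2 / w1"
  define y where "y = Im (z / w1) / Im t"
  define x where "x = Re (z / w1) - y * Re t"
  have "z / w1 = of_real x + of_real y * t"
    using Im_ratio[folded t_def] by (simp add: complex_eq_iff x_def y_def)
  then have "z = of_real x * w1 + of_real y * w2"
    unfolding t_def by (simp add: field_simps)
  then show ?thesis by (rule that)
qed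

text \<open>By periodicity the limit at 0 is the limit at every lattice point, so all singularities
  are removable. The entire extension is bounded because its values all occur on a compact
  parallelogram.\<close>

lemma elliptic_const:
  assumes f: "f holomorphic_on - L"
    and p1: "\<And>z. z \<notin> L \<Longrightarrow> f (z + w1) = f z" and p2: "\<And>z. z \<notin> L \<Longrightarrow> f (z + w2) = f z"
    and lim: "(f \<longlongrightarrow> l) (at 0)" and z: "z \<notin> L"
  shows "f z = (l :: complex)"
proof -
  define g where "g z = (if z \<in> L then l else f z)" for z
  have gper: "g (z + w) = g z" if "w \<in> L" for z w
    using periodic_all[of f, OF p1 p2 that, of z] that by (auto simp: g_def add_in_iff)
  have ev: "\<forall>\<^sub>F x in at w. x \<notin> L" for w
  proof -
    obtain r where "r > 0" "\<And>x. x \<in> ball w r \<Longrightarrow> x \<in> L \<Longrightarrow> x = w"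
      using isolated_lattice_point by blast
    then show ?thesis unfolding eventually_at by (intro exI[of _ r]) (auto simp: dist_commute)
  qed
  have "(g \<longlongrightarrow> l) (at 0)"
    by (rule Lim_transform_eventually[OF lim]) (use ev[of 0] in \<open>auto elim!: eventually_mono simp: g_def\<close>)
  then have glim: "(g \<longlongrightarrow> l) (at w)" if "w \<in> L" for w
  proof -
    have "((\<lambda>x. g (w + x)) \<longlongrightarrow> l) (at 0)"
      using \<open>(g \<longlongrightarrow> l) (at 0)\<close> gper[OF that] by (simp add: add.commute)
    then show ?thesis by (subst (asm) LIM_offset_zero_iff[symmetric]) auto
  qed
  have "\<exists>f'. (g has_field_derivative f') (at x)" for x
  proof (cases "x \<in> L")
    case False
    have "(f has_field_derivative deriv f x) (at x)"
      using f open_compl False by (intro holomorphic_derivI) auto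
    then have "(g has_field_derivative deriv f x) (at x)"
      by (rule has_field_derivative_transform_within_open[of _ _ _ "- L"])
         (use open_compl False in \<open>auto simp: g_def\<close>)
    then show ?thesis by blast
  next
    case True
    obtain r where r: "r > 0" "\<And>y. y \<in> ball x r \<Longrightarrow> y \<in> L \<Longrightarrow> y = x"
      using isolated_lattice_point by blast
    have "g holomorphic_on ball x r"
    proof (rule no_isolated_singularity')
      show "(g \<longlongrightarrow> g z) (at z within ball x r)" if "z \<in> {x}" for z
        using glim[OF True] that True r(1)
        by (auto simp: g_def at_within_open[of x "ball x r"])
      have "f holomorphic_on ball x r - {x}"
        by (rule holomorphic_on_subset[OF f]) (use r(2) in auto)
      then show "g holomorphic_on ball x r - {x}"
        by (rule holomorphic_transform) (use r(2) in \<open>auto simp: g_def\<close>)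
    qed auto
    then show ?thesis using r(1) by (metis holomorphic_on_open open_ball centre_in_ball)
  qed
  then have ghol: "g holomorphic_on UNIV" by (simp add: holomorphic_on_open)
  define P where "P = (\<lambda>(x::real, y::real). of_real x * w1 + of_real y * w2) ` ({0..1} \<times> {0..1})"
  have "compact P"
    unfolding P_def case_prod_beta
    by (intro compact_continuous_image compact_Times continuous_intros) auto
  then have "compact (g ` P)"
    by (intro compact_continuous_image holomorphic_on_imp_continuous_on holomorphic_on_subset[OF ghol]) auto
  then have "bounded (g ` P)" by (rule compact_imp_bounded)
  moreover have "range g \<subseteq> g ` P"
  proof clarify
    fix x
    obtain a b where ab: "x = of_real a * w1 + of_real b * w2" using real_coords by blast
    \<comment> \<open>Dropping the integer parts of the real coordinates moves the point by a period
      into the parallelogram.\<close>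
    define y where "y = of_real (frac a) * w1 + of_real (frac b) * w2"
    have "y \<in> P" unfolding P_def y_def
      by (intro image_eqI[of _ _ "(frac a, frac b)"]) (auto simp: less_imp_le[OF frac_lt_1])
    moreover have "x = y + (of_int \<lfloor>a\<rfloor> * w1 + of_int \<lfloor>b\<rfloor> * w2)"
      unfolding ab y_def frac_def by (simp add: algebra_simps)
    then have "g x = g y" using gper[of "of_int \<lfloor>a\<rfloor> * w1 + of_int \<lfloor>b\<rfloor> * w2" y]
      by (simp add: add_in mult_int_in)
    ultimately show "g x \<in> g ` P" by blast
  qed
  ultimately have "bounded (range g)" by (rule bounded_subset)
  then have "g constant_on UNIV" by (rule Liouville_theorem[OF ghol])
  then have "g z = g 0" unfolding constant_on_def by auto
  then show ?thesis using z by (simp add: g_def)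
qed

end

subsection \<open>Differential equations, and the lattice as a function of its invariants\<close>

text \<open>Turns the cancellation of pole terms into a check of finitely many power series
  coefficients. The zero series is separate because its subdegree is 0 by convention.\<close>

lemma has_fps_quotient_limit:
  fixes f :: "complex \<Rightarrow> complex"
  assumes f: "f has_fps_expansion F" and z: "\<And>i. i < n \<Longrightarrow> fps_nth F i = 0"
  shows "((\<lambda>z. f z / z ^ n) \<longlongrightarrow> fps_nth F n) (at 0)"
proof (cases "F = 0")
  case True
  then have "\<forall>\<^sub>F z in nhds 0. f z = 0" using f has_fps_expansion_0_iff by blast
  then have "\<forall>\<^sub>F z in at 0. 0 = f z / z ^ n" unfolding eventually_at_filter by eventually_elim auto
  then show ?thesis using True by (intro Lim_transform_eventually[OF tendsto_const]) auto
next
  case False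
  have sub: "n \<le> subdegree F" using z False by (metis not_le nth_subdegree_nonzero)
  have rad: "fps_conv_radius F > 0" and ev: "\<forall>\<^sub>F z in nhds 0. eval_fps F z = f z"
    using f by (auto simp: has_fps_expansion_def)
  have evr: "\<forall>\<^sub>F z in nhds (0::complex). norm z < fps_conv_radius F"
    using eventually_nhds_in_open[of "eball (0::complex) (fps_conv_radius F)" 0] rad by (simp add: zero_ereal_def in_eball_iff)
  have "isCont (eval_fps (fps_shift n F)) 0"
    using rad by (intro continuous_eval_fps) (auto simp: zero_ereal_def)
  then have "(eval_fps (fps_shift n F) \<longlongrightarrow> fps_nth F n) (at 0)"
    by (simp add: isCont_def eval_fps_at_0)
  then show ?thesis
  proof (rule Lim_transform_eventually)
    show "\<forall>\<^sub>F z in at 0. eval_fps (fps_shift n F) z = f z / z ^ n"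
      using ev evr unfolding eventually_at_filter
      by eventually_elim (auto simp: eval_fps_shift[OF sub])
  qed
qed

context period_lat
begin

lemma head_empty: obtains r where "r > 0" "head r = {}"
proof -
  obtain r where r: "r > 0" "\<And>x. x \<in> ball 0 r \<Longrightarrow> x \<in> L \<Longrightarrow> x = 0"
    using isolated_lattice_point by blast
  then have "head (r / 2) = {}" unfolding head_def by auto
  then show ?thesis using that[of "r / 2"] r(1) by auto
qed

lemma eisen_odd: "odd k \<Longrightarrow> eisen k L = 0"
proof -
  assume k: "odd k"
  have "eisen k L = infsum (\<lambda>w. - (1 / w ^ k)) (L - {0})"
    unfolding eisen_def by (rule infsum_reindex_bij_witness[of _ uminus uminus]) (use k in auto)
  then have "eisen k L = - eisen k L" unfolding eisen_def by (simp add: infsum_uminus)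
  then show ?thesis by simp
qed

text \<open>A radius with empty head: in this ball the finite parts of all local formulas vanish,
  leaving the principal part at 0 plus a holomorphic function.\<close>

definition rad0 :: real where "rad0 = (SOME r. r > 0 \<and> head r = {})"

lemma rad0: "rad0 > 0" "head rad0 = {}"
proof -
  have "\<exists>r. r > 0 \<and> head r = {}" using head_empty by blast
  then show "rad0 > 0" "head rad0 = {}" unfolding rad0_def by (metis (mono_tags, lifting) someI_ex)+
qed

lemma rad0_notin: "z \<in> ball 0 rad0 \<Longrightarrow> z \<noteq> 0 \<Longrightarrow> z \<notin> L"
  using rad0 unfolding head_def by auto

definition wp_reg :: "complex \<Rightarrow> complex" where "wp_reg z = - (deriv ^^ 2) (log_tail rad0) z"

lemma sigma_near_0: "z \<in> ball 0 rad0 \<Longrightarrow> sg z = z * exp (log_tail rad0 z)"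
  using sigma_eq[of z rad0] by (simp add: rad0)

lemma wp_reg_deriv_iter: "z \<in> ball 0 rad0 \<Longrightarrow> (deriv ^^ m) wp_reg z = - (deriv ^^ (m + 2)) (log_tail rad0) z"
proof (induction m arbitrary: z)
  case 0 then show ?case by (simp add: wp_reg_def numeral_2_eq_2)
next
  case (Suc m)
  have "(deriv ^^ Suc m) wp_reg z = deriv (\<lambda>z. - (deriv ^^ (m + 2)) (log_tail rad0) z) z"
    unfolding funpow.simps o_apply
    by (intro deriv_cong_ev refl eventually_mono[OF eventually_nhds_in_open[OF open_ball Suc.prems]] Suc.IH)
  also have "\<dots> = - (deriv ^^ Suc (m + 2)) (log_tail rad0) z"
    by (intro DERIV_imp_deriv DERIV_minus log_tail_deriv Suc.prems)
  finally show ?case by simp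
qed

lemma wp_reg_holomorphic: "wp_reg holomorphic_on ball 0 rad0"
  unfolding wp_reg_def [abs_def]
  by (intro holomorphic_intros holomorphic_higher_deriv log_tail_holomorphic) auto

lemma wp_near_0:
  assumes "z \<in> ball 0 rad0" "z \<noteq> 0"
  shows "wp L z = 1 / z ^ 2 + wp_reg z" "wp' L z = - 2 / z ^ 3 + deriv wp_reg z"
  using wp_eq[OF assms(1) rad0_notin[OF assms]] wp'_eq[OF assms(1) rad0_notin[OF assms]]
    wp_reg_deriv_iter[OF assms(1), of 1]
  by (auto simp: rad0 wp_reg_def numeral_3_eq_3)

text \<open>The classical Laurent expansion of \<open>wp\<close> at 0. The case \<open>m = 0\<close>
  stands apart since the correction \<open>1 / w ^ 2\<close> cancels the constant term.\<close>

lemma wp_reg_coeff: "(deriv ^^ m) wp_reg 0 = (if m = 0 then 0 else fact (m + 1) * eisen (m + 2) L)"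
proof -
  have 0: "(0::complex) \<in> ball 0 rad0" using rad0 by simp
  have tl: "tail rad0 = L - {0}" using head_Un_tail(1)[of rad0] rad0 by simp
  have hs: "((\<lambda>w. (deriv ^^ (m + 2)) (log_factor w) 0) has_sum (deriv ^^ (m + 2)) (log_tail rad0) 0) (L - {0})"
    using log_tail_has_sum[OF 0, of "m + 2"] tl by simp
  show ?thesis
  proof (cases m)
    case 0
    have "((\<lambda>w. 0) has_sum (deriv ^^ (m + 2)) (log_tail rad0) 0) (L - {0})"
      using hs by (rule has_sum_cong[THEN iffD1, rotated]) (use log_factor_deriv_iter(2)[of 0] in \<open>auto simp: 0 numeral_2_eq_2\<close>)
    then have "(deriv ^^ (m + 2)) (log_tail rad0) 0 = 0" by (simp add: has_sum_iff)
    then show ?thesis using wp_reg_deriv_iter[OF \<open>0 \<in> ball 0 rad0\<close>, of m] 0 by simp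
  next
    case (Suc k)
    have "((\<lambda>w. - fact (m + 1) * (1 / w ^ (m + 2))) has_sum (deriv ^^ (m + 2)) (log_tail rad0) 0) (L - {0})"
      using hs by (rule has_sum_cong[THEN iffD1, rotated])
        (use log_factor_deriv_iter(3)[of 0 _ k] in \<open>auto simp: Suc eval_nat_numeral\<close>)
    then have "(deriv ^^ (m + 2)) (log_tail rad0) 0 = infsum (\<lambda>w. - fact (m + 1) * (1 / w ^ (m + 2))) (L - {0})"
      by (simp add: infsumI)
    also have "\<dots> = - fact (m + 1) * eisen (m + 2) L"
      unfolding eisen_def by (subst infsum_cmult_right') simp
    finally show ?thesis using wp_reg_deriv_iter[OF 0, of m] Suc by simp
  qed
qed

definition wp_fps :: "complex fps" where "wp_fps = fps_expansion wp_reg 0"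

lemma wp_reg_fps: "wp_reg has_fps_expansion wp_fps"
  unfolding wp_fps_def
  by (rule has_fps_expansion_fps_expansion[OF open_ball _ wp_reg_holomorphic]) (use rad0 in auto)

lemma wp_fps_nth: "fps_nth wp_fps 0 = 0" "fps_nth wp_fps 1 = 0" "fps_nth wp_fps 2 = 3 * eisen 4 L"
  "fps_nth wp_fps 3 = 0" "fps_nth wp_fps 4 = 5 * eisen 6 L"
  unfolding fps_nth_fps_expansion[OF wp_reg_fps] wp_reg_coeff
  by (auto simp: eisen_odd fact_numeral)

lemma wp'_holomorphic: "wp' L holomorphic_on - L"
proof -
  have "wp L holomorphic_on - L" using wp_deriv by (auto simp: holomorphic_on_open[OF open_compl])
  then have "deriv (wp L) holomorphic_on - L" by (rule holomorphic_deriv[OF _ open_compl])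
  then show ?thesis by (rule holomorphic_transform) (auto intro: DERIV_imp_deriv wp_deriv)
qed

lemma wp_holomorphic: "wp L holomorphic_on - L"
  using wp_deriv by (auto simp: holomorphic_on_open[OF open_compl])

lemma ev_rad0: "\<forall>\<^sub>F z in at 0. z \<in> ball 0 rad0 \<and> z \<noteq> (0::complex)"
  using eventually_nhds_in_open[OF open_ball, of 0 0 rad0] rad0 unfolding eventually_at_filter
  by (auto elim: eventually_mono)

lemma wp'_deriv_periodic: assumes "w \<in> L" "z \<notin> L" shows "deriv (wp' L) (z + w) = deriv (wp' L) z"
proof -
  have "(wp' L has_field_derivative deriv (wp' L) (z + w)) (at (z + w))"
    using assms by (intro holomorphic_derivI[OF wp'_holomorphic open_compl]) (auto simp: add_in_iff)
  then have "((\<lambda>z. wp' L (z + w)) has_field_derivative deriv (wp' L) (z + w)) (at z)"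
    by (simp add: DERIV_at_within_shift[symmetric] DERIV_shift)
  then show ?thesis using wp'_periodic[OF assms(1)] by (simp add: DERIV_imp_deriv)
qed

lemma wp'_deriv_near_0:
  assumes "z \<in> ball 0 rad0" "z \<noteq> 0"
  shows "deriv (wp' L) z = 6 / z ^ 4 + deriv (deriv wp_reg) z"
proof -
  have "(deriv wp_reg has_field_derivative deriv (deriv wp_reg) z) (at z)"
    using assms by (intro holomorphic_derivI[of _ "ball 0 rad0"] holomorphic_deriv wp_reg_holomorphic) auto
  then have "((\<lambda>z. - 2 / z ^ 3 + deriv wp_reg z) has_field_derivative 6 / z ^ 4 + deriv (deriv wp_reg) z) (at z)"
    using assms(2) by (auto intro!: derivative_eq_intros) (simp add: divide_simps eval_nat_numeral)
  then have "(wp' L has_field_derivative 6 / z ^ 4 + deriv (deriv wp_reg) z) (at z)"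
    by (rule has_field_derivative_transform_within_open[of _ _ _ "ball 0 rad0 - {0}"])
       (use assms in \<open>auto simp: wp_near_0\<close>)
  then show ?thesis by (rule DERIV_imp_deriv)
qed

lemma wp_reg_tendsto:
  "(wp_reg \<longlongrightarrow> 0) (at 0)" "(deriv wp_reg \<longlongrightarrow> 0) (at 0)" "(deriv (deriv wp_reg) \<longlongrightarrow> 6 * eisen 4 L) (at 0)"
  "((\<lambda>z. wp_reg z / z ^ 2) \<longlongrightarrow> 3 * eisen 4 L) (at 0)"
proof -
  have 1: "deriv wp_reg has_fps_expansion fps_deriv wp_fps" and
     2: "deriv (deriv wp_reg) has_fps_expansion fps_deriv (fps_deriv wp_fps)"
    by (intro has_fps_expansion_deriv wp_reg_fps)+
  show "(wp_reg \<longlongrightarrow> 0) (at 0)" using has_fps_quotient_limit[OF wp_reg_fps, of 0] by (simp add: wp_fps_nth)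
  show "(deriv wp_reg \<longlongrightarrow> 0) (at 0)" using has_fps_quotient_limit[OF 1, of 0] wp_fps_nth(2) by simp
  show "(deriv (deriv wp_reg) \<longlongrightarrow> 6 * eisen 4 L) (at 0)"
    using has_fps_quotient_limit[OF 2, of 0] wp_fps_nth(3) by (simp add: numeral_2_eq_2)
  show "((\<lambda>z. wp_reg z / z ^ 2) \<longlongrightarrow> 3 * eisen 4 L) (at 0)"
    using has_fps_quotient_limit[OF wp_reg_fps, of 2] wp_fps_nth by (auto simp: less_2_cases_iff)
qed

text \<open>\<open>wp''\<close> and \<open>6 * wp ^ 2\<close> have the same principal part at 0, so
  their difference is an elliptic function with a limit there. The limit is
  \<open>6 G4 - 36 G4 = - 30 G4\<close>, where \<open>G4\<close> is
  \<open>eisen 4 L\<close>.\<close>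

lemma wp_ode2:
  assumes z: "z \<notin> L"
  shows "deriv (wp' L) z = 6 * wp L z ^ 2 - g2 L / 2"
proof -
  let ?f = "\<lambda>z. deriv (wp' L) z - 6 * wp L z ^ 2"
  \<comment> \<open>The difference with the poles of order four cancelled; the quotient by
    \<open>z ^ 2\<close> is the cross term of the square.\<close>
  let ?r = "\<lambda>z. deriv (deriv wp_reg) z - 12 * (wp_reg z / z ^ 2) - 6 * wp_reg z ^ 2"
  have "?f z = - 30 * eisen 4 L"
  proof (rule elliptic_const[OF _ _ _ _ z])
    show "?f holomorphic_on - L"
      by (intro holomorphic_intros holomorphic_deriv wp'_holomorphic wp_holomorphic open_compl)
    have "(?r
       \<longlongrightarrow> 6 * eisen 4 L - 12 * (3 * eisen 4 L) - 6 * 0 ^ 2) (at 0)"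
      by (intro tendsto_intros wp_reg_tendsto)
    then have "(?r \<longlongrightarrow> - 30 * eisen 4 L) (at 0)"
      by simp
    then show "(?f \<longlongrightarrow> - 30 * eisen 4 L) (at 0)"
    proof (rule Lim_transform_eventually)
      show "\<forall>\<^sub>F z in at 0. ?r z = ?f z"
        using ev_rad0
      proof eventually_elim
        case (elim z)
        then show ?case
          by (simp add: wp_near_0 wp'_deriv_near_0 divide_simps) (simp add: algebra_simps eval_nat_numeral)
      qed
    qed
  qed (auto simp: wp'_deriv_periodic wp_periodic)
  then show ?thesis unfolding g2_def by (simp add: algebra_simps)
qed

lemma wp'_deriv: "z \<notin> L \<Longrightarrow> (wp' L has_field_derivative 6 * wp L z ^ 2 - g2 L / 2) (at z)"
  using holomorphic_derivI[OF wp'_holomorphic open_compl, of z] wp_ode2[of z] by simp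

lemma wp_ode1:
  assumes z: "z \<notin> L"
  shows "wp' L z ^ 2 = 4 * wp L z ^ 3 - g2 L * wp L z - g3 L"
proof -
  let ?f = "\<lambda>z. wp' L z ^ 2 - 4 * wp L z ^ 3 + g2 L * wp L z"
  let ?h = wp_reg
  have "?f z = - 140 * eisen 6 L"
  proof (rule elliptic_const[OF _ _ _ _ z])
    show "?f holomorphic_on - L"
      by (intro holomorphic_intros wp'_holomorphic wp_holomorphic)
    \<comment> \<open>All terms still carrying a pole, put over \<open>z ^ 4\<close>. The
      coefficients below order four cancel, and the fourth is
      \<open>- 80 G6 - 60 G6 = - 140 G6\<close> with \<open>G6 = eisen 6 L\<close>.\<close>
    let ?U = "fps_const (-4) * (fps_X * fps_deriv wp_fps) - fps_const 12 * wp_fps + fps_const (60 * eisen 4 L) * fps_X ^ 2"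
    let ?u = "\<lambda>z. (-4) * (z * deriv ?h z) - 12 * ?h z + 60 * eisen 4 L * z ^ 2"
    let ?r = "\<lambda>z. ?u z / z ^ 4 + (deriv ?h z ^ 2 - 12 * (?h z * (?h z / z ^ 2)) - 4 * ?h z ^ 3 + g2 L * ?h z)"
    have U: "?u has_fps_expansion ?U"
      by (intro fps_expansion_intros wp_reg_fps)
    have n: "fps_nth ?U i = 0" if "i < 4" for i
    proof -
      have "i \<in> {0, 1, 2, 3}" using that by auto
      then show ?thesis using wp_fps_nth by (auto simp: numeral_2_eq_2 numeral_3_eq_3 fps_X_power_nth)
    qed
    have "fps_nth ?U 4 = - 140 * eisen 6 L"
      using wp_fps_nth by (simp add: eval_nat_numeral fps_X_power_nth)
    then have "((\<lambda>z. ?u z / z ^ 4) \<longlongrightarrow> - 140 * eisen 6 L) (at 0)"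
      using has_fps_quotient_limit[OF U, of 4] n by simp
    then have "(?r \<longlongrightarrow>
       - 140 * eisen 6 L + (0 ^ 2 - 12 * (0 * (3 * eisen 4 L)) - 4 * 0 ^ 3 + g2 L * 0)) (at 0)"
      by (intro tendsto_intros wp_reg_tendsto)
    then have "(?r \<longlongrightarrow>
       - 140 * eisen 6 L) (at 0)" by simp
    then show "(?f \<longlongrightarrow> - 140 * eisen 6 L) (at 0)"
    proof (rule Lim_transform_eventually)
      show "\<forall>\<^sub>F z in at 0. ?r z = ?f z"
        using ev_rad0
      proof eventually_elim
        case (elim z)
        then show ?case
          by (simp add: wp_near_0 g2_def divide_simps) (simp add: algebra_simps eval_nat_numeral)
      qed
    qed
  qed (auto simp: wp'_periodic wp_periodic)
  then show ?thesis unfolding g3_def by (simp add: algebra_simps)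
qed

text \<open>The second order equation multiplied by \<open>z ^ 2\<close>: the terms
  \<open>6 / z ^ 4\<close> cancel and the factor clears the remaining pole, so it becomes an
  identity of power series.\<close>

lemma wp_fps_ode:
  "fps_X ^ 2 * fps_deriv (fps_deriv wp_fps)
     = fps_const 12 * wp_fps + fps_const 6 * (fps_X ^ 2 * wp_fps ^ 2) - fps_const (30 * eisen 4 L) * fps_X ^ 2"
proof (rule fps_expansion_unique_complex)
  let ?h = wp_reg
  show "(\<lambda>z. 12 * ?h z + 6 * (z ^ 2 * ?h z ^ 2) - 30 * eisen 4 L * z ^ 2) has_fps_expansion
    fps_const 12 * wp_fps + fps_const 6 * (fps_X ^ 2 * wp_fps ^ 2) - fps_const (30 * eisen 4 L) * fps_X ^ 2"
    by (intro fps_expansion_intros wp_reg_fps)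
  have "(\<lambda>z. z ^ 2 * deriv (deriv ?h) z) has_fps_expansion fps_X ^ 2 * fps_deriv (fps_deriv wp_fps)"
    by (intro fps_expansion_intros wp_reg_fps)
  moreover have "\<forall>\<^sub>F z in nhds 0. z ^ 2 * deriv (deriv ?h) z = 12 * ?h z + 6 * (z ^ 2 * ?h z ^ 2) - 30 * eisen 4 L * z ^ 2"
    using eventually_nhds_in_open[OF open_ball, of 0 0 rad0, unfolded centre_in_ball, OF rad0(1)]
  proof (eventually_elim)
    case (elim z)
    show ?case
    proof (cases "z = 0")
      case True then show ?thesis using wp_reg_coeff[of 0] by simp
    next
      case False
      have "6 / z ^ 4 + deriv (deriv ?h) z = 6 * (1 / z ^ 2 + ?h z) ^ 2 - 30 * eisen 4 L"
        using wp_ode2[OF rad0_notin[OF elim False]] wp'_deriv_near_0[OF elim False] wp_near_0(1)[OF elim False]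
        by (simp add: g2_def)
      then have "deriv (deriv ?h) z = 6 * (1 / z ^ 2 + ?h z) ^ 2 - 30 * eisen 4 L - 6 / z ^ 4"
        by (simp add: algebra_simps)
      then have "z ^ 2 * deriv (deriv ?h) z = z ^ 2 * (6 * (1 / z ^ 2 + ?h z) ^ 2 - 30 * eisen 4 L - 6 / z ^ 4)"
        by simp
      also have "\<dots> = 12 * ?h z + 6 * (z ^ 2 * ?h z ^ 2) - 30 * eisen 4 L * z ^ 2"
        using False by (simp add: divide_simps) (simp add: algebra_simps eval_nat_numeral)
      finally show ?thesis .
    qed
  qed
  ultimately show "(\<lambda>z. 12 * ?h z + 6 * (z ^ 2 * ?h z ^ 2) - 30 * eisen 4 L * z ^ 2) has_fps_expansion
     fps_X ^ 2 * fps_deriv (fps_deriv wp_fps)"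
    using has_fps_expansion_cong by fastforce
qed

text \<open>The factor \<open>(n + 2) * (n + 1) - 12\<close> vanishes only for \<open>n = 2\<close>.
  Every coefficient except that of \<open>z ^ 4\<close> thus follows from earlier ones and
  \<open>g2\<close>; the exceptional one carries \<open>g3\<close>.\<close>

lemma wp_fps_rec:
  "(of_nat (n + 2) * of_nat (n + 1) - 12) * fps_nth wp_fps (n + 2)
    = 6 * fps_nth (wp_fps ^ 2) n - (if n = 0 then 30 * eisen 4 L else 0)"
proof -
  have "of_nat (n + 1) * (of_nat (n + 2) * fps_nth wp_fps (n + 2))
    = 12 * fps_nth wp_fps (n + 2) + 6 * fps_nth (wp_fps ^ 2) n - (if n = 0 then 30 * eisen 4 L else 0)"
    using arg_cong[OF wp_fps_ode, of "\<lambda>F. fps_nth F (n + 2)"]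
    by (simp add: fps_X_power_mult_nth fps_X_power_nth split: if_splits)
  then show ?thesis by (simp add: algebra_simps)
qed

end

section \<open>The invariants determine the lattice; conjugation\<close>

lemma fps_square_nth_cong:
  assumes "\<And>i. i \<le> n \<Longrightarrow> fps_nth F i = fps_nth G i"
  shows "fps_nth (F ^ 2) n = fps_nth (G ^ 2 :: complex fps) n"
  unfolding power2_eq_square fps_mult_nth by (intro sum.cong) (auto simp: assms)

text \<open>Equal invariants give equal expansions at 0, hence equal functions off both lattices by
  continuation. A point of \<open>L\<close> outside \<open>M\<close> would be a pole and a regular
  point of the same function.\<close>

lemma lattice_determined_subset:
  assumes "period_lat L w1 w2" "period_lat M v1 v2" "g2 L = g2 M" "g3 L = g3 M"
  shows "L \<subseteq> M"
proof
  interpret A: period_lat L w1 w2 by fact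
  interpret B: period_lat M v1 v2 by fact
  have e4: "eisen 4 L = eisen 4 M" using assms(3) by (simp add: g2_def)
  have e6: "eisen 6 L = eisen 6 M" using assms(4) by (simp add: g3_def)
  have "fps_nth A.wp_fps n = fps_nth B.wp_fps n" for n
  proof (induction n rule: less_induct)
    case (less n)
    \<comment> \<open>Index 4 is the one where the recursion degenerates; there equality of
      \<open>g3\<close> is used.\<close>
    consider "n = 0" | "n = 1" | "n = 4" | m where "n = m + 2" "m \<noteq> 2"
      by (metis One_nat_def add_2_eq_Suc' not0_implies_Suc numeral_plus_numeral semiring_norm(2) semiring_norm(6) add_2_eq_Suc numeral_Bit0)
    then show ?case
    proof cases
      case (4 m)
      have "fps_nth (A.wp_fps ^ 2) m = fps_nth (B.wp_fps ^ 2) m"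
        using less 4 by (intro fps_square_nth_cong) auto
      then have "(of_nat (m + 2) * of_nat (m + 1) - 12) * fps_nth A.wp_fps n
         = (of_nat (m + 2) * of_nat (m + 1) - 12 :: complex) * fps_nth B.wp_fps n"
        using A.wp_fps_rec[of m] B.wp_fps_rec[of m] e4 4 by simp
      moreover have "of_nat (m + 2) * of_nat (m + 1) - 12 \<noteq> (0::complex)"
      proof
        assume "of_nat (m + 2) * of_nat (m + 1) - 12 = (0::complex)"
        then have "of_nat ((m + 2) * (m + 1)) = (of_nat 12 :: complex)" by (simp add: algebra_simps)
        then have eq: "(m + 2) * (m + 1) = 12" by (subst (asm) of_nat_eq_iff)
        have "m < 2 \<or> m > 2" using 4 by auto
        then show False
        proof
          assume "m > 2"
          then have "(3 + 2) * (3 + 1) \<le> (m + 2) * (m + 1)" by (intro mult_le_mono) auto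
          then show False using eq by simp
        qed (use eq in \<open>auto simp: less_2_cases_iff\<close>)
      qed
      ultimately show ?thesis by simp
    qed (use A.wp_fps_nth B.wp_fps_nth e4 e6 in auto)
  qed
  then have fps: "A.wp_fps = B.wp_fps" by (rule fps_ext)
  have "\<forall>\<^sub>F z in nhds 0. A.wp_reg z = B.wp_reg z"
    using A.wp_reg_fps B.wp_reg_fps unfolding fps has_fps_expansion_def
    by (auto elim: eventually_elim2)
  then have "\<forall>\<^sub>F z in nhds 0. A.wp_reg z = B.wp_reg z \<and> z \<in> ball 0 (min A.rad0 B.rad0)"
    using eventually_nhds_in_open[OF open_ball, of 0 0 "min A.rad0 B.rad0"] A.rad0 B.rad0
    by (auto elim: eventually_elim2)
  then obtain U where U: "open U" "0 \<in> U" "\<And>z. z \<in> U \<Longrightarrow> A.wp_reg z = B.wp_reg z \<and> z \<in> ball 0 (min A.rad0 B.rad0)"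
    unfolding eventually_nhds by auto
  have eqU: "wp L z = wp M z" if "z \<in> U - {0}" for z
    using U(3)[of z] that A.wp_near_0(1)[of z] B.wp_near_0(1)[of z] by auto
  have eq: "wp L z = wp M z" if z: "z \<notin> L" "z \<notin> M" for z
  proof (rule analytic_continuation_open[of "U - {0}" "- (L \<union> M)" "wp L" "wp M"])
    show "open (U - {0})" using U(1) by auto
    show "open (- (L \<union> M))" using A.open_compl B.open_compl by (simp add: open_Int)
    show "connected (- (L \<union> M))"
      using connected_open_diff_countable[of UNIV "L \<union> M"] A.countable_L B.countable_L connected_UNIV
      by (simp add: Compl_eq_Diff_UNIV)
    show "U - {0} \<noteq> {}"
      using U(1,2) by (metis Diff_eq_empty_iff not_open_singleton subset_singletonD empty_iff)
    show "U - {0} \<subseteq> - (L \<union> M)" using U(3) A.rad0_notin B.rad0_notin by auto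
    show "wp L holomorphic_on - (L \<union> M)" by (rule holomorphic_on_subset[OF A.wp_holomorphic]) auto
    show "wp M holomorphic_on - (L \<union> M)" by (rule holomorphic_on_subset[OF B.wp_holomorphic]) auto
  qed (use z eqU in auto)
  fix w assume w: "w \<in> L"
  show "w \<in> M"
  proof (rule ccontr)
    assume nw: "w \<notin> M"
    have "((\<lambda>z. inverse (z ^ 2) + A.wp_reg z)  \<longlongrightarrow> wp M w) (at 0)"
    proof -
      have "isCont (wp M) w" using B.wp_deriv[OF nw] DERIV_isCont by blast
      then have "((\<lambda>z. wp M (w + z)) \<longlongrightarrow> wp M w) (at 0)"
        unfolding isCont_def by (rule LIM_offset_zero)
      moreover have "\<forall>\<^sub>F z in at 0. wp M (w + z) = inverse (z ^ 2) + A.wp_reg z"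
      proof -
        have "\<forall>\<^sub>F z in at w. z \<notin> M"
          using nw B.open_compl by (metis ComplD ComplI eventually_at_topological)
        then have "\<forall>\<^sub>F z in at 0. w + z \<notin> M" by (subst (asm) at_to_0) (simp add: eventually_filtermap add.commute)
        then show ?thesis using A.ev_rad0
        proof eventually_elim
          case (elim z)
          then have nz: "z \<notin> L" using A.rad0_notin by blast
          then have "wp M (w + z) = wp L (z + w)" using eq[of "z + w"] elim(1) nz A.add_in_iff[OF w, of z] by (simp add: add.commute)
          also have "\<dots> = wp L z" using w nz by (rule A.wp_periodic)
          finally show ?case using A.wp_near_0(1)[of z] elim by (simp add: field_simps)
        qed
      qed
      ultimately show ?thesis by (rule Lim_transform_eventually)
    qed
    \<comment> \<open>Multiplication by \<open>z ^ 2\<close> exposes the contradiction: the limit is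
      0 from regularity at \<open>w\<close> and 1 from the double pole.\<close>
    then have "((\<lambda>z. z ^ 2 * (inverse (z ^ 2) + A.wp_reg z)) \<longlongrightarrow> 0 ^ 2 * wp M w) (at 0)"
      by (intro tendsto_intros)
    moreover have "\<forall>\<^sub>F z in at 0. z ^ 2 * (inverse (z ^ 2) + A.wp_reg z) = 1 + z ^ 2 * A.wp_reg z"
      using A.ev_rad0 by eventually_elim (simp add: field_simps)
    ultimately have "((\<lambda>z. 1 + z ^ 2 * A.wp_reg z) \<longlongrightarrow> 0 ^ 2 * wp M w) (at 0)"
      by (rule Lim_transform_eventually)
    moreover have "((\<lambda>z. 1 + z ^ 2 * A.wp_reg z) \<longlongrightarrow> 1 + 0 ^ 2 * 0) (at 0)"
      by (intro tendsto_intros A.wp_reg_tendsto)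
    ultimately show False using LIM_unique by fastforce
  qed
qed

lemma cnj_lattice:
  assumes "period_lat L w1 w2"
  shows "period_lat (cnj ` L) (cnj w1) (cnj w2)"
proof
  interpret period_lat L w1 w2 by fact
  show "Im (cnj w2 / cnj w1) \<noteq> 0" using Im_ratio by (metis complex_cnj_divide cnj.simps(2) neg_equal_0_iff_equal)
  show "cnj ` L = {of_int a * cnj w1 + of_int b * cnj w2 | a b. True}"
    unfolding L_eq image_Collect by (intro Collect_cong) force
qed

lemma eisen_cnj: "eisen k (cnj ` L) = cnj (eisen k L)"
proof -
  have "eisen k (cnj ` L) = infsum (\<lambda>w. cnj (1 / w ^ k)) (L - {0})"
    unfolding eisen_def by (rule infsum_reindex_bij_witness[of _ cnj cnj]) auto
  then show ?thesis unfolding eisen_def infsum_cnj .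
qed

text \<open>Conjugating a lattice conjugates its invariants, so a lattice with real invariants
  shares them with its conjugate.\<close>

lemma cnj_invariant:
  assumes "period_lat L w1 w2" "g2 L \<in> \<real>" "g3 L \<in> \<real>"
  shows "cnj w \<in> L \<longleftrightarrow> w \<in> L"
proof -
  have "cnj ` L \<subseteq> L"
    using assms by (intro lattice_determined_subset[OF cnj_lattice[OF assms(1)] assms(1)])
      (auto simp: g2_def g3_def eisen_cnj Reals_cnj_iff)
  then show ?thesis by (metis complex_cnj_cnj image_subset_iff)
qed

subsection \<open>Addition theorems\<close>

context period_lat
begin

lemma log_tail_0: "log_tail rad0 0 = 0"
  unfolding log_tail_def log_factor_def by simp

lemma deriv_sigma_0: "(sg has_field_derivative 1) (at 0)"
proof -
  have "((\<lambda>z. z * exp (log_tail rad0 z)) has_field_derivative 1) (at 0)"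
    using log_tail_deriv[of 0 rad0 0] rad0 by (auto intro!: derivative_eq_intros simp: log_tail_0)
  then show ?thesis
    by (rule has_field_derivative_transform_within_open[OF _ open_ball, of _ _ _ 0 rad0])
       (use rad0 sigma_near_0 in auto)
qed

text \<open>The sigma quotient is elliptic in \<open>z\<close>, and adding \<open>wp\<close> cancels
  its double pole at 0. The sum is constant, and at \<open>z = a\<close>, where
  \<open>sg (z - a)\<close> vanishes, its value is \<open>wp L a\<close>.\<close>

lemma wp_diff_sigma:
  assumes z: "z \<notin> L" and a: "a \<notin> L"
  shows "(wp L z - wp L a) * (sg z ^ 2 * sg a ^ 2) = - (sg (z + a) * sg (z - a))"
proof -
  let ?f = "\<lambda>z. sg (z + a) * sg (z - a) / (sg z ^ 2 * sg a ^ 2) + wp L z"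
  have sa: "sg a \<noteq> 0" using a sigma_eq_0_iff by simp
  define s where "s z = exp (log_tail rad0 z)" for z
  define u where "u z = sg (z + a) * sg (z - a) / (s z ^ 2 * sg a ^ 2) + 1" for z
  have hs[holomorphic_intros]: "(\<lambda>z. sg (z + c)) holomorphic_on A" "(\<lambda>z. sg (z - c)) holomorphic_on A" for c A
    by (intro holomorphic_on_compose_gen[OF _ sigma_holomorphic[of UNIV], unfolded o_def] holomorphic_intros, auto)+
  have uhol: "u holomorphic_on ball 0 rad0"
    unfolding u_def s_def using sa by (intro holomorphic_intros log_tail_holomorphic) auto
  then have U: "u has_fps_expansion fps_expansion u 0"
    by (intro has_fps_expansion_fps_expansion[OF open_ball]) (use rad0 in auto)
  have u0: "u 0 = 0" using sa unfolding u_def s_def by (simp add: log_tail_0 sigma_minus[of a, simplified] power2_eq_square)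
  have seq: "s z = sg z / z" if "z \<in> ball 0 rad0" "z \<noteq> 0" for z
    using sigma_near_0[OF that(1)] that by (simp add: s_def)
  have ueven: "u (- z) = u z" if "z \<in> ball 0 rad0" for z
  proof (cases "z = 0")
    case False
    then have "s (- z) = s z" using seq[of z] seq[of "- z"] that by (simp add: sigma_minus)
    moreover have "sg (- z + a) * sg (- z - a) = sg (z + a) * sg (z - a)"
    proof -
      have "sg (- z + a) = - sg (z - a)" using sigma_minus[of "z - a"] by simp
      moreover have "sg (- z - a) = - sg (z + a)" using sigma_minus[of "z + a"] by simp
      ultimately show ?thesis by simp
    qed
    ultimately show ?thesis unfolding u_def by simp
  qed simp
  \<comment> \<open>Evenness removes the linear coefficient, so together with \<open>u 0 = 0\<close>
    the numerator has a double zero.\<close>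
  have "deriv u 0 = 0"
  proof -
    have d: "(u has_field_derivative deriv u 0) (at 0)"
      using rad0 by (intro holomorphic_derivI[OF uhol]) auto
    have "((\<lambda>z. u (- z)) has_field_derivative deriv u 0 * (- 1)) (at 0)"
      by (rule DERIV_chain2) (use d in \<open>auto intro!: derivative_eq_intros\<close>)
    then have "(u has_field_derivative deriv u 0 * (- 1)) (at 0)"
      by (rule has_field_derivative_transform_within_open[OF _ open_ball, of _ _ _ 0 rad0])
         (use rad0 ueven in auto)
    from DERIV_unique[OF d this] show ?thesis by simp
  qed
  then have "fps_nth (fps_expansion u 0) i = 0" if "i < 2" for i
    using that u0 unfolding fps_nth_fps_expansion[OF U] by (auto simp: less_2_cases_iff)
  from has_fps_quotient_limit[OF U this]
  obtain l where "((\<lambda>z. u z / z ^ 2) \<longlongrightarrow> l) (at 0)" by blast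
  then have "((\<lambda>z. u z / z ^ 2 + wp_reg z) \<longlongrightarrow> l + 0) (at 0)"
    by (intro tendsto_intros wp_reg_tendsto)
  then have "((\<lambda>z. u z / z ^ 2 + wp_reg z) \<longlongrightarrow> l) (at 0)" by simp
  then have lim: "(?f \<longlongrightarrow> l) (at 0)"
  proof (rule Lim_transform_eventually)
    show "\<forall>\<^sub>F z in at 0. u z / z ^ 2 + wp_reg z = ?f z"
      using ev_rad0
    proof eventually_elim
      case (elim z)
      then have "sg z = z * s z" "s z \<noteq> 0" using sigma_near_0 by (auto simp: s_def)
      then show ?case using elim sa unfolding u_def
        by (simp add: wp_near_0 power_mult_distrib add_divide_distrib)
    qed
  qed
  have fhol: "?f holomorphic_on - L"
    using sa sigma_eq_0_iff by (intro holomorphic_intros wp_holomorphic sigma_holomorphic) auto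
  have per: "?f (z + w) = ?f z" if z: "z \<notin> L" and w: "w \<in> L" for z w
  proof -
    \<comment> \<open>Common factor of numerator and denominator under the shift: the contributions
      of \<open>a\<close> and \<open>- a\<close> to the exponent cancel.\<close>
    let ?c = "psi w ^ 2 * (exp (eta w * (z + a + w / 2)) * exp (eta w * (z - a + w / 2)))"
    have "sg (z + w + a) * sg (z + w - a) = ?c * (sg (z + a) * sg (z - a))"
      using sigma_shift[OF w, of "z + a"] sigma_shift[OF w, of "z - a"]
      by (simp add: algebra_simps power2_eq_square)
    moreover have "sg (z + w) ^ 2 = ?c * sg z ^ 2"
    proof -
      have "exp (eta w * (z + a + w / 2)) * exp (eta w * (z - a + w / 2)) = exp (eta w * (z + w / 2)) ^ 2"
        unfolding exp_add[symmetric] power2_eq_square by (simp add: algebra_simps)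
      then show ?thesis using sigma_shift[OF w, of z] by (simp add: power_mult_distrib)
    qed
    moreover have "?c \<noteq> 0"
      using psi_nz[OF w] by simp
    ultimately show ?thesis using wp_periodic[OF w z] by simp
  qed
  have "?f z = l" "?f a = l"
    using elliptic_const[OF fhol per[OF _ w1_in] per[OF _ w2_in] lim] z a by blast+
  moreover have "sg 0 = 0" using sigma_eq_0_iff by simp
  ultimately have "?f z = wp L a" by simp
  then have "wp L z - wp L a = - (sg (z + a) * sg (z - a)) / (sg z ^ 2 * sg a ^ 2)"
    by (simp add: algebra_simps)
  then show ?thesis using sa z sigma_eq_0_iff[of z] by simp
qed

lemma wp_eq_iff:
  assumes "z \<notin> L" "a \<notin> L"
  shows "wp L z = wp L a \<longleftrightarrow> z + a \<in> L \<or> z - a \<in> L"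
  using wp_diff_sigma[OF assms] assms sigma_eq_0_iff
  by (metis eq_iff_diff_eq_0 mult_eq_0_iff neg_equal_0_iff_equal power_eq_0_iff)

lemma sigma_shift_deriv:
  assumes "z + c \<notin> L"
  shows "((\<lambda>z. sg (z + c)) has_field_derivative sg (z + c) * zeta (z + c)) (at z)"
proof -
  have "((\<lambda>z. sg (z + c)) has_field_derivative sg (z + c) * zeta (z + c) * 1) (at z)"
    by (rule DERIV_chain2[of sg]) (use assms in \<open>auto intro!: sigma_has_deriv_zeta derivative_eq_intros\<close>)
  then show ?thesis by simp
qed

lemma deriv_eq_on_compl:
  assumes "(f has_field_derivative D) (at z)" "(g has_field_derivative D') (at z)"
    and "\<And>x. x \<notin> L \<Longrightarrow> f x = g x" "z \<notin> L"
  shows "D = D'"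
proof -
  have "(g has_field_derivative D) (at z)"
    by (rule has_field_derivative_transform_within_open[OF assms(1) open_compl]) (use assms in auto)
  then show ?thesis using assms(2) DERIV_unique by blast
qed

text \<open>Logarithmic derivative in \<open>z\<close> of the sigma identity
  \<open>wp_diff_sigma\<close>.\<close>

lemma zeta_add_sub:
  assumes "z \<notin> L" "a \<notin> L" "z + a \<notin> L" "z - a \<notin> L"
  shows "(wp L z - wp L a) * (zeta (z + a) + zeta (z - a) - 2 * zeta z) = wp' L z"
proof -
  have nz: "sg z \<noteq> 0" "sg a \<noteq> 0" using assms sigma_eq_0_iff by auto
  have "((\<lambda>z. (wp L z - wp L a) * (sg z ^ 2 * sg a ^ 2)) has_field_derivative
      (wp' L z + 2 * (wp L z - wp L a) * zeta z) * (sg z ^ 2 * sg a ^ 2)) (at z)"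
    using wp_deriv[OF assms(1)] sigma_has_deriv_zeta[OF assms(1)]
    by (auto intro!: derivative_eq_intros simp: algebra_simps power2_eq_square)
  moreover have "((\<lambda>z. - (sg (z + a) * sg (z + - a))) has_field_derivative
      - (sg (z + a) * sg (z + - a)) * (zeta (z + a) + zeta (z + - a))) (at z)"
    using sigma_shift_deriv[of z a] sigma_shift_deriv[of z "- a"] assms
    by (auto intro!: derivative_eq_intros simp: algebra_simps)
  ultimately have "(wp' L z + 2 * (wp L z - wp L a) * zeta z) * (sg z ^ 2 * sg a ^ 2)
      = - (sg (z + a) * sg (z + - a)) * (zeta (z + a) + zeta (z + - a))"
    by (rule deriv_eq_on_compl) (use wp_diff_sigma assms in auto)
  also have "\<dots> = (wp L z - wp L a) * (zeta (z + a) + zeta (z - a)) * (sg z ^ 2 * sg a ^ 2)"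
    unfolding add_uminus_conv_diff using wp_diff_sigma[OF assms(1,2)] by algebra
  finally have "wp' L z + 2 * (wp L z - wp L a) * zeta z = (wp L z - wp L a) * (zeta (z + a) + zeta (z - a))"
    using nz by simp
  then show ?thesis by (simp add: algebra_simps)
qed

text \<open>The sigma identity differentiated at \<open>z = a\<close>, where
  \<open>wp L z - wp L a\<close> and \<open>sg (z - a)\<close> vanish and sigma has derivative 1 at
  0.\<close>

lemma wp'_sigma:
  assumes a: "a \<notin> L"
  shows "wp' L a * sg a ^ 4 = - sg (2 * a)"
proof -
  have "((\<lambda>z. (wp L z - wp L a) * (sg z ^ 2 * sg a ^ 2)) has_field_derivative
      wp' L a * sg a ^ 4) (at a)"
    using wp_deriv[OF a] sigma_has_deriv_zeta[OF a]
    by (auto intro!: derivative_eq_intros simp: eval_nat_numeral)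
  moreover have "((\<lambda>z. - (sg (z + a) * sg (z - a))) has_field_derivative - sg (2 * a)) (at a)"
  proof -
    have "((\<lambda>z. sg (z + a)) has_field_derivative deriv sg (a + a) * 1) (at a)"
      by (rule DERIV_chain2[of sg]) (auto intro!: sigma_has_deriv derivative_eq_intros)
    moreover have "((\<lambda>z. sg (z - a)) has_field_derivative 1 * 1) (at a)"
      by (rule DERIV_chain2[of sg]) (auto intro!: deriv_sigma_0 derivative_eq_intros)
    ultimately show ?thesis using sigma_eq_0_iff[of 0] by (auto intro!: derivative_eq_intros)
  qed
  ultimately show ?thesis
    by (rule deriv_eq_on_compl) (use wp_diff_sigma a in auto)
qed

lemma wp'_eq_0_iff: "a \<notin> L \<Longrightarrow> wp' L a = 0 \<longleftrightarrow> 2 * a \<in> L"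
  using wp'_sigma[of a] sigma_eq_0_iff[of a] sigma_eq_0_iff[of "2 * a"] by auto

text \<open>Equal \<open>wp\<close> values leave \<open>z\<close> congruent to \<open>a\<close> or
  to \<open>- a\<close>. In the latter case oddness of \<open>wp'\<close> gives
  \<open>wp' L a = 0\<close>, so \<open>2 * a\<close> is a period and both congruences
  agree.\<close>

lemma wp_point_inj:
  assumes "z \<notin> L" "a \<notin> L" "wp L z = wp L a" "wp' L z = wp' L a"
  shows "z - a \<in> L"
proof (rule ccontr)
  assume n: "z - a \<notin> L"
  then have za: "z + a \<in> L" using wp_eq_iff assms by blast
  have "wp' L z = - wp' L a" using wp'_periodic[OF za, of "- a"] wp'_minus[of a] by simp
  then have "wp' L a = 0" using assms(4) by simp
  then have "2 * a \<in> L" using wp'_eq_0_iff assms(2) by blast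
  from diff_in[OF za this] show False using n by simp
qed

text \<open>The slope of the chord or tangent in the coordinates \<open>(wp, wp' / 2)\<close>.
  Written with zeta, one expression covers both cases and is easily differentiated.\<close>

definition slope :: "complex \<Rightarrow> complex \<Rightarrow> complex" where
  "slope z a = zeta (z + a) - zeta z - zeta a"

lemma slope_chord:
  assumes "z \<notin> L" "a \<notin> L" "z + a \<notin> L" "z - a \<notin> L"
  shows "2 * slope z a * (wp L z - wp L a) = wp' L z - wp' L a"
proof -
  have "a - z \<notin> L" using minus_in_iff[of "z - a"] assms(4) by simp
  then have "(wp L a - wp L z) * (zeta (z + a) + zeta (a - z) - 2 * zeta a) = wp' L a"
    using zeta_add_sub[of a z] assms by (simp add: add.commute)
  moreover have "zeta (a - z) = - zeta (z - a)" using zeta_minus[OF assms(4)] by simp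
  ultimately have "(wp L a - wp L z) * (zeta (z + a) - zeta (z - a) - 2 * zeta a) = wp' L a" by simp
  moreover have "2 * slope z a * (wp L z - wp L a)
     = (wp L z - wp L a) * (zeta (z + a) + zeta (z - a) - 2 * zeta z)
       - (wp L a - wp L z) * (zeta (z + a) - zeta (z - a) - 2 * zeta a)"
    unfolding slope_def by (simp add: algebra_simps)
  ultimately show ?thesis using zeta_add_sub[OF assms] by simp
qed

text \<open>Logarithmic differentiation of the duplication formula \<open>wp'_sigma\<close>.\<close>

lemma slope_tangent:
  assumes "a \<notin> L" "2 * a \<notin> L"
  shows "2 * slope a a * wp' L a = 6 * wp L a ^ 2 - g2 L / 2"
proof -
  have nz: "sg a \<noteq> 0" using assms sigma_eq_0_iff by auto
  have "((\<lambda>a. wp' L a * sg a ^ 4) has_field_derivative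
      (6 * wp L a ^ 2 - g2 L / 2 + 4 * wp' L a * zeta a) * sg a ^ 4) (at a)"
    using wp'_deriv[OF assms(1)] sigma_has_deriv_zeta[OF assms(1)]
    by (auto intro!: derivative_eq_intros simp: algebra_simps eval_nat_numeral)
  moreover have "((\<lambda>a. - sg (2 * a)) has_field_derivative - (sg (2 * a) * zeta (2 * a) * 2)) (at a)"
    by (intro DERIV_minus DERIV_chain2[of sg "sg (2 * a) * zeta (2 * a)"])
       (use assms(2) in \<open>auto intro!: sigma_has_deriv_zeta derivative_eq_intros\<close>)
  ultimately have "(6 * wp L a ^ 2 - g2 L / 2 + 4 * wp' L a * zeta a) * sg a ^ 4 = - (sg (2 * a) * zeta (2 * a) * 2)"
    by (rule deriv_eq_on_compl) (use wp'_sigma assms in auto)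
  also have "\<dots> = - sg (2 * a) * (2 * zeta (2 * a))" by simp
  also have "\<dots> = (2 * wp' L a * zeta (2 * a)) * sg a ^ 4"
    unfolding wp'_sigma[OF assms(1), symmetric] by (simp add: mult_ac)
  finally have "6 * wp L a ^ 2 - g2 L / 2 + 4 * wp' L a * zeta a = 2 * wp' L a * zeta (2 * a)"
    using nz by simp
  then show ?thesis unfolding slope_def by (simp add: algebra_simps)
qed

text \<open>Moving \<open>z\<close> by a period adds the same quasi-period to
  \<open>zeta (z + a)\<close> and to \<open>zeta z\<close>, so congruent arguments give the tangent
  slope.\<close>

lemma slope_shift:
  assumes "a \<notin> L" "z - a \<in> L" "z + a \<notin> L"
  shows "slope z a = slope a a"
proof -
  have "z = a + (z - a)" "z + a = 2 * a + (z - a)" by simp_all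
  moreover have "2 * a \<notin> L" using assms(3) add_in_iff[OF assms(2), of "2 * a"] by (simp add: add.commute)
  ultimately have "zeta z = zeta a + eta (z - a)" "zeta (z + a) = zeta (2 * a) + eta (z - a)"
    using zeta_shift[OF assms(2)] assms by metis+
  then show ?thesis unfolding slope_def by simp
qed

lemma slope_deriv:
  assumes "z \<notin> L" "z + a \<notin> L"
  shows "((\<lambda>z. slope z a) has_field_derivative wp L z - wp L (z + a)) (at z)"
proof -
  have "((\<lambda>z. zeta (z + a)) has_field_derivative - wp L (z + a) * 1) (at z)"
    by (rule DERIV_chain2[of zeta]) (use assms in \<open>auto intro!: zeta_deriv derivative_eq_intros\<close>)
  then show ?thesis unfolding slope_def
    using zeta_deriv[OF assms(1)] by (auto intro!: derivative_eq_intros)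
qed

lemma slope_ode:
  assumes "z \<notin> L" "a \<notin> L" "z + a \<notin> L" "z - a \<notin> L"
  shows "2 * (wp L z - wp L (z + a)) * (wp L z - wp L a) + 2 * slope z a * wp' L z = 6 * wp L z ^ 2 - g2 L / 2"
proof -
  let ?S = "- L \<inter> (\<lambda>z. z + a) -` (- L) \<inter> (\<lambda>z. z - a) -` (- L)"
  have S: "open ?S" by (intro open_Int open_vimage open_compl continuous_intros)
  have "((\<lambda>z. 2 * slope z a * (wp L z - wp L a)) has_field_derivative
     2 * (wp L z - wp L (z + a)) * (wp L z - wp L a) + 2 * slope z a * wp' L z) (at z)"
    using slope_deriv[OF assms(1,3)] wp_deriv[OF assms(1)]
    by (auto intro!: derivative_eq_intros simp: algebra_simps)
  then have "((\<lambda>z. wp' L z - wp' L a) has_field_derivative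
     2 * (wp L z - wp L (z + a)) * (wp L z - wp L a) + 2 * slope z a * wp' L z) (at z)"
    by (rule has_field_derivative_transform_within_open[OF _ S]) (use slope_chord assms in auto)
  moreover have "((\<lambda>z. wp' L z - wp' L a) has_field_derivative (6 * wp L z ^ 2 - g2 L / 2)) (at z)"
    using wp'_deriv[OF assms(1)] by (auto intro!: derivative_eq_intros)
  ultimately show ?thesis by (rule DERIV_unique)
qed

text \<open>\<open>slope_ode\<close> is \<open>slope_chord\<close> differentiated in
  \<open>z\<close>. Subtracting its instances at \<open>(z, a)\<close> and \<open>(a, z)\<close>
  removes \<open>g2\<close>; the chord relation then replaces the difference of \<open>wp'\<close>
  values, and \<open>wp L z - wp L a\<close> divides out.\<close>

lemma wp_add_generic:
  assumes "z \<notin> L" "a \<notin> L" "z + a \<notin> L" "z - a \<notin> L"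
  shows "wp L (z + a) = slope z a ^ 2 - wp L z - wp L a"
proof -
  have az: "a - z \<notin> L" "a + z \<notin> L" using minus_in_iff[of "z - a"] assms(3,4) by (simp_all add: add.commute)
  have sym: "slope a z = slope z a" unfolding slope_def by (simp add: add.commute)
  have 1: "2 * (wp L z - wp L (z + a)) * (wp L z - wp L a) + 2 * slope z a * wp' L z = 6 * wp L z ^ 2 - g2 L / 2"
    by (rule slope_ode[OF assms])
  have 2: "2 * (wp L a - wp L (z + a)) * (wp L a - wp L z) + 2 * slope z a * wp' L a = 6 * wp L a ^ 2 - g2 L / 2"
    using slope_ode[OF assms(2,1) az(2,1)] sym by (simp add: add.commute)
  have 3: "2 * slope z a * (wp L z - wp L a) = wp' L z - wp' L a" by (rule slope_chord[OF assms])
  have nz: "wp L z - wp L a \<noteq> 0" using wp_eq_iff assms by simp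
  have "(wp L z - wp L a) * (wp L (z + a) - (slope z a ^ 2 - wp L z - wp L a)) * 4 = 0"
    using 1 2 3 by algebra
  then show ?thesis using nz by simp
qed

text \<open>The excluded points with \<open>z - a\<close> a period are isolated, so continuity
  extends the formula to the tangent case.\<close>

lemma wp_add:
  assumes "z \<notin> L" "a \<notin> L" "z + a \<notin> L"
  shows "wp L (z + a) = slope z a ^ 2 - wp L z - wp L a"
proof -
  let ?f = "\<lambda>z. wp L (z + a) - (slope z a ^ 2 - wp L z - wp L a)"
  have "((\<lambda>z. wp L (z + a)) has_field_derivative wp' L (z + a) * 1) (at z)"
    by (rule DERIV_chain2[of "wp L"]) (use assms in \<open>auto intro!: wp_deriv derivative_eq_intros\<close>)
  then have c: "isCont (\<lambda>z. wp L (z + a)) z" by (rule DERIV_isCont)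
  have "isCont ?f z"
    by (intro continuous_intros c DERIV_isCont[OF slope_deriv] DERIV_isCont[OF wp_deriv] assms)
  then have "(?f \<longlongrightarrow> ?f z) (at z)" by (simp add: isCont_def)
  moreover have "\<forall>\<^sub>F x in at z. ?f x = 0"
  proof -
    obtain r where r: "r > 0" "\<And>x. x \<in> ball (z - a) r \<Longrightarrow> x \<in> L \<Longrightarrow> x = z - a"
      using isolated_lattice_point by blast
    have "\<forall>\<^sub>F x in nhds z. x \<in> - L \<inter> (\<lambda>z. z + a) -` (- L)"
      by (intro eventually_nhds_in_open open_Int open_vimage open_compl continuous_intros) (use assms in auto)
    moreover have "\<forall>\<^sub>F x in nhds z. x \<in> ball z r"
      by (intro eventually_nhds_in_open) (use r in auto)
    ultimately show ?thesis unfolding eventually_at_filter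
    proof eventually_elim
      case (elim x)
      show ?case
      proof (intro impI)
        assume "x \<noteq> z"
        then have "x - a \<notin> L" using r(2)[of "x - a"] elim by (auto simp: dist_norm algebra_simps)
        then show "?f x = 0" using wp_add_generic[of x a] elim assms by simp
      qed
    qed
  qed
  then have "(?f \<longlongrightarrow> 0) (at z)" by (rule tendsto_eventually)
  ultimately have "?f z = 0" using LIM_unique by blast
  then show ?thesis by simp
qed

lemma wp'_add:
  assumes "z \<notin> L" "a \<notin> L" "z + a \<notin> L"
  shows "wp' L (z + a) = 2 * slope z a * (wp L z - wp L (z + a)) - wp' L z"
proof -
  let ?S = "- L \<inter> (\<lambda>z. z + a) -` (- L)"
  have S: "open ?S" by (intro open_Int open_vimage open_compl continuous_intros)
  have "((\<lambda>z. wp L (z + a)) has_field_derivative wp' L (z + a) * 1) (at z)"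
    by (rule DERIV_chain2[of "wp L"]) (use assms in \<open>auto intro!: wp_deriv derivative_eq_intros\<close>)
  then have "((\<lambda>z. slope z a ^ 2 - wp L z - wp L a) has_field_derivative wp' L (z + a) * 1) (at z)"
    by (rule has_field_derivative_transform_within_open[OF _ S]) (use wp_add assms in auto)
  moreover have "((\<lambda>z. slope z a ^ 2 - wp L z - wp L a) has_field_derivative
     2 * slope z a * (wp L z - wp L (z + a)) - wp' L z) (at z)"
    using slope_deriv[OF assms(1,3)] wp_deriv[OF assms(1)]
    by (auto intro!: derivative_eq_intros)
  ultimately show ?thesis using DERIV_unique by fastforce
qed

end

subsection \<open>Elliptic logarithms of real points\<close>

lemma of_real_halve_eq:
  "2 * s * of_real d = of_real c \<Longrightarrow> d \<noteq> 0 \<Longrightarrow> s = complex_of_real (c / (2 * d))"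
  by (auto simp: field_simps)

locale curve_lat = period_lat L w1 w2 for L w1 w2 +
  fixes E :: wcurve
  assumes g2_real: "g2 L = of_real (wc4 E / 12)" and g3_real: "g3 L = of_real (wc6 E / 216)"
begin

definition elog :: "complex \<Rightarrow> real ppoint \<Rightarrow> bool" where
  "elog z P \<longleftrightarrow> weier_pt E L z = map_ppoint complex_of_real P"

lemma elog_Inf: "elog z Inf \<longleftrightarrow> z \<in> L"
  unfolding elog_def weier_pt_def by (auto simp: Let_def)

text \<open>\<open>x + b2 / 12\<close> and \<open>2 * y + a1 * x + a3\<close> are the coordinates in
  which the curve takes the form satisfied by \<open>wp\<close> and \<open>wp'\<close>.\<close>

lemma elog_Pt: "elog z (Pt x y) \<longleftrightarrow> z \<notin> L \<and> wp L z = of_real (x + wb2 E / 12)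
    \<and> wp' L z = of_real (2 * y + wa1 E * x + wa3 E)"
proof (cases "z \<in> L")
  case False
  have "elog z (Pt x y) \<longleftrightarrow> wp L z - of_real (wb2 E / 12) = of_real x
     \<and> (wp' L z - of_real (wa1 E) * of_real x - of_real (wa3 E)) / 2 = of_real y"
    unfolding elog_def weier_pt_def Let_def using False by auto
  also have "wp L z - of_real (wb2 E / 12) = of_real x \<longleftrightarrow> wp L z = of_real (x + wb2 E / 12)"
    by (simp only: diff_eq_eq of_real_add)
  also have "(wp' L z - of_real (wa1 E) * of_real x - of_real (wa3 E)) / 2 = of_real y
     \<longleftrightarrow> wp' L z = of_real (2 * y + wa1 E * x + wa3 E)"
    by (auto simp: field_simps)
  finally show ?thesis using False by simp
qed (simp add: elog_def weier_pt_def)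

lemma elog_in_iff: "elog z P \<Longrightarrow> z \<in> L \<longleftrightarrow> P = Inf"
  by (cases P) (auto simp: elog_Inf elog_Pt)

lemma elog_shift:
  assumes "w \<in> L" "elog z P" shows "elog (z + w) P"
  using assms by (cases P) (auto simp: elog_Inf elog_Pt add_in add_in_iff wp_periodic wp'_periodic)

lemma elog_minus: "elog z P \<Longrightarrow> elog (- z) (pt_neg E P)"
  by (cases P) (auto simp: elog_Inf elog_Pt wp_minus wp'_minus algebra_simps)

lemma curve_equation:
  assumes "elog z (Pt x y)"
  shows "y ^ 2 + wa1 E * x * y + wa3 E * y = x ^ 3 + wa2 E * x ^ 2 + wa4 E * x + wa6 E"
proof -
  let ?X = "x + wb2 E / 12" and ?Y = "2 * y + wa1 E * x + wa3 E"
  have "wp' L z ^ 2 = 4 * wp L z ^ 3 - g2 L * wp L z - g3 L"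
    using assms wp_ode1[of z] unfolding elog_Pt by blast
  then have "complex_of_real (?Y ^ 2) = of_real (4 * ?X ^ 3 - wc4 E / 12 * ?X - wc6 E / 216)"
    using assms unfolding g2_real g3_real by (simp add: elog_Pt)
  then have "?Y ^ 2 = 4 * ?X ^ 3 - wc4 E / 12 * ?X - wc6 E / 216" by (simp only: of_real_eq_iff)
  then have "?Y ^ 2 = 4 * x ^ 3 + wb2 E * x ^ 2 + 2 * wb4 E * x + wb6 E"
    unfolding wc4_def wc6_def by (simp add: field_simps power2_eq_square power3_eq_cube)
  then show ?thesis
    unfolding wb2_def wb4_def wb6_def by (simp add: algebra_simps power2_eq_square power3_eq_cube)
qed

text \<open>Chord and tangent share this computation. The shift of the slope by
  \<open>a1 / 2\<close> comes from completing the square in \<open>y\<close>.\<close>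

lemma elog_add_affine:
  assumes z: "elog z (Pt x1 y1)" and w: "elog w (Pt x2 y2)" and zw: "z + w \<notin> L"
    and l: "slope z w = of_real (l + wa1 E / 2)" and nu: "nu = y1 - l * x1"
    and x3: "x3 = l ^ 2 + wa1 E * l - wa2 E - x1 - x2"
  shows "elog (z + w) (Pt x3 (- (l + wa1 E) * x3 - nu - wa3 E))"
proof -
  have zL: "z \<notin> L" and wL: "w \<notin> L" and zx: "wp L z = of_real (x1 + wb2 E / 12)"
    and wx: "wp L w = of_real (x2 + wb2 E / 12)"
    and zy: "wp' L z = of_real (2 * y1 + wa1 E * x1 + wa3 E)"
    using z w by (auto simp: elog_Pt)
  have "wp L (z + w) = of_real ((l + wa1 E / 2) ^ 2 - (x1 + wb2 E / 12) - (x2 + wb2 E / 12))"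
    by (simp only: wp_add[OF zL wL zw] l zx wx of_real_diff of_real_power)
  also have "(l + wa1 E / 2) ^ 2 - (x1 + wb2 E / 12) - (x2 + wb2 E / 12) = x3 + wb2 E / 12"
    unfolding x3 wb2_def by (simp add: field_simps power2_eq_square)
  finally have X: "wp L (z + w) = of_real (x3 + wb2 E / 12)" .
  have "wp' L (z + w) = of_real (2 * (l + wa1 E / 2) * ((x1 + wb2 E / 12) - (x3 + wb2 E / 12))
        - (2 * y1 + wa1 E * x1 + wa3 E))"
    by (simp only: wp'_add[OF zL wL zw] X l zx zy of_real_diff of_real_mult of_real_numeral)
  also have "2 * (l + wa1 E / 2) * ((x1 + wb2 E / 12) - (x3 + wb2 E / 12)) - (2 * y1 + wa1 E * x1 + wa3 E)
     = 2 * (- (l + wa1 E) * x3 - nu - wa3 E) + wa1 E * x3 + wa3 E"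
    unfolding nu by (simp add: algebra_simps)
  finally show ?thesis using X zw unfolding elog_Pt by blast
qed

text \<open>The addition theorem matched with the cases of \<open>pt_add\<close>: opposite points,
  chord, tangent. In each affine case only the slope and the intercept need identification.\<close>

lemma elog_add:
  assumes z: "elog z P" and w: "elog w Q"
  shows "elog (z + w) (pt_add E P Q)"
proof (cases "P = Inf \<or> Q = Inf")
  case True
  then show ?thesis
  proof
    assume "P = Inf"
    then show ?thesis using z w elog_shift[of z w Q] by (simp add: elog_Inf add.commute)
  next
    assume "Q = Inf"
    then show ?thesis using z w elog_shift[of w z P] by (cases P) (auto simp: elog_Inf)
  qed
next
  case False
  then obtain x1 y1 x2 y2 where P: "P = Pt x1 y1" and Q: "Q = Pt x2 y2" by (metis ppoint.exhaust)
  have zL: "z \<notin> L" and wL: "w \<notin> L" and zx: "wp L z = of_real (x1 + wb2 E / 12)"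
    and wx: "wp L w = of_real (x2 + wb2 E / 12)"
    and zy: "wp' L z = of_real (2 * y1 + wa1 E * x1 + wa3 E)"
    and wy: "wp' L w = of_real (2 * y2 + wa1 E * x2 + wa3 E)"
    using z w P Q by (auto simp: elog_Pt)
  have wp_iff: "wp L z = wp L w \<longleftrightarrow> x1 = x2" unfolding zx wx of_real_eq_iff by simp
  \<comment> \<open>The test for opposite points agrees with \<open>z + w\<close> being a period, by
    injectivity of the parametrization applied to \<open>z\<close> and \<open>- w\<close>.\<close>
  have opp: "x1 = x2 \<and> y1 + y2 + wa1 E * x2 + wa3 E = 0 \<longleftrightarrow> z + w \<in> L"
  proof
    assume *: "x1 = x2 \<and> y1 + y2 + wa1 E * x2 + wa3 E = 0"
    have "2 * y1 + wa1 E * x1 + wa3 E + (2 * y2 + wa1 E * x2 + wa3 E) = 2 * (y1 + y2 + wa1 E * x2 + wa3 E)"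
      unfolding conjunct1[OF *] by (simp add: algebra_simps)
    then have "2 * y1 + wa1 E * x1 + wa3 E = - (2 * y2 + wa1 E * x2 + wa3 E)" using * by simp
    then have "wp' L z = wp' L (- w)" unfolding wp'_minus zy wy by (metis of_real_minus)
    then have "z - - w \<in> L"
      using * zL wL wp_iff by (intro wp_point_inj) (auto simp: wp_minus)
    then show "z + w \<in> L" by simp
  next
    assume zw: "z + w \<in> L"
    then have x: "x1 = x2" using wp_eq_iff[OF zL wL] wp_iff by simp
    have "wp' L z = - wp' L w" using wp'_periodic[OF zw, of "- w"] by (simp add: wp'_minus)
    then have "complex_of_real (2 * y1 + wa1 E * x1 + wa3 E) = of_real (- (2 * y2 + wa1 E * x2 + wa3 E))"
      unfolding zy wy by simp
    then have "2 * y1 + wa1 E * x1 + wa3 E = - (2 * y2 + wa1 E * x2 + wa3 E)" by (simp only: of_real_eq_iff)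
    then have "2 * y1 + wa1 E * x2 + wa3 E = - (2 * y2 + wa1 E * x2 + wa3 E)" using x by simp
    then show "x1 = x2 \<and> y1 + y2 + wa1 E * x2 + wa3 E = 0" using x by linarith
  qed
  have half_frac: "(2 * A + a * D) / (2 * D) = A / D + a / 2" if "D \<noteq> 0" for A a D :: real
    using that by (simp add: field_simps)
  have frac_sub: "(y * D - A * x) / D = y - A / D * x" if "D \<noteq> 0" for y A D x :: real
    using that by (simp add: field_simps)
  show ?thesis
  proof (cases "z + w \<in> L")
    case True
    then show ?thesis using opp unfolding P Q by (simp add: elog_Inf)
  next
    case zw: False
    show ?thesis
    proof (cases "x1 = x2")
      case False
      define l where "l = (y2 - y1) / (x2 - x1)"
      have zmw: "z - w \<notin> L" using False wp_iff wp_eq_iff[OF zL wL] by blast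
      have "wp L z - wp L w = of_real (x1 - x2)" unfolding zx wx of_real_diff[symmetric] by simp
      moreover have "wp' L z - wp' L w = of_real (2 * (y1 - y2) + wa1 E * (x1 - x2))"
        unfolding zy wy of_real_diff[symmetric] by (simp add: algebra_simps)
      ultimately have "2 * slope z w * of_real (x1 - x2) = of_real (2 * (y1 - y2) + wa1 E * (x1 - x2))"
        using slope_chord[OF zL wL zw zmw] by simp
      then have "slope z w = of_real ((2 * (y1 - y2) + wa1 E * (x1 - x2)) / (2 * (x1 - x2)))"
        by (rule of_real_halve_eq) (use False in simp)
      also have "(2 * (y1 - y2) + wa1 E * (x1 - x2)) / (2 * (x1 - x2)) = l + wa1 E / 2"
        using half_frac[of "x1 - x2" "y1 - y2" "wa1 E"] minus_divide_divide[of "y2 - y1" "x2 - x1"] False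
        unfolding l_def by simp
      finally have sl: "slope z w = of_real (l + wa1 E / 2)" .
      have nu: "(y1 * x2 - y2 * x1) / (x2 - x1) = y1 - l * x1"
      proof -
        have "y1 * x2 - y2 * x1 = y1 * (x2 - x1) - (y2 - y1) * x1" by (simp add: algebra_simps)
        then show ?thesis unfolding l_def by (simp only: frac_sub[of "x2 - x1"] False eq_commute[of x2] right_minus_eq simp_thms)
      qed
      show ?thesis
        using elog_add_affine[OF z[unfolded P] w[unfolded Q] zw sl nu refl]
        unfolding P Q pt_add.simps(3) Let_def l_def[symmetric]
        by (simp only: False simp_thms if_False if_True)
    next
      case True
      then have zmw: "z - w \<in> L" using wp_iff wp_eq_iff[OF zL wL] zw by blast
      have ww: "2 * w \<notin> L" using zw add_in_iff[OF zmw, of "2 * w"] by (simp add: add.commute)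
      have "wp' L z = wp' L w" using wp'_periodic[OF zmw, of w] by simp
      then have y: "y1 = y2" unfolding zy wy of_real_eq_iff using True by simp
      let ?d = "2 * y1 + wa1 E * x1 + wa3 E"
      have "complex_of_real (2 * y2 + wa1 E * x2 + wa3 E) \<noteq> 0" using wp'_eq_0_iff[OF wL] ww unfolding wy by blast
      then have d: "?d \<noteq> 0" unfolding of_real_eq_0_iff using True y by simp
      define l where "l = (3 * x1 ^ 2 + 2 * wa2 E * x1 + wa4 E - wa1 E * y1) / ?d"
      have "2 * slope w w * of_real ?d = of_real (6 * (x1 + wb2 E / 12) ^ 2 - wc4 E / 24)"
      proof -
        have "complex_of_real (6 * X ^ 2 - c / 24) = 6 * of_real X ^ 2 - of_real (c / 12) / 2" for X c by simp
        from this[of "x2 + wb2 E / 12" "wc4 E"] show ?thesis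
          using slope_tangent[OF wL ww] unfolding wy wx g2_real True y by argo
      qed
      then have "slope w w = of_real ((6 * (x1 + wb2 E / 12) ^ 2 - wc4 E / 24) / (2 * ?d))"
        by (rule of_real_halve_eq[OF _ d])
      also have "6 * (x1 + wb2 E / 12) ^ 2 - wc4 E / 24 = 2 * (3 * x1 ^ 2 + 2 * wa2 E * x1 + wa4 E - wa1 E * y1) + wa1 E * ?d"
        unfolding wc4_def wb4_def by (simp add: power2_eq_square field_simps wb2_def)
      also have "(2 * (3 * x1 ^ 2 + 2 * wa2 E * x1 + wa4 E - wa1 E * y1) + wa1 E * ?d) / (2 * ?d) = l + wa1 E / 2"
        unfolding l_def by (rule half_frac[OF d])
      finally have sl: "slope z w = of_real (l + wa1 E / 2)"
        using slope_shift[OF wL zmw zw] by simp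
      \<comment> \<open>The intercept of the tangent in \<open>pt_add\<close> agrees with
        \<open>y1 - l * x1\<close> only modulo the curve equation.\<close>
      have ce: "y1 ^ 2 + wa1 E * x1 * y1 + wa3 E * y1 = x1 ^ 3 + wa2 E * x1 ^ 2 + wa4 E * x1 + wa6 E"
        using curve_equation z P by blast
      have "(- (x1 ^ 3) + wa4 E * x1 + 2 * wa6 E - wa3 E * y1)
          = y1 * ?d - (3 * x1 ^ 2 + 2 * wa2 E * x1 + wa4 E - wa1 E * y1) * x1"
        using ce by (simp add: power2_eq_square power3_eq_cube algebra_simps)
      then have nu: "(- (x1 ^ 3) + wa4 E * x1 + 2 * wa6 E - wa3 E * y1) / ?d = y1 - l * x1"
        unfolding l_def by (simp only: frac_sub[OF d])
      have c1: "\<not> (x1 = x2 \<and> y1 + y2 + wa1 E * x2 + wa3 E = 0)" using opp zw by blast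
      have c2: "\<not> x1 \<noteq> x2" using True by simp
      show ?thesis
        using elog_add_affine[OF z[unfolded P] w[unfolded Q] zw sl nu refl]
        unfolding P Q pt_add.simps(3) Let_def l_def[symmetric] if_not_P[OF c1] if_not_P[OF c2] .
    qed
  qed
qed

lemma elog_nmult: "elog z P \<Longrightarrow> elog (of_nat m * z) (pt_nmult E m P)"
proof (induction m)
  case (Suc m)
  have "z + of_nat m * z = of_nat (Suc m) * z" by (simp add: distrib_right)
  then show ?case using elog_add[OF Suc.prems Suc.IH[OF Suc.prems]] by (simp only: pt_nmult.simps)
qed (simp add: elog_Inf)

lemma elog_smult:
  assumes "elog z P" shows "elog (of_int c * z) (pt_smult E c P)"
proof (cases "0 \<le> c")
  case True
  then show ?thesis using elog_nmult[OF assms, of "nat c"] by (simp add: pt_smult_def)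
next
  case False
  then have "of_int c * z = - (of_nat (nat (- c)) * z)" by simp
  moreover have "pt_smult E c P = pt_neg E (pt_nmult E (nat (- c)) P)" using False by (simp add: pt_smult_def)
  ultimately show ?thesis using elog_minus[OF elog_nmult[OF assms, of "nat (- c)"]] by (simp only:)
qed

lemma elog_lincomb:
  assumes "\<And>i. i < n \<Longrightarrow> elog (z i) (P i)"
  shows "elog (\<Sum>i<n. of_int (c i) * z i) (pt_lincomb E n c P)"
  using assms
proof (induction n)
  case (Suc n)
  have "elog ((\<Sum>i<n. of_int (c i) * z i) + of_int (c n) * z n) (pt_add E (pt_lincomb E n c P) (pt_smult E (c n) (P n)))"
    by (intro elog_add elog_smult Suc.IH Suc.prems) simp_all
  then show ?case by (simp add: pt_lincomb_def)
qed (simp add: pt_lincomb_def elog_Inf)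

lemma lin_indep_elog:
  assumes "lin_indep E n P" "\<And>i. i < n \<Longrightarrow> elog (z i) (P i)"
    "(\<Sum>i<n. of_int (c i) * z i) \<in> L" "i < n"
  shows "c i = 0"
proof -
  have "elog (\<Sum>i<n. of_int (c i) * z i) (pt_lincomb E n c P)" by (rule elog_lincomb[OF assms(2)])
  then have "pt_lincomb E n c P = Inf" using elog_in_iff assms(3) by blast
  then show ?thesis using assms(1,4) unfolding lin_indep_def by blast
qed

section \<open>Compatibility with complex conjugation\<close>

lemma cnj_in_iff[simp]: "cnj w \<in> L \<longleftrightarrow> w \<in> L"
  by (rule cnj_invariant[OF period_lat_axioms]) (auto simp: g2_real g3_real)

lemma wp_cnj: "wp L (cnj z) = cnj (wp L z)"
proof -
  have "infsum (\<lambda>w. 1 / (cnj z - w) ^ 2 - 1 / w ^ 2) (L - {0}) = infsum (\<lambda>w. cnj (1 / (z - w) ^ 2 - 1 / w ^ 2)) (L - {0})"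
    by (rule infsum_reindex_bij_witness[of _ cnj cnj]) auto
  then show ?thesis unfolding wp_def infsum_cnj by simp
qed

lemma wp'_cnj: "wp' L (cnj z) = cnj (wp' L z)"
proof -
  have "infsum (\<lambda>w. 1 / (cnj z - w) ^ 3) L = infsum (\<lambda>w. cnj (1 / (z - w) ^ 3)) L"
    by (rule infsum_reindex_bij_witness[of _ cnj cnj]) auto
  then show ?thesis unfolding wp'_def infsum_cnj by simp
qed

lemma sigma_cnj: "sg (cnj z) = cnj (sg z)"
proof -
  have eq: "cnj z * (\<Prod>w\<in>disc N. sigma_factor w (cnj z))
     = cnj (z * (\<Prod>w\<in>disc N. sigma_factor w z))" for N
  proof -
    have "(\<Prod>w\<in>disc N. sigma_factor w (cnj z))
       = (\<Prod>w\<in>disc N. cnj (sigma_factor w z))"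
      by (rule prod.reindex_bij_witness[of _ cnj cnj]) (auto simp: exp_cnj)
    then show ?thesis by simp
  qed
  have "(\<lambda>N. cnj (z * (\<Prod>w\<in>disc N. sigma_factor w z))) \<longlonglongrightarrow> sg (cnj z)"
    using sigma_LIMSEQ[of "cnj z"] by (simp only: eq)
  moreover have "(\<lambda>N. cnj (z * (\<Prod>w\<in>disc N. sigma_factor w z))) \<longlonglongrightarrow> cnj (sg z)"
    unfolding lim_cnj by (rule sigma_LIMSEQ)
  ultimately show ?thesis by (rule LIMSEQ_unique)
qed

text \<open>Real coordinates make \<open>z\<close> and \<open>cnj z\<close> parametrize the same
  point. This restricts \<open>Im z\<close> to half the imaginary periods.\<close>

lemma elog_diff_cnj:
  assumes "elog z P" shows "z - cnj z \<in> L"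
proof (cases P)
  case Inf
  then show ?thesis using assms by (auto simp: elog_Inf intro: diff_in)
next
  case (Pt x y)
  then have z: "z \<notin> L" "wp L z \<in> \<real>" "wp' L z \<in> \<real>" using assms by (auto simp: elog_Pt)
  have "wp L (cnj z) = wp L z" "wp' L (cnj z) = wp' L z"
    using z by (auto simp: wp_cnj wp'_cnj Reals_cnj_iff)
  then show ?thesis using z(1) by (intro wp_point_inj) auto
qed

end

subsection \<open>Equidistribution of square waves\<close>

definition square_wave :: "real \<Rightarrow> real" where
  "square_wave y = (if even \<lfloor>y\<rfloor> then 1 else - 1)"

lemma square_wave_add_int: "square_wave (y + of_int k) = (if even k then 1 else - 1) * square_wave y"
  unfolding square_wave_def by (auto simp: floor_add_int[symmetric])

lemma abs_square_wave [simp]: "\<bar>square_wave y\<bar> = 1"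
  unfolding square_wave_def by auto

definition triangle_wave :: "real \<Rightarrow> real" where
  "triangle_wave y = (if even \<lfloor>y\<rfloor> then frac y else 1 - frac y)"

lemma triangle_wave_bounds: "0 \<le> triangle_wave y" "triangle_wave y \<le> 1"
  unfolding triangle_wave_def using frac_ge_0[of y] frac_lt_1[of y] by auto

text \<open>The triangle wave is a primitive of the square wave, and a step of length less than one
  crosses at most one kink.\<close>

lemma square_wave_step:
  assumes p: "0 < p" "p < 1"
  shows "\<bar>p * square_wave a - (triangle_wave (a + p) - triangle_wave a)\<bar> \<le> 2 * p * (of_int \<lfloor>a + p\<rfloor> - of_int \<lfloor>a\<rfloor>)"
proof -
  have "\<lfloor>a + p\<rfloor> = \<lfloor>a\<rfloor> \<or> \<lfloor>a + p\<rfloor> = \<lfloor>a\<rfloor> + 1" using p by linarith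
  then show ?thesis
  proof
    assume "\<lfloor>a + p\<rfloor> = \<lfloor>a\<rfloor>"
    then show ?thesis unfolding square_wave_def triangle_wave_def frac_def by auto
  next
    assume f: "\<lfloor>a + p\<rfloor> = \<lfloor>a\<rfloor> + 1"
    have 1: "of_int \<lfloor>a\<rfloor> \<le> a" "of_int \<lfloor>a\<rfloor> + 1 \<le> a + p" "a < of_int \<lfloor>a\<rfloor> + 1"
      using f by linarith+
    show ?thesis
      using 1 p unfolding square_wave_def triangle_wave_def frac_def f by (simp add: abs_le_iff; linarith)
  qed
qed

text \<open>The triangle wave telescopes to at most 1, and at most \<open>K * p + 1\<close> kinks
  are crossed, each costing \<open>2 * p\<close>. Dividing by \<open>p\<close> leaves the stated
  bound, uniform in \<open>y\<close>.\<close>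

lemma square_wave_slow_sum:
  assumes p: "0 < p" "p < 1"
  shows "\<bar>\<Sum>i<K. square_wave (y + real i * p)\<bar> \<le> 1 / p + 2 * real K * p + 2"
proof -
  let ?a = "\<lambda>i. y + real i * p"
  have "\<bar>p * (\<Sum>i<K. square_wave (?a i)) - (triangle_wave (?a K) - triangle_wave (?a 0))\<bar>
      \<le> 2 * p * (of_int \<lfloor>?a K\<rfloor> - of_int \<lfloor>?a 0\<rfloor>)"
  proof (induction K)
    case (Suc K)
    have "?a (Suc K) = ?a K + p" by (simp add: algebra_simps)
    then show ?case using Suc square_wave_step[OF p, of "?a K"] by (simp add: algebra_simps)
  qed simp
  moreover have "\<bar>triangle_wave (?a K) - triangle_wave (?a 0)\<bar> \<le> 1"
    using triangle_wave_bounds[of "?a K"] triangle_wave_bounds[of "?a 0"] by linarith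
  moreover have "2 * p * (of_int \<lfloor>?a K\<rfloor> - of_int \<lfloor>?a 0\<rfloor>) \<le> 2 * p * (real K * p + 1)"
  proof (rule mult_left_mono)
    have "of_int \<lfloor>?a K\<rfloor> \<le> ?a K" "?a 0 < of_int \<lfloor>?a 0\<rfloor> + 1" by linarith+
    then have "of_int \<lfloor>?a K\<rfloor> - of_int \<lfloor>?a 0\<rfloor> \<le> ?a K - (?a 0 - 1)" by linarith
    then show "of_int \<lfloor>?a K\<rfloor> - of_int \<lfloor>?a 0\<rfloor> \<le> real K * p + 1" by (simp only: of_nat_0 mult_zero_left add_0_right)
  qed (use p in auto)
  ultimately have "\<bar>p * (\<Sum>i<K. square_wave (?a i))\<bar> \<le> 1 + 2 * p * (real K * p + 1)" by linarith
  then have "p * \<bar>\<Sum>i<K. square_wave (?a i)\<bar> \<le> 1 + 2 * p * (real K * p + 1)"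
    using p by (simp add: abs_mult)
  also have "\<dots> = p * (1 / p + 2 * real K * p + 2)" using p by (simp add: field_simps)
  finally show ?thesis using p by simp
qed

text \<open>Some multiple \<open>h * \<alpha>\<close> is slightly above an even integer, so along
  each residue class modulo \<open>h\<close> the wave is sampled slowly. Uniformity in
  \<open>y\<close> matters because lines start at all points of a box.\<close>

lemma square_wave_sum_small:
  assumes irr: "\<alpha> \<notin> \<rat>" and d: "\<delta> > 0"
  obtains N0 where "\<And>N y. N \<ge> N0 \<Longrightarrow> \<bar>\<Sum>j<N. square_wave (y + real j * \<alpha>)\<bar> \<le> \<delta> * real N"
proof -
  \<comment> \<open>With \<open>p < e \<le> \<delta> / 4\<close> the main term
    \<open>2 * N * p\<close> costs at most half of the allowed \<open>\<delta> * N\<close>; the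
    bound 1/2 ensures \<open>p < 1\<close>.\<close>
  define e where "e = min (1/2) (\<delta> / 4)"
  have e: "0 < e" "e < 1" "e \<le> \<delta> / 4" using d by (auto simp: e_def)
  have irr2: "\<alpha> / 2 \<notin> \<rat>"
    using irr Rats_mult[of "\<alpha> / 2" 2] by auto
  have "0 \<le> e / 4" "e / 4 \<le> 1" "e / 8 > 0" using e by auto
  \<comment> \<open>The wave has period 2, hence \<open>\<alpha> / 2\<close>. Approximating
    \<open>e / 4\<close> to within \<open>e / 8\<close> keeps \<open>p\<close> away from 0 and below
    \<open>e\<close>.\<close>
  then obtain h :: nat where h: "h > 0" "\<bar>frac (real h * (\<alpha> / 2)) - e / 4\<bar> < e / 8"
    using Kronecker_approx_1_explicit[OF irr2] by blast
  define p where "p = 2 * frac (real h * (\<alpha> / 2))"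
  define t where "t = \<lfloor>real h * (\<alpha> / 2)\<rfloor>"
  have p: "0 < p" "p < e" using h(2) e(1) unfolding p_def by linarith+
  have ha: "real h * \<alpha> = of_int (2 * t) + p" unfolding p_def t_def frac_def by simp
  have shift: "square_wave (y + real (i * h + r) * \<alpha>) = square_wave ((y + real r * \<alpha>) + real i * p)" for y i r
  proof -
    have "y + real (i * h + r) * \<alpha> = y + real r * \<alpha> + real i * (real h * \<alpha>)" by (simp add: algebra_simps)
    also have "\<dots> = ((y + real r * \<alpha>) + real i * p) + of_int (2 * (int i * t))"
      unfolding ha by (simp add: algebra_simps)
    finally have eq: "y + real (i * h + r) * \<alpha> = \<dots>" .
    show ?thesis unfolding eq square_wave_add_int by simp
  qed
  have bound: "\<bar>\<Sum>j<N. square_wave (y + real j * \<alpha>)\<bar> \<le> 2 * real N * p + real h / p + 3 * real h" for N y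
  proof -
    define K where "K = N div h"
    define R where "R = N mod h"
    have N: "N = K * h + R" "R < h" unfolding K_def R_def using h(1) by auto
    have "(\<Sum>j<K * h. square_wave (y + real j * \<alpha>)) = (\<Sum>i<K. \<Sum>j\<in>{i * h..<i * h + h}. square_wave (y + real j * \<alpha>))"
      by (rule sum.nat_group[symmetric])
    also have "\<dots> = (\<Sum>i<K. \<Sum>r<h. square_wave ((y + real r * \<alpha>) + real i * p))"
    proof (rule sum.cong[OF refl])
      fix i
      show "(\<Sum>j\<in>{i * h..<i * h + h}. square_wave (y + real j * \<alpha>)) = (\<Sum>r<h. square_wave ((y + real r * \<alpha>) + real i * p))"
      proof (rule sum.reindex_bij_witness[of _ "\<lambda>r. i * h + r" "\<lambda>j. j - i * h"])
        fix a assume "a \<in> {i * h..<i * h + h}"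
        then have "i * h + (a - i * h) = a" by auto
        then show "square_wave ((y + real (a - i * h) * \<alpha>) + real i * p) = square_wave (y + real a * \<alpha>)"
          using shift[of y i "a - i * h"] by metis
      qed auto
    qed
    also have "\<dots> = (\<Sum>r<h. \<Sum>i<K. square_wave ((y + real r * \<alpha>) + real i * p))" by (rule sum.swap)
    finally have "\<bar>\<Sum>j<K * h. square_wave (y + real j * \<alpha>)\<bar> \<le> (\<Sum>r<h. \<bar>\<Sum>i<K. square_wave ((y + real r * \<alpha>) + real i * p)\<bar>)"
      by (simp add: sum_abs)
    also have "\<dots> \<le> (\<Sum>r<h. 1 / p + 2 * real K * p + 2)"
      by (intro sum_mono square_wave_slow_sum) (use p e in auto)
    also have "\<dots> = real h / p + 2 * (real K * real h) * p + 2 * real h" by (simp add: algebra_simps)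
    also have "\<dots> \<le> real h / p + 2 * real N * p + 2 * real h"
      using p N(1) by (simp add: mult_right_mono)
    finally have 1: "\<bar>\<Sum>j<K * h. square_wave (y + real j * \<alpha>)\<bar> \<le> real h / p + 2 * real N * p + 2 * real h" .
    have "(\<Sum>j<N. square_wave (y + real j * \<alpha>)) = (\<Sum>j<K * h. square_wave (y + real j * \<alpha>)) + (\<Sum>j\<in>{K * h..<N}. square_wave (y + real j * \<alpha>))"
      unfolding lessThan_atLeast0 by (rule sum.atLeastLessThan_concat[symmetric]) (use N in auto)
    moreover have "\<bar>\<Sum>j\<in>{K * h..<N}. square_wave (y + real j * \<alpha>)\<bar> \<le> (\<Sum>j\<in>{K * h..<N}. \<bar>square_wave (y + real j * \<alpha>)\<bar>)"
      by (rule sum_abs)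
    moreover have "\<dots> \<le> real h" using N by simp
    ultimately show ?thesis using 1 by linarith
  qed
  show ?thesis
  proof (rule that[of "nat \<lceil>2 * (real h / p + 3 * real h) / \<delta>\<rceil>"])
    fix N :: nat and y
    assume "nat \<lceil>2 * (real h / p + 3 * real h) / \<delta>\<rceil> \<le> N"
    then have "2 * (real h / p + 3 * real h) / \<delta> \<le> real N" by linarith
    then have "real h / p + 3 * real h \<le> \<delta> / 2 * real N" using d by (simp add: field_simps)
    moreover have "2 * real N * p \<le> 2 * real N * (\<delta> / 4)"
      using p e by (intro mult_left_mono) auto
    ultimately show "\<bar>\<Sum>j<N. square_wave (y + real j * \<alpha>)\<bar> \<le> \<delta> * real N"
      using bound[where N = N and y = y] by argo
  qed
qed

section \<open>Counting signs in a box along lines\<close>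

lemma bij_betw_vbox_split:
  assumes "d < n"
  shows "bij_betw (\<lambda>(u, t). u(d := t)) (vbox n (V(d := 1)) \<times> {1..int (V d)}) (vbox n V)"
  by (rule bij_betw_byWitness[where f' = "\<lambda>v. (v(d := 1), v d)"])
     (use assms in \<open>auto simp: vbox_def fun_eq_iff split: if_splits\<close>)

lemma bij_betw_vbox_Suc:
  "bij_betw (\<lambda>(u, t). u(n := t)) (vbox n V \<times> {1..int (V n)}) (vbox (Suc n) V)"
  by (rule bij_betw_byWitness[where f' = "\<lambda>v. (v(n := 0), v n)"])
     (auto simp: vbox_def fun_eq_iff less_Suc_eq split: if_splits)

lemma finite_card_vbox: "finite (vbox n V) \<and> card (vbox n V) = (\<Prod>i<n. V i)"
proof (induction n)
  case 0
  have "vbox 0 V = {\<lambda>_. 0}" unfolding vbox_def by auto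
  then show ?case by simp
next
  case (Suc n)
  then show ?case
    using bij_betw_finite[OF bij_betw_vbox_Suc[of n V]] bij_betw_same_card[OF bij_betw_vbox_Suc[of n V]]
    by (simp add: card_cartesian_product)
qed

lemma sum_parity_split:
  fixes f :: "int \<Rightarrow> real"
  shows "(\<Sum>t\<in>{1..int M}. f t) = (\<Sum>j<(M + 1) div 2. f (1 + 2 * int j)) + (\<Sum>j<M div 2. f (2 + 2 * int j))"
proof (induction M)
  case (Suc M)
  have "{1..int (Suc M)} = insert (int (Suc M)) {1..int M}" by auto
  then have *: "(\<Sum>t\<in>{1..int (Suc M)}. f t) = f (int (Suc M)) + (\<Sum>t\<in>{1..int M}. f t)" by simp
  show ?case
  proof (cases "even M")
    case True
    then obtain m where "M = 2 * m" by auto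
    then show ?thesis using * Suc by simp
  next
    case False
    then obtain m where "M = 2 * m + 1" by (auto elim: oddE)
    then show ?thesis using * Suc by simp
  qed
qed simp

text \<open>The box is a union of lines in direction \<open>d\<close>, each split by the parity of
  its coordinate. The sign sum over the box is then small compared with its size, and that sum is
  the number of positive values minus the number of negative ones.\<close>

lemma signs_unif_of_line_sums:
  fixes W :: "(nat \<Rightarrow> int) \<Rightarrow> real"
  assumes d: "d < n"
    and nz: "\<And>v V. v \<in> vbox n V \<Longrightarrow> W v \<noteq> 0"
    and small: "\<And>\<delta>. \<delta> > 0 \<Longrightarrow> \<exists>N0. \<forall>N\<ge>N0. \<forall>v V. v \<in> vbox n V \<longrightarrow>
       \<bar>\<Sum>j<N. sgn (W (v(d := v d + 2 * int j)))\<bar> \<le> \<delta> * real N"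
  shows "signs_unif n W"
  unfolding signs_unif_def unif_distrib_mod_def
proof (intro allI impI)
  fix j :: int and \<epsilon> :: real
  assume j: "0 \<le> j \<and> j < 2" and e: "\<epsilon> > 0"
  obtain N0 where N0: "\<And>N v V. N \<ge> N0 \<Longrightarrow> v \<in> vbox n V \<Longrightarrow>
       \<bar>\<Sum>j<N. sgn (W (v(d := v d + 2 * int j)))\<bar> \<le> \<epsilon> * real N"
    using small[OF e] by blast
  show "\<exists>N. \<forall>V. (\<forall>i<n. N \<le> V i) \<longrightarrow>
     \<bar>real (card {v \<in> vbox n V. parity (W v) mod 2 = j}) / (\<Prod>i<n. real (V i)) - 1 / real_of_int 2\<bar> < \<epsilon>"
  \<comment> \<open>Makes both parity classes of a line at least \<open>N0\<close> long.\<close>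
  proof (intro exI[of _ "2 * N0 + 2"] allI impI)
    fix V :: "nat \<Rightarrow> nat" assume V: "\<forall>i<n. 2 * N0 + 2 \<le> V i"
    have Vd: "2 * N0 + 2 \<le> V d" using V d by blast
    have Vpos: "V i > 0" if "i < n" for i using V that by fastforce
    let ?B = "vbox n (V(d := 1))"
    let ?C = "real (card {v \<in> vbox n V. parity (W v) mod 2 = j})" and ?S = "\<Sum>v\<in>vbox n V. sgn (W v)"
    define M where "M = (\<Prod>i<n. real (V i))"
    have fin: "finite (vbox n V)" and cardM: "real (card (vbox n V)) = M"
      using finite_card_vbox[of n V] by (auto simp: M_def)
    have Mpos: "M > 0" unfolding M_def by (intro prod_pos) (use Vpos in auto)
    have cardB: "M = real (card ?B) * real (V d)"
      using bij_betw_same_card[OF bij_betw_vbox_split[OF d, of V]] cardM by (simp add: card_cartesian_product flip: of_nat_mult)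
    have "?S = (\<Sum>(u, t)\<in>?B \<times> {1..int (V d)}. sgn (W (u(d := t))))"
      using sum.reindex_bij_betw[OF bij_betw_vbox_split[OF d, of V], of "\<lambda>v. sgn (W v)"]
      by (simp add: case_prod_unfold)
    also have "\<dots> = (\<Sum>u\<in>?B. \<Sum>t\<in>{1..int (V d)}. sgn (W (u(d := t))))"
      by (rule sum.cartesian_product[symmetric])
    finally have sum_eq: "?S = (\<Sum>u\<in>?B. \<Sum>t\<in>{1..int (V d)}. sgn (W (u(d := t))))" .
    have inner: "\<bar>\<Sum>t\<in>{1..int (V d)}. sgn (W (u(d := t)))\<bar> \<le> \<epsilon> * real (V d)" if u: "u \<in> ?B" for u
    proof -
      have ud: "u d = 1" using u d unfolding vbox_def by auto
      have u1: "u \<in> vbox n (V(d := 1))" by (rule u)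
      \<comment> \<open>The even half line starts at coordinate 2, in a different box; this is why
        the hypothesis ranges over all \<open>V\<close>.\<close>
      have u2: "u(d := 2) \<in> vbox n (V(d := 2))" using u d unfolding vbox_def by auto
      have "\<bar>\<Sum>j<(V d + 1) div 2. sgn (W (u(d := 1 + 2 * int j)))\<bar> \<le> \<epsilon> * real ((V d + 1) div 2)"
        using N0[OF _ u1, of "(V d + 1) div 2"] Vd ud by simp
      moreover have "\<bar>\<Sum>j<V d div 2. sgn (W (u(d := 2 + 2 * int j)))\<bar> \<le> \<epsilon> * real (V d div 2)"
        using N0[OF _ u2, of "V d div 2"] Vd by simp
      moreover have "real ((V d + 1) div 2) + real (V d div 2) = real (V d)"
        by (simp flip: of_nat_add)
      then have "\<epsilon> * real ((V d + 1) div 2) + \<epsilon> * real (V d div 2) = \<epsilon> * real (V d)"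
        by (metis distrib_left)
      ultimately show ?thesis unfolding sum_parity_split by linarith
    qed
    have "\<bar>?S\<bar> \<le> (\<Sum>u\<in>?B. \<bar>\<Sum>t\<in>{1..int (V d)}. sgn (W (u(d := t)))\<bar>)"
      unfolding sum_eq by (rule sum_abs)
    also have "\<dots> \<le> (\<Sum>u\<in>?B. \<epsilon> * real (V d))" by (intro sum_mono inner)
    also have "\<dots> = \<epsilon> * M" unfolding cardB by simp
    finally have D: "\<bar>?S\<bar> \<le> \<epsilon> * M" .
    let ?P = "{v \<in> vbox n V. 0 < W v}" and ?N = "{v \<in> vbox n V. \<not> 0 < W v}"
    have split: "vbox n V = ?P \<union> ?N" "?P \<inter> ?N = {}" by auto
    have cards: "real (card ?P) + real (card ?N) = M"
      using card_Un_disjoint[of ?P ?N] fin split(2) cardM unfolding split(1)[symmetric] by simp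
    have "?S = (\<Sum>v\<in>?P. sgn (W v)) + (\<Sum>v\<in>?N. sgn (W v))"
      by (subst split(1), rule sum.union_disjoint) (use fin split(2) in auto)
    also have "(\<Sum>v\<in>?P. sgn (W v)) = (\<Sum>v\<in>?P. 1)" by (rule sum.cong) auto
    \<comment> \<open>\<open>parity\<close> sends every nonpositive value to 1; since zero does not
      occur in the box, the class consists of negative values.\<close>
    also have "(\<Sum>v\<in>?N. sgn (W v)) = (\<Sum>v\<in>?N. - 1)"
      using nz by (intro sum.cong) (auto simp: sgn_if not_less)
    finally have S: "?S = real (card ?P) - real (card ?N)" by simp
    have "j = 0 \<or> j = 1" using j by auto
    then have "\<bar>?C - M / 2\<bar> \<le> \<epsilon> * M / 2"
    proof
      assume "j = 0"
      then have "{v \<in> vbox n V. parity (W v) mod 2 = j} = ?P" unfolding parity_def by auto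
      then show ?thesis using D S cards by (simp add: abs_le_iff field_simps)
    next
      assume "j = 1"
      then have "{v \<in> vbox n V. parity (W v) mod 2 = j} = ?N" unfolding parity_def by auto
      then show ?thesis using D S cards by (simp add: abs_le_iff field_simps)
    qed
    also have "\<epsilon> * M / 2 < \<epsilon> * M" using e Mpos by simp
    finally have "\<bar>?C - M / 2\<bar> / M < \<epsilon>"
      using Mpos by (simp add: divide_less_eq)
    moreover have "\<bar>?C - M / 2\<bar> / M
       = \<bar>?C / M - 1 / 2\<bar>"
    proof -
      have "\<bar>c - M / 2\<bar> / M = \<bar>(c - M / 2) / M\<bar>" for c using Mpos by simp
      moreover have "(c - M / 2) / M = c / M - 1 / 2" for c using Mpos by (simp add: field_simps)
      ultimately show ?thesis by simp
    qed
    ultimately show "\<bar>?C / (\<Prod>i<n. real (V i)) - 1 / real_of_int 2\<bar> < \<epsilon>"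
      unfolding M_def by simp
  qed
qed

subsection \<open>Signs of sigma on real components\<close>

text \<open>The least positive element generates, by division with remainder.\<close>

lemma discrete_real_subgroup_cyclic:
  fixes S :: "real set"
  assumes diff: "\<And>x y. x \<in> S \<Longrightarrow> y \<in> S \<Longrightarrow> x - y \<in> S" and s: "s \<in> S" "s \<noteq> 0"
    and fin: "\<And>R. finite {x \<in> S. \<bar>x\<bar> \<le> R}"
  obtains g where "g > 0" "\<And>x. x \<in> S \<longleftrightarrow> (\<exists>a::int. x = of_int a * g)"
proof -
  have 0: "0 \<in> S" using diff[OF s(1) s(1)] by simp
  have neg: "- x \<in> S" if "x \<in> S" for x using diff[OF 0 that] by simp
  have add: "x + y \<in> S" if "x \<in> S" "y \<in> S" for x y using diff[OF that(1) neg[OF that(2)]] by simp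
  define A where "A = {x \<in> S. 0 < x \<and> x \<le> \<bar>s\<bar>}"
  have "finite A" by (rule finite_subset[OF _ fin[of "\<bar>s\<bar>"]]) (auto simp: A_def)
  moreover have "\<bar>s\<bar> \<in> A" using s neg[OF s(1)] by (auto simp: A_def abs_if)
  ultimately have g: "Min A \<in> A" "\<And>x. x \<in> A \<Longrightarrow> Min A \<le> x" using Min_in by auto
  define g where "g = Min A"
  have gS: "g \<in> S" "g > 0" using g(1) by (auto simp: A_def g_def)
  have gmin: "g \<le> x" if "x \<in> S" "x > 0" for x
  proof (cases "x \<le> \<bar>s\<bar>")
    case False
    then show ?thesis using g(1) by (auto simp: A_def g_def)
  qed (use g(2) that in \<open>auto simp: A_def g_def\<close>)
  have mult: "of_int a * g \<in> S" for a :: int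
    by (induction a rule: int_induct[where k = 0]) (auto simp: 0 algebra_simps intro: add diff gS)
  have "\<exists>a::int. x = of_int a * g" if x: "x \<in> S" for x
  proof -
    define r where "r = x - of_int \<lfloor>x / g\<rfloor> * g"
    have rS: "r \<in> S" unfolding r_def by (rule diff[OF x mult])
    have "of_int \<lfloor>x / g\<rfloor> * g \<le> x" "x < (of_int \<lfloor>x / g\<rfloor> + 1) * g"
      using of_int_floor_le[of "x / g"] real_of_int_floor_add_one_gt[of "x / g"] gS(2)
      by (simp_all only: pos_le_divide_eq pos_divide_less_eq)
    then have "0 \<le> r" "r < g" unfolding r_def by (auto simp: algebra_simps)
    then have "r = 0" using gmin[OF rS] by linarith
    then show ?thesis unfolding r_def by (intro exI[of _ "\<lfloor>x / g\<rfloor>"]) simp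
  qed
  then show ?thesis using that[OF gS(2)] mult by blast
qed

lemma same_sgn_of_no_zero:
  fixes g :: "real \<Rightarrow> real"
  assumes c: "continuous_on UNIV g" and nz: "\<And>x. x \<in> {a..b} \<Longrightarrow> g x \<noteq> 0" and ab: "a \<le> b"
  shows "sgn (g a) = sgn (g b)"
proof (rule ccontr)
  assume ne: "sgn (g a) \<noteq> sgn (g b)"
  have "g a \<noteq> 0" "g b \<noteq> 0" using nz[of a] nz[of b] ab by auto
  with ne consider "g a < 0" "0 < g b" | "0 < g a" "g b < 0" by (auto simp: sgn_if split: if_splits)
  moreover have "continuous_on {a..b} g" using c by (rule continuous_on_subset) simp
  ultimately obtain x where "a \<le> x" "x \<le> b" "g x = 0"
    using IVT'[of g a 0 b] IVT2'[of g b 0 a] ab by cases (metis less_imp_le)+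
  then show False using nz by auto
qed

text \<open>Zeros occur exactly at \<open>x0\<close> plus multiples of \<open>om\<close>, so the
  sign is constant between them and equals that at the midpoint. The shift rule carries it from one
  interval to the next.\<close>

lemma sgn_square_wave:
  fixes g :: "real \<Rightarrow> real"
  assumes c: "continuous_on UNIV g" and om: "om > 0"
    and shift: "\<And>x. sgn (g (x + om)) = - sgn (g x)"
    and zero: "\<And>x. g x = 0 \<longleftrightarrow> (\<exists>a::int. x - x0 = of_int a * om)"
    and gx: "g x \<noteq> 0"
  shows "sgn (g x) = sgn (g (x0 + om / 2)) * square_wave ((x - x0) / om)"
proof -
  have shifts: "sgn (g (x + of_int a * om)) = (if even a then 1 else - 1) * sgn (g x)" for a :: int and x
  proof (induction a rule: int_induct[where k = 0])
    case (step1 i)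
    then show ?case using shift[of "x + of_int i * om"] by (auto simp: algebra_simps split: if_splits)
  next
    case (step2 i)
    then show ?case using shift[of "x + of_int (i - 1) * om"] by (auto simp: algebra_simps split: if_splits)
  qed simp
  define a where "a = \<lfloor>(x - x0) / om\<rfloor>"
  define y where "y = x - of_int a * om"
  have sx: "sgn (g x) = (if even a then 1 else - 1) * sgn (g y)"
    using shifts[of y a] by (simp add: y_def)
  then have gy: "g y \<noteq> 0" using gx by (auto simp: sgn_zero_iff)
  have "of_int a \<le> (x - x0) / om" "(x - x0) / om < of_int a + 1" unfolding a_def by linarith+
  then have "x0 \<le> y" "y < x0 + om" unfolding y_def using om by (auto simp: field_simps)
  moreover have "y \<noteq> x0" using gy zero[of y] by (metis diff_self mult_zero_left of_int_0)
  ultimately have y: "x0 < y" "y < x0 + om" by auto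
  have nz: "g t \<noteq> 0" if "x0 < t" "t < x0 + om" for t
  proof
    assume "g t = 0"
    then obtain b :: int where b: "t - x0 = of_int b * om" using zero by blast
    then have "0 < of_int b * om" "of_int b * om < 1 * om" using that by linarith+
    then have "real_of_int b > 0" "real_of_int b < 1"
      using om by (simp_all only: mult_less_cancel_right_pos zero_less_mult_iff) auto
    then have "0 < b" "b < 1" by simp_all
    then show False by simp
  qed
  have "sgn (g y) = sgn (g (x0 + om / 2))"
  proof (cases "y \<le> x0 + om / 2")
    case True
    then show ?thesis by (intro same_sgn_of_no_zero[OF c] nz) (use y om in auto)
  next
    case False
    then show ?thesis by (intro same_sgn_of_no_zero[OF c, symmetric] nz) (use y om in auto)
  qed
  then show ?thesis using sx unfolding square_wave_def a_def by auto
qed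

context curve_lat
begin

text \<open>\<open>w + cnj w\<close> is a nonzero real period for a suitable generator
  \<open>w\<close>, and the real periods are discrete.\<close>

lemma real_period: obtains om where "om > 0" "\<And>x. complex_of_real x \<in> L \<longleftrightarrow> (\<exists>a::int. x = of_int a * om)"
proof -
  have "Re w1 \<noteq> 0 \<or> Re w2 \<noteq> 0"
    using Im_ratio by (auto simp: Im_divide)
  then obtain w where w: "w \<in> L" "Re w \<noteq> 0" by (metis w1_in w2_in)
  have "complex_of_real (2 * Re w) = w + cnj w" by (simp add: complex_add_cnj)
  then have s: "2 * Re w \<in> {x. complex_of_real x \<in> L}" using w add_in by auto
  have "finite {x \<in> {x. complex_of_real x \<in> L}. \<bar>x\<bar> \<le> R}" for R
    by (rule finite_imageD[of complex_of_real, OF finite_subset[OF _ finite_disc[of R]]]) (auto simp: inj_on_def)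
  then show ?thesis
    using discrete_real_subgroup_cyclic[of "{x. complex_of_real x \<in> L}" "2 * Re w"] s w that diff_in
    by (auto simp: mem_Collect_eq)
qed

lemma imag_period: obtains m where "m > 0" "\<And>y. \<i> * complex_of_real y \<in> L \<longleftrightarrow> (\<exists>a::int. y = of_int a * m)"
proof -
  have "Im w1 \<noteq> 0 \<or> Im w2 \<noteq> 0"
    using Im_ratio by (auto simp: Im_divide)
  then obtain w where w: "w \<in> L" "Im w \<noteq> 0" by (metis w1_in w2_in)
  have "\<i> * complex_of_real (2 * Im w) = w - cnj w" by (simp add: complex_diff_cnj mult_ac)
  then have s: "2 * Im w \<in> {y. \<i> * complex_of_real y \<in> L}" using w diff_in by auto
  have "finite {x \<in> {y. \<i> * complex_of_real y \<in> L}. \<bar>x\<bar> \<le> R}" for R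
    by (rule finite_imageD[of "\<lambda>y. \<i> * complex_of_real y", OF finite_subset[OF _ finite_disc[of R]]])
       (auto simp: inj_on_def norm_mult)
  moreover have "x - y \<in> {y. \<i> * complex_of_real y \<in> L}"
    if "x \<in> {y. \<i> * complex_of_real y \<in> L}" "y \<in> {y. \<i> * complex_of_real y \<in> L}" for x y
    using that diff_in[of "\<i> * of_real x" "\<i> * of_real y"] by (simp add: algebra_simps)
  ultimately show ?thesis
    using discrete_real_subgroup_cyclic[of "{y. \<i> * complex_of_real y \<in> L}" "2 * Im w"] s w that
    by (auto simp: mem_Collect_eq)
qed

lemma zeta_cnj: assumes z: "z \<notin> L" shows "zeta (cnj z) = cnj (zeta z)"
proof -
  have "(sg has_field_derivative sg (cnj z) * zeta (cnj z)) (at (cnj z))"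
    using z by (intro sigma_has_deriv_zeta) simp
  then have "((cnj \<circ> sg \<circ> cnj) has_field_derivative cnj (sg (cnj z) * zeta (cnj z))) (at z)"
    by (rule has_field_derivative_cnj_cnj)
  moreover have "cnj \<circ> sg \<circ> cnj = sg" by (simp add: fun_eq_iff sigma_cnj)
  ultimately have "cnj (sg (cnj z) * zeta (cnj z)) = sg z * zeta z"
    using DERIV_unique[OF _ sigma_has_deriv_zeta[OF z]] by simp
  then have "sg z * cnj (zeta (cnj z)) = sg z * zeta z" by (simp add: sigma_cnj)
  then have "cnj (zeta (cnj z)) = zeta z" using z sigma_eq_0_iff by simp
  then show ?thesis by (metis complex_cnj_cnj)
qed

lemma eta_cnj: assumes w: "w \<in> L" shows "eta (cnj w) = cnj (eta w)"
proof -
  let ?z = "w1 / 2"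
  have z: "?z \<notin> L" by (rule half_notin)
  then have cz: "cnj ?z \<notin> L" by (subst cnj_in_iff)
  have "zeta (cnj ?z) + eta (cnj w) = zeta (cnj ?z + cnj w)"
    using zeta_shift[of "cnj w" "cnj ?z"] w cz by simp
  also have "\<dots> = zeta (cnj (?z + w))" by simp
  also have "\<dots> = cnj (zeta (?z + w))" using z w by (intro zeta_cnj) (simp add: add_in_iff)
  also have "\<dots> = cnj (zeta ?z) + cnj (eta w)" using zeta_shift[OF w z] by simp
  also have "cnj (zeta ?z) = zeta (cnj ?z)" by (rule zeta_cnj[OF z, symmetric])
  finally show ?thesis by simp
qed

lemma eta_minus: assumes "w \<in> L" shows "eta (- w) = - eta w"
proof -
  have "eta 0 = 0" by (simp add: eta_def)
  then show ?thesis using eta_add[of w "- w"] assms by (simp add: eq_neg_iff_add_eq_0 add.commute)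
qed

end

section \<open>A real normalization of sigma over the real components\<close>

text \<open>The real and the purely imaginary periods together generate either all of
  \<open>L\<close> (rectangular case) or a sublattice of index two (rhombic case).\<close>

locale real_frame = curve_lat L w1 w2 E for L w1 w2 E +
  fixes om m :: real
  assumes om_pos: "om > 0" and real_in_iff: "\<And>x. complex_of_real x \<in> L \<longleftrightarrow> (\<exists>a::int. x = of_int a * om)"
    and m_pos: "m > 0" and imag_in_iff: "\<And>y. \<i> * complex_of_real y \<in> L \<longleftrightarrow> (\<exists>a::int. y = of_int a * m)"
begin

definition mu :: complex where "mu = \<i> * of_real m"

lemma half_not_int_multiple: "g > 0 \<Longrightarrow> g / 2 \<noteq> of_int a * (g :: real)"
proof
  assume g: "g > 0" "g / 2 = of_int a * g"
  then have "real_of_int (2 * a) = of_int 1" by simp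
  then have "2 * a = 1" by (simp only: of_int_eq_iff)
  then show False by presburger
qed

lemma om_in: "of_real om \<in> L" and om_half: "of_real om / 2 \<notin> L"
  and mu_in: "mu \<in> L" and mu_half: "mu / 2 \<notin> L"
proof -
  show "of_real om \<in> L" unfolding real_in_iff by (rule exI[of _ 1]) simp
  show "mu \<in> L" unfolding mu_def imag_in_iff by (rule exI[of _ 1]) simp
  have "complex_of_real (om / 2) \<notin> L" unfolding real_in_iff using half_not_int_multiple[OF om_pos] by blast
  then show "of_real om / 2 \<notin> L" by simp
  have "\<i> * complex_of_real (m / 2) \<notin> L" unfolding imag_in_iff using half_not_int_multiple[OF m_pos] by blast
  then show "mu / 2 \<notin> L" by (simp add: mu_def)
qed

lemma cnj_mu: "cnj mu = - mu" by (simp add: mu_def)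

lemma eta_om: "eta (of_real om) = of_real (Re (eta (of_real om)))"
  using eta_cnj[OF om_in] by (simp add: complex_eq_iff)

lemma eta_mu: "eta mu = \<i> * of_real (Im (eta mu))"
  using eta_cnj[OF mu_in] eta_minus[OF mu_in] by (simp add: cnj_mu complex_eq_iff)

text \<open>The exponent is a homogeneous quadratic form in \<open>(k, x)\<close>, which is what net
  polynomials cancel. Its second summand contributes 1 for even \<open>k\<close> and the imaginary
  unit for odd \<open>k\<close>.\<close>

definition phase :: "int \<Rightarrow> real \<Rightarrow> complex" where
  "phase k x = exp (of_int k * eta mu * of_real x / 2 + \<i> * of_real pi * of_int k ^ 2 / 2)"

definition rsig_c :: "int \<Rightarrow> real \<Rightarrow> complex" where
  "rsig_c k x = sg (of_real x + of_int k * mu / 2) / phase k x"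

text \<open>A shift by \<open>mu\<close> has constant -1, and \<open>eta mu * mu\<close> is real
  because \<open>eta mu\<close> is purely imaginary; what remains is a negative real factor.\<close>

lemma rsig_c_step: "rsig_c (k + 2) x = - of_real (exp (- (Im (eta mu) * m * of_int (k + 1) / 2))) * rsig_c k x"
proof -
  \<comment> \<open>\<open>(k + 2)^2 - k^2 = 4 * (k + 1)\<close>, so the second summand changes by a
    multiple of the period of \<open>exp\<close>.\<close>
  have ex: "of_int (k + 2) * eta mu * of_real x / 2 + \<i> * of_real pi * of_int (k + 2) ^ 2 / 2
     = (of_int k * eta mu * of_real x / 2 + \<i> * of_real pi * of_int k ^ 2 / 2) + eta mu * of_real x
       + (2 * of_int (k + 1) * of_real pi) * \<i>"
    by (simp add: field_simps power2_eq_square)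
  have ph: "phase (k + 2) x = phase k x * exp (eta mu * of_real x)"
  proof -
    have "exp ((2 * of_int (k + 1) * of_real pi) * \<i>) = 1" by (subst exp_eq_1) (auto intro!: exI[of _ "k + 1"])
    then show ?thesis unfolding phase_def ex by (simp only: exp_add mult_1_right)
  qed
  have "sg (of_real x + of_int (k + 2) * mu / 2) = sg (of_real x + of_int k * mu / 2 + mu)"
    by (simp add: field_simps)
  also have "\<dots> = - exp (eta mu * (of_real x + of_int k * mu / 2 + mu / 2)) * sg (of_real x + of_int k * mu / 2)"
    using sigma_shift[OF mu_in] psi_half_notin[OF mu_in mu_half] by simp
  also have "eta mu * (of_real x + of_int k * mu / 2 + mu / 2) = eta mu * of_real x + eta mu * mu * of_int (k + 1) / 2"
    by (simp add: field_simps)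
  also have "eta mu * mu * of_int (k + 1) / 2 = of_real (- (Im (eta mu) * m * of_int (k + 1) / 2))"
  proof -
    have i: "(\<i> * of_real a) * (\<i> * of_real b) = complex_of_real (- (a * b))" for a b by (simp add: complex_eq_iff)
    have "eta mu * mu = of_real (- (Im (eta mu) * m))"
      using i[of "Im (eta mu)" m, folded eta_mu mu_def] .
    then show ?thesis by simp
  qed
  finally have "sg (of_real x + of_int (k + 2) * mu / 2) = - (exp (eta mu * of_real x)
      * of_real (exp (- (Im (eta mu) * m * of_int (k + 1) / 2)))) * sg (of_real x + of_int k * mu / 2)"
    by (simp only: exp_add exp_of_real)
  then show ?thesis unfolding rsig_c_def ph by simp
qed

text \<open>The step by 2 reduces to \<open>k = 0\<close>, where sigma is real on the real line, and
  \<open>k = 1\<close>, where conjugation differs from the identity by the period \<open>mu\<close>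
  and the imaginary unit in \<open>phase\<close> absorbs the sign.\<close>

lemma rsig_c_real: "cnj (rsig_c k x) = rsig_c k x"
proof -
  have 0: "cnj (rsig_c 0 x) = rsig_c 0 x"
    unfolding rsig_c_def phase_def using sigma_cnj[of "of_real x"] by simp
  have 1: "cnj (rsig_c 1 x) = rsig_c 1 x"
  proof -
    let ?s = "sg (of_real x + mu / 2)" and ?e = "exp (eta mu * of_real x / 2)"
    have ph: "phase 1 x = ?e * \<i>"
    proof -
      have "exp (\<i> * of_real pi / 2) = cis (pi / 2)" by (simp add: cis_conv_exp)
      then show ?thesis unfolding phase_def by (simp add: exp_add)
    qed
    have "cnj ?e = exp (- (eta mu * of_real x / 2))"
      by (subst (1 2) eta_mu) (simp add: exp_cnj)
    then have ce: "cnj ?e = 1 / ?e" by (simp add: exp_minus field_simps)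
    have "sg (of_real x + mu / 2) = sg (of_real x - mu / 2 + mu)" by (simp add: field_simps)
    also have "\<dots> = - exp (eta mu * of_real x) * sg (of_real x - mu / 2)"
      using sigma_shift[OF mu_in, of "of_real x - mu / 2"] psi_half_notin[OF mu_in mu_half] by simp
    also have "sg (of_real x - mu / 2) = cnj ?s"
      using sigma_cnj[of "of_real x + mu / 2"] by (simp add: cnj_mu)
    also have "exp (eta mu * of_real x) = ?e * ?e" by (simp add: exp_add[symmetric] mult.commute)
    finally have s: "?s = - (?e * ?e) * cnj ?s" by simp
    have "cnj (rsig_c 1 x) = cnj ?s / (cnj ?e * (- \<i>))" unfolding rsig_c_def ph by simp
    also have "\<dots> = (- (?e * ?e) * cnj ?s) / (?e * \<i>)" unfolding ce by (simp add: field_simps)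
    also have "\<dots> = ?s / (?e * \<i>)" by (simp only: s[symmetric])
    finally show ?thesis unfolding rsig_c_def ph by simp
  qed
  have up: "cnj (rsig_c (k + 2) x) = rsig_c (k + 2) x \<longleftrightarrow> cnj (rsig_c k x) = rsig_c k x" for k
    unfolding rsig_c_step by simp
  have even: "cnj (rsig_c (2 * j + e) x) = rsig_c (2 * j + e) x" if "cnj (rsig_c e x) = rsig_c e x" for j e
  proof (induction j rule: int_induct[where k = 0])
    case (step1 i)
    then show ?case using up[of "2 * i + e"] by (simp add: algebra_simps)
  next
    case (step2 i)
    then show ?case using up[of "2 * (i - 1) + e"] by (simp add: algebra_simps)
  qed (use that in simp)
  show ?thesis
  proof (cases "even k")
    case True
    then show ?thesis using even[OF 0, of "k div 2"] by simp
  next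
    case False
    then show ?thesis using even[OF 1, of "k div 2"] by simp
  qed
qed

definition rsig :: "int \<Rightarrow> real \<Rightarrow> real" where "rsig k x = Re (rsig_c k x)"

lemma of_real_rsig: "of_real (rsig k x) = rsig_c k x"
  using rsig_c_real[of k x] unfolding rsig_def by (simp add: complex_eq_iff)

lemma sigma_rsig: "sg (of_real x + of_int k * mu / 2) = phase k x * of_real (rsig k x)"
  unfolding of_real_rsig rsig_c_def phase_def by simp

lemma rsig_eq_0_iff: "rsig k x = 0 \<longleftrightarrow> of_real x + of_int k * mu / 2 \<in> L"
  using sigma_rsig[of x k] sigma_eq_0_iff[of "of_real x + of_int k * mu / 2"] by (simp add: phase_def)

lemma sgn_rsig_step: "sgn (rsig (k + 2) x) = - sgn (rsig k x)"
proof -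
  have "complex_of_real (rsig (k + 2) x) = of_real (- exp (- (Im (eta mu) * m * of_int (k + 1) / 2)) * rsig k x)"
    unfolding of_real_rsig rsig_c_step of_real_mult of_real_minus ..
  then have "rsig (k + 2) x = - exp (- (Im (eta mu) * m * of_int (k + 1) / 2)) * rsig k x"
    by (simp only: of_real_eq_iff)
  then show ?thesis by (simp add: sgn_mult)
qed

lemma sgn_rsig_shift: "sgn (rsig (k + 2 * j) x) = (if even j then 1 else - 1) * sgn (rsig k x)"
proof (induction j rule: int_induct[where k = 0])
  case (step1 i)
  then show ?case using sgn_rsig_step[of "k + 2 * i" x] by (auto simp: algebra_simps split: if_splits)
next
  case (step2 i)
  then show ?case using sgn_rsig_step[of "k + 2 * (i - 1)" x] by (auto simp: algebra_simps split: if_splits)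
qed simp

lemma continuous_rsig: "continuous_on UNIV (rsig k)"
proof -
  have "continuous_on UNIV (\<lambda>x. sg (of_real x + of_int k * mu / 2))"
    by (rule continuous_on_compose2[OF holomorphic_on_imp_continuous_on[OF sigma_holomorphic[of UNIV]]])
       (auto intro!: continuous_intros)
  then show ?thesis unfolding rsig_def rsig_c_def phase_def by (intro continuous_intros) auto
qed

text \<open>The hypothesis says that the exponential in Legendre's relation, for the periods
  \<open>om\<close> and \<open>k * mu\<close>, is 1. Then only the constant -1 of \<open>om\<close>
  and a positive factor remain.\<close>

lemma sgn_rsig_period:
  assumes p: "exp ((eta (of_real om) * (of_int k * mu) - of_int k * eta mu * of_real om) / 2) = 1"
  shows "sgn (rsig k (x + om)) = - sgn (rsig k x)"
proof -
  have ph: "phase k (x + om) = phase k x * exp (of_int k * eta mu * of_real om / 2)"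
    unfolding phase_def exp_add[symmetric] by (simp add: field_simps)
  have "sg (of_real (x + om) + of_int k * mu / 2) = sg (of_real x + of_int k * mu / 2 + of_real om)"
    by (simp add: algebra_simps)
  also have "\<dots> = - exp (eta (of_real om) * (of_real x + of_int k * mu / 2 + of_real om / 2)) * sg (of_real x + of_int k * mu / 2)"
    using sigma_shift[OF om_in] psi_half_notin[OF om_in om_half] by simp
  also have "eta (of_real om) * (of_real x + of_int k * mu / 2 + of_real om / 2)
     = of_int k * eta mu * of_real om / 2 + (eta (of_real om) * (of_int k * mu) - of_int k * eta mu * of_real om) / 2
       + eta (of_real om) * of_real (x + om / 2)"
    by (simp add: field_simps)
  also have "eta (of_real om) * of_real (x + om / 2) = of_real (Re (eta (of_real om)) * (x + om / 2))"
    by (subst eta_om) (simp only: of_real_mult)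
  finally have "rsig_c k (x + om) = - of_real (exp (Re (eta (of_real om)) * (x + om / 2))) * rsig_c k x"
    unfolding rsig_c_def ph exp_add p exp_of_real by (simp add: mult_ac)
  then have "complex_of_real (rsig k (x + om)) = of_real (- exp (Re (eta (of_real om)) * (x + om / 2)) * rsig k x)"
    by (simp add: of_real_rsig)
  then have "rsig k (x + om) = - exp (Re (eta (of_real om)) * (x + om / 2)) * rsig k x"
    by (simp only: of_real_eq_iff)
  then show ?thesis by (simp add: sgn_mult)
qed

lemma sgn_rsig_even:
  assumes "rsig 0 x \<noteq> 0"
  shows "sgn (rsig 0 x) = sgn (rsig 0 (0 + om / 2)) * square_wave ((x - 0) / om)"
proof (rule sgn_square_wave[OF continuous_rsig om_pos _ _ assms])
  show "sgn (rsig 0 (x + om)) = - sgn (rsig 0 x)" for x by (rule sgn_rsig_period) simp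
  show "rsig 0 x = 0 \<longleftrightarrow> (\<exists>a::int. x - 0 = of_int a * om)" for x
    using real_in_iff[of x] by (simp add: rsig_eq_0_iff)
qed

text \<open>The rhombic case: a zero on the line of height \<open>m / 2\<close> forces
  \<open>(om + mu) / 2\<close> into \<open>L\<close>. The constants of \<open>om\<close>,
  \<open>mu\<close> and \<open>om + mu\<close> are then -1, -1 and 1, and \<open>psi_add\<close>
  yields the condition for the sign change.\<close>

lemma sgn_rsig_odd:
  assumes z: "rsig 1 x0 = 0" and x: "rsig 1 x \<noteq> 0"
  shows "sgn (rsig 1 x) = sgn (rsig 1 (x0 + om / 2)) * square_wave ((x - x0) / om)"
proof (rule sgn_square_wave[OF continuous_rsig om_pos _ _ x])
  have z1: "of_real x0 + mu / 2 \<in> L" using z by (simp add: rsig_eq_0_iff)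
  then have z2: "of_real x0 - mu / 2 \<in> L" using cnj_in_iff[of "of_real x0 + mu / 2"] by (simp add: cnj_mu)
  show "rsig 1 x = 0 \<longleftrightarrow> (\<exists>a::int. x - x0 = of_int a * om)" for x
  proof -
    have "rsig 1 x = 0 \<longleftrightarrow> of_real (x - x0) + (of_real x0 + mu / 2) \<in> L" by (simp add: rsig_eq_0_iff)
    also have "\<dots> \<longleftrightarrow> of_real (x - x0) \<in> L" by (rule add_in_iff[OF z1])
    finally show ?thesis unfolding real_in_iff .
  qed
  have "complex_of_real (2 * x0) \<in> L" using add_in[OF z1 z2] by simp
  then obtain a :: int where a: "2 * x0 = of_int a * om" unfolding real_in_iff by blast
  \<comment> \<open>For even \<open>a\<close> the point \<open>x0\<close> would be a period, and
    hence so would \<open>mu / 2\<close>.\<close>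
  have "odd a"
  proof
    assume "even a"
    then obtain b where "a = 2 * b" by auto
    then have "x0 = of_int b * om" using a by simp
    then have "complex_of_real x0 \<in> L" unfolding real_in_iff by blast
    from diff_in[OF z1 this] show False using mu_half by simp
  qed
  then obtain b where b: "a = 2 * b + 1" by (auto elim: oddE)
  have "om / 2 = x0 - of_int b * om" using a unfolding b by (simp add: algebra_simps)
  then have "complex_of_real (om / 2) = of_real x0 - of_real (of_int b * om)" by (metis of_real_diff)
  then have "(of_real om + mu) / 2 = (of_real x0 + mu / 2) - of_real (of_int b * om)"
    by (simp add: add_divide_distrib)
  moreover have "complex_of_real (of_int b * om) \<in> L" unfolding real_in_iff by blast
  ultimately have "(of_real om + mu) / 2 \<in> L" by (metis diff_in z1)
  then have "psi (of_real om + mu) = 1" by (rule psi_half_in)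
  then have "exp ((eta (of_real om) * mu - eta mu * of_real om) / 2) = 1"
    using psi_add[OF om_in mu_in] psi_half_notin[OF om_in om_half] psi_half_notin[OF mu_in mu_half] by simp
  then show "sgn (rsig 1 (x + om)) = - sgn (rsig 1 x)" for x
    by (intro sgn_rsig_period) simp
qed

text \<open>The rectangular case: the odd line contains no lattice point, so continuity fixes the
  sign.\<close>

lemma sgn_rsig_odd_const:
  assumes "\<And>x. rsig 1 x \<noteq> 0"
  shows "sgn (rsig 1 x) = sgn (rsig 1 0)"
proof (cases "x \<le> 0")
  case True
  then show ?thesis by (intro same_sgn_of_no_zero[OF continuous_rsig] assms)
next
  case False
  then show ?thesis by (intro same_sgn_of_no_zero[OF continuous_rsig, symmetric] assms) simp
qed

lemma sgn_rsig_mod_2: "sgn (rsig K x) = (if even (K div 2) then 1 else - 1) * sgn (rsig (K mod 2) x)"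
  using sgn_rsig_shift[of "K mod 2" "K div 2" x] by simp

text \<open>Either the line sees a square wave with irrational step, or \<open>K\<close> is odd
  without zeros and the signs alternate because \<open>kd\<close> is odd. The bound
  \<open>N0\<close> precedes \<open>K\<close> and \<open>X\<close>, so it is uniform in
  them.\<close>

lemma rsig_line_sums:
  assumes irr: "xd / om \<notin> \<rat>" and del: "\<delta> > 0"
  obtains N0 where "\<And>N K X. N \<ge> N0 \<Longrightarrow> even K \<or> odd kd \<Longrightarrow>
     (\<And>j::nat. rsig (K + 2 * (int j * kd)) (X + 2 * real j * xd) \<noteq> 0) \<Longrightarrow>
     \<bar>\<Sum>j<N. sgn (rsig (K + 2 * (int j * kd)) (X + 2 * real j * xd))\<bar> \<le> \<delta> * real N"
proof -
  \<comment> \<open>In units of \<open>om\<close> the wave argument advances by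
    \<open>2 * xd / om\<close>; the sign \<open>(-1) ^ kd\<close> from the change of
    \<open>K\<close> is encoded as an additional advance by \<open>kd\<close>.\<close>
  define \<alpha> where "\<alpha> = 2 * (xd / om) + of_int kd"
  have "\<alpha> \<notin> \<rat>"
  proof
    assume "\<alpha> \<in> \<rat>"
    then have "(\<alpha> - of_int kd) / 2 \<in> \<rat>" by (intro Rats_divide Rats_diff) auto
    then show False using irr by (simp add: \<alpha>_def)
  qed
  then obtain N1 where N1: "\<And>N y. N \<ge> N1 \<Longrightarrow> \<bar>\<Sum>j<N. square_wave (y + real j * \<alpha>)\<bar> \<le> \<delta> * real N"
    using square_wave_sum_small del by blast
  \<comment> \<open>Alternating sums are at most 1, and 1 is at most \<open>\<delta> * N\<close>
    from here on.\<close>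
  define N2 where "N2 = nat \<lceil>1 / \<delta>\<rceil>"
  have alt: "\<bar>\<Sum>j<N. if even j then 1 else - 1 :: real\<bar> \<le> 1" for N :: nat
  proof -
    have "(\<Sum>j<N. if even j then 1 else - 1 :: real) = (if even N then 0 else 1)" by (induction N) auto
    then show ?thesis by simp
  qed
  show ?thesis
  proof (rule that[of "max N1 N2"])
    fix N K X
    let ?T = "\<lambda>j::nat. sgn (rsig (K + 2 * (int j * kd)) (X + 2 * real j * xd))"
    assume N: "N \<ge> max N1 N2" and K: "even K \<or> odd kd"
      and nz: "\<And>j::nat. rsig (K + 2 * (int j * kd)) (X + 2 * real j * xd) \<noteq> 0"
    define s where "s = (if even (K div 2) then 1 else - 1 :: real)"
    have s: "\<bar>s\<bar> = 1" by (simp add: s_def)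
    have term_eq: "?T j
       = (if even (int j * kd) then 1 else - 1) * (s * sgn (rsig (K mod 2) (X + 2 * real j * xd)))" for j :: nat
      unfolding sgn_rsig_shift sgn_rsig_mod_2[of K] s_def by simp
    have nz': "rsig (K mod 2) (X + 2 * real j * xd) \<noteq> 0" for j :: nat
      using nz[of j] term_eq[of j] by (auto simp: sgn_zero_iff)
    have wave: "\<bar>sum ?T {..<N}\<bar> \<le> \<delta> * real N"
      if c: "\<And>x. rsig (K mod 2) x \<noteq> 0 \<Longrightarrow> sgn (rsig (K mod 2) x) = c * square_wave ((x - x0) / om)" and c1: "\<bar>c\<bar> \<le> 1" for c x0
    proof -
      have "?T j = s * c * square_wave ((X - x0) / om + real j * \<alpha>)" for j :: nat
      proof -
        have "(X - x0) / om + real j * \<alpha> = (X + 2 * real j * xd - x0) / om + of_int (int j * kd)"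
          using om_pos by (simp add: \<alpha>_def field_simps)
        then have "square_wave ((X - x0) / om + real j * \<alpha>)
            = (if even (int j * kd) then 1 else - 1) * square_wave ((X + 2 * real j * xd - x0) / om)"
          by (simp only: square_wave_add_int)
        then show ?thesis unfolding term_eq using c[OF nz'] by simp
      qed
      then have "\<bar>sum ?T {..<N}\<bar>
         = \<bar>c\<bar> * \<bar>\<Sum>j<N. square_wave ((X - x0) / om + real j * \<alpha>)\<bar>"
        by (simp add: sum_distrib_left[symmetric] abs_mult s)
      also have "\<dots> \<le> 1 * (\<delta> * real N)" using N by (intro mult_mono c1 N1) auto
      finally show ?thesis by simp
    qed
    show "\<bar>sum ?T {..<N}\<bar> \<le> \<delta> * real N"
    proof (cases "even K")
      case True
      then have "K mod 2 = 0" by presburger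
      then show ?thesis using wave[of "sgn (rsig 0 (0 + om / 2))" 0] sgn_rsig_even by (simp add: abs_sgn_eq)
    next
      case False
      then have K1: "K mod 2 = 1" and kd: "odd kd" using K by presburger+
      show ?thesis
      proof (cases "\<exists>x0. rsig 1 x0 = 0")
        case True
        then obtain x0 where "rsig 1 x0 = 0" by blast
        then show ?thesis using wave[of "sgn (rsig 1 (x0 + om / 2))" x0] sgn_rsig_odd K1 by (simp add: abs_sgn_eq)
      next
        case False
        then have "sgn (rsig 1 x) = sgn (rsig 1 0)" for x using sgn_rsig_odd_const by blast
        then have "?T j = (s * sgn (rsig 1 0)) * (if even j then 1 else - 1)" for j :: nat
          unfolding term_eq K1 using kd by simp
        then have "\<bar>sum ?T {..<N}\<bar>
           = \<bar>sgn (rsig 1 0)\<bar> * \<bar>\<Sum>j<N. if even j then 1 else - 1 :: real\<bar>"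
          by (simp add: sum_distrib_left[symmetric] abs_mult s)
        also have "\<dots> \<le> 1 * 1" by (intro mult_mono alt) (auto simp: abs_sgn_eq)
        also have "\<dots> \<le> \<delta> * real N"
        proof -
          have "1 / \<delta> \<le> real N" using N unfolding N2_def by linarith
          then show ?thesis using del by (simp add: field_simps)
        qed
        finally show ?thesis .
      qed
    qed
  qed
qed

end

subsection \<open>Net polynomials\<close>

lemma sum_pairs_symmetric:
  fixes f :: "nat \<Rightarrow> nat \<Rightarrow> 'a :: ab_group_add"
  shows "(\<Sum>i<n. \<Sum>j\<in>{i<..<n}. f i j + f j i) = (\<Sum>i<n. \<Sum>j<n. f i j) - (\<Sum>i<n. f i i)"
proof (induction n)
  case (Suc n)
  have "{i<..<Suc n} = insert n {i<..<n}" if "i < n" for i using that by auto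
  then have "(\<Sum>i<n. \<Sum>j\<in>{i<..<Suc n}. f i j + f j i) = (\<Sum>i<n. (f i n + f n i) + (\<Sum>j\<in>{i<..<n}. f i j + f j i))"
    by (intro sum.cong) auto
  moreover have "{n<..<Suc n} = {}" by auto
  ultimately show ?case using Suc by (simp add: sum.distrib algebra_simps)
qed simp

lemma sgn_power_int_parity:
  fixes a :: real
  assumes "a \<noteq> 0" shows "sgn (a powi e) = (if even e then 1 else sgn a)"
proof -
  have sq: "sgn (a powi (2 * t)) = 1" for t
  proof -
    have "a powi (2 * t) = (a powi t) * (a powi t)" using assms by (simp add: power_int_add[symmetric])
    then show ?thesis using assms by (simp add: sgn_mult sgn_if)
  qed
  show ?thesis
  proof (cases "even e")
    case True
    then show ?thesis using sq[of "e div 2"] by simp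
  next
    case False
    then obtain t where t: "e = 2 * t + 1" by (auto elim: oddE)
    have "a powi e = a powi (2 * t) * a" unfolding t using assms by (simp add: power_int_add)
    then show ?thesis using sq[of t] False by (simp add: sgn_mult)
  qed
qed

lemma sgn_prod_real: "sgn (\<Prod>i\<in>A. f i) = (\<Prod>i\<in>A. sgn (f i :: real))"
  by (induction A rule: infinite_finite_induct) (auto simp: sgn_mult)

lemma even_sum_cong:
  fixes f g :: "'a \<Rightarrow> int"
  assumes "\<And>i. i \<in> A \<Longrightarrow> even (f i) \<longleftrightarrow> even (g i)"
  shows "even (sum f A) \<longleftrightarrow> even (sum g A)"
  using assms by (induction A rule: infinite_finite_induct) auto

text \<open>A net polynomial without its numerator sigma value, with \<open>a\<close> and
  \<open>b\<close> in place of the values of sigma at the \<open>z i\<close> and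
  \<open>z i + z j\<close>.\<close>

definition net_sign :: "nat \<Rightarrow> (nat \<Rightarrow> real) \<Rightarrow> (nat \<Rightarrow> nat \<Rightarrow> real) \<Rightarrow> (nat \<Rightarrow> int) \<Rightarrow> real" where
  "net_sign n a b v = (-1) powi ((\<Sum>i<n. v i ^ 2) - (\<Sum>i<n. \<Sum>j\<in>{i<..<n}. v i * v j) - 1)
     / ((\<Prod>i<n. a i powi (2 * v i ^ 2 - (\<Sum>j<n. v i * v j)))
        * (\<Prod>i<n. \<Prod>j\<in>{i<..<n}. b i j powi (v i * v j)))"

text \<open>The sign of each real power depends on the parity of its exponent, and all exponents are
  integral polynomials in \<open>v\<close>.\<close>

lemma sgn_net_sign_cong:
  assumes par: "\<And>i. i < n \<Longrightarrow> even (v i) \<longleftrightarrow> even (v' i)"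
    and a: "\<And>i. i < n \<Longrightarrow> a i \<noteq> 0" and b: "\<And>i j. i < j \<Longrightarrow> j < n \<Longrightarrow> b i j \<noteq> 0"
  shows "sgn (net_sign n a b v) = sgn (net_sign n a b v')"
proof -
  have "even ((\<Sum>i<n. v i ^ 2) - (\<Sum>i<n. \<Sum>j\<in>{i<..<n}. v i * v j) - 1)
      \<longleftrightarrow> even ((\<Sum>i<n. v' i ^ 2) - (\<Sum>i<n. \<Sum>j\<in>{i<..<n}. v' i * v' j) - 1)"
    using even_sum_cong[of "{..<n}" "\<lambda>i. v i ^ 2" "\<lambda>i. v' i ^ 2"]
      even_sum_cong[of "{..<n}" "\<lambda>i. \<Sum>j\<in>{i<..<n}. v i * v j" "\<lambda>i. \<Sum>j\<in>{i<..<n}. v' i * v' j"]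
      even_sum_cong[of "{i<..<n}" "\<lambda>j. v i * v j" "\<lambda>j. v' i * v' j" for i]
    by (auto simp: par)
  then have 1: "sgn ((-1 :: real) powi ((\<Sum>i<n. v i ^ 2) - (\<Sum>i<n. \<Sum>j\<in>{i<..<n}. v i * v j) - 1))
     = sgn ((-1) powi ((\<Sum>i<n. v' i ^ 2) - (\<Sum>i<n. \<Sum>j\<in>{i<..<n}. v' i * v' j) - 1))"
    by (simp only: sgn_power_int_parity[of "- 1"] neg_equal_0_iff_equal one_neq_zero not_False_eq_True)
  have 2: "sgn (a i powi (2 * v i ^ 2 - (\<Sum>j<n. v i * v j))) = sgn (a i powi (2 * v' i ^ 2 - (\<Sum>j<n. v' i * v' j)))"
    if "i < n" for i
  proof -
    have "even (2 * v i ^ 2 - (\<Sum>j<n. v i * v j)) \<longleftrightarrow> even (2 * v' i ^ 2 - (\<Sum>j<n. v' i * v' j))"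
      using even_sum_cong[of "{..<n}" "\<lambda>j. v i * v j" "\<lambda>j. v' i * v' j"] that by (simp add: par)
    then show ?thesis by (simp only: sgn_power_int_parity[OF a[OF that]])
  qed
  have 3: "sgn (b i j powi (v i * v j)) = sgn (b i j powi (v' i * v' j))" if "i < n" "j \<in> {i<..<n}" for i j
  proof -
    have "even (v i * v j) \<longleftrightarrow> even (v' i * v' j)" using that by (simp add: par)
    moreover have bn: "b i j \<noteq> 0" using b that by simp
    ultimately show ?thesis by (simp only: sgn_power_int_parity[OF bn])
  qed
  have 4: "(\<Prod>i<n. sgn (a i powi (2 * v i ^ 2 - (\<Sum>j<n. v i * v j))))
      = (\<Prod>i<n. sgn (a i powi (2 * v' i ^ 2 - (\<Sum>j<n. v' i * v' j))))"
    by (intro prod.cong refl 2) auto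
  have 5: "(\<Prod>i<n. \<Prod>j\<in>{i<..<n}. sgn (b i j powi (v i * v j)))
      = (\<Prod>i<n. \<Prod>j\<in>{i<..<n}. sgn (b i j powi (v' i * v' j)))"
    by (intro prod.cong refl 3) auto
  show ?thesis
    unfolding net_sign_def sgn_divide sgn_mult sgn_prod_real 1 4 5 ..
qed

lemma net_sign_nz:
  assumes a: "\<And>i. i < n \<Longrightarrow> a i \<noteq> 0" and b: "\<And>i j. i < j \<Longrightarrow> j < n \<Longrightarrow> b i j \<noteq> 0"
  shows "net_sign n a b v \<noteq> 0"
  unfolding net_sign_def using a b by (auto simp: power_int_eq_0_iff)

context real_frame
begin

definition freq :: "nat \<Rightarrow> (nat \<Rightarrow> int) \<Rightarrow> (nat \<Rightarrow> int) \<Rightarrow> int" where "freq n k v = (\<Sum>i<n. v i * k i)"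
definition posn :: "nat \<Rightarrow> (nat \<Rightarrow> real) \<Rightarrow> (nat \<Rightarrow> int) \<Rightarrow> real" where "posn n x v = (\<Sum>i<n. of_int (v i) * x i)"

lemma lincomb_eq:
  assumes "\<And>i. i < n \<Longrightarrow> z i = of_real (x i) + of_int (k i) * mu / 2"
  shows "(\<Sum>i<n. of_int (v i) * z i) = of_real (posn n x v) + of_int (freq n k v) * mu / 2"
proof -
  have "(\<Sum>i<n. of_int (v i) * z i) = (\<Sum>i<n. of_int (v i) * of_real (x i) + of_int (v i * k i) * mu / 2)"
    using assms by (intro sum.cong) (auto simp: algebra_simps)
  also have "\<dots> = of_real (posn n x v) + of_int (freq n k v) * mu / 2"
    unfolding posn_def freq_def by (simp add: sum.distrib sum_distrib_right sum_divide_distrib)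
  finally show ?thesis .
qed

text \<open>The quasi-period factors of the sigma values form a homogeneous quadratic form in the
  exponent vector, and the denominator of a net polynomial is designed to cancel every such form.\<close>

lemma netpoly_eq:
  assumes z: "\<And>i. i < n \<Longrightarrow> z i = of_real (x i) + of_int (k i) * mu / 2"
  shows "netpoly L n z v = of_real (net_sign n (\<lambda>i. rsig (k i) (x i)) (\<lambda>i j. rsig (k i + k j) (x i + x j)) v
     * rsig (freq n k v) (posn n x v))"
proof -
  \<comment> \<open>A bilinear, not necessarily symmetric, form whose diagonal gives the exponent of
    \<open>phase\<close>.\<close>
  define q where "q i j = of_int (k i) * eta mu * of_real (x j) / 2 + \<i> * of_real pi * (of_int (k i) * of_int (k j)) / 2" for i j
  define a where "a i = 2 * v i ^ 2 - (\<Sum>j<n. v i * v j)" for i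
  have ph1: "phase (k i) (x i) = exp (q i i)" for i
    unfolding phase_def q_def by (simp add: power2_eq_square)
  have ph2: "phase (k i + k j) (x i + x j) = exp (q i i + q j j + q i j + q j i)" for i j
    unfolding phase_def q_def by (rule arg_cong[of _ _ exp]) (simp add: field_simps power2_eq_square)
  have qsum: "(\<Sum>i<n. of_int (a i) * q i i) + (\<Sum>i<n. \<Sum>j\<in>{i<..<n}. of_int (v i * v j) * (q i i + q j j + q i j + q j i))
     = (\<Sum>i<n. \<Sum>j<n. of_int (v i * v j) * q i j)"
  proof -
    \<comment> \<open>Chosen so that \<open>?f i j + ?f j i\<close> is the pair term. Its diagonal
      supplies \<open>2 * v i ^ 2 * q i i\<close>, matching the exponent of
      \<open>sigma L (z i)\<close>.\<close>
    let ?f = "\<lambda>i j. of_int (v i * v j) * (q i i + q i j)"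
    have "(\<Sum>i<n. \<Sum>j\<in>{i<..<n}. of_int (v i * v j) * (q i i + q j j + q i j + q j i))
       = (\<Sum>i<n. \<Sum>j\<in>{i<..<n}. ?f i j + ?f j i)"
      by (intro sum.cong refl) (simp add: algebra_simps)
    also have "\<dots> = (\<Sum>i<n. \<Sum>j<n. ?f i j) - (\<Sum>i<n. ?f i i)" by (rule sum_pairs_symmetric)
    also have "(\<Sum>i<n. ?f i i) = (\<Sum>i<n. of_int (2 * v i ^ 2) * q i i)"
      by (intro sum.cong refl) (simp add: power2_eq_square algebra_simps)
    also have "(\<Sum>i<n. \<Sum>j<n. ?f i j) = (\<Sum>i<n. of_int (\<Sum>j<n. v i * v j) * q i i) + (\<Sum>i<n. \<Sum>j<n. of_int (v i * v j) * q i j)"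
      by (simp add: distrib_left sum.distrib sum_distrib_right)
    finally show ?thesis unfolding a_def by (simp add: sum_subtractf left_diff_distrib)
  qed
  have phv: "phase (freq n k v) (posn n x v) = exp (\<Sum>i<n. \<Sum>j<n. of_int (v i * v j) * q i j)"
  proof -
    have "of_int (freq n k v) * eta mu * of_real (posn n x v) / 2
       = (\<Sum>j<n. \<Sum>i<n. of_int (v i * v j) * (of_int (k i) * eta mu * of_real (x j) / 2))"
      unfolding freq_def posn_def of_int_sum of_real_sum sum_distrib_right sum_distrib_left sum_divide_distrib
      by (intro sum.cong refl) (simp add: field_simps)
    also have "\<dots> = (\<Sum>i<n. \<Sum>j<n. of_int (v i * v j) * (of_int (k i) * eta mu * of_real (x j) / 2))"
      by (rule sum.swap)
    finally have "of_int (freq n k v) * eta mu * of_real (posn n x v) / 2 = \<dots>" .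
    moreover have "\<i> * of_real pi * of_int (freq n k v) ^ 2 / 2
       = (\<Sum>i<n. \<Sum>j<n. of_int (v i * v j) * (\<i> * of_real pi * (of_int (k i) * of_int (k j)) / 2))"
      unfolding freq_def power2_eq_square of_int_sum sum_product sum_distrib_right sum_distrib_left sum_divide_distrib
      by (intro sum.cong refl) (simp add: field_simps)
    ultimately show ?thesis unfolding phase_def q_def by (simp add: distrib_left sum.distrib)
  qed
  have s1: "sg (z i) = exp (q i i) * of_real (rsig (k i) (x i))" if "i < n" for i
    unfolding z[OF that] sigma_rsig ph1 ..
  have s2: "sg (z i + z j) = exp (q i i + q j j + q i j + q j i) * of_real (rsig (k i + k j) (x i + x j))"
    if "i < n" "j < n" for i j
  proof -
    have "z i + z j = of_real (x i + x j) + of_int (k i + k j) * mu / 2"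
      unfolding z[OF that(1)] z[OF that(2)] by (simp add: field_simps)
    then show ?thesis by (simp only: sigma_rsig ph2)
  qed
  let ?A = "\<Prod>i<n. rsig (k i) (x i) powi (a i)"
  let ?B = "\<Prod>i<n. \<Prod>j\<in>{i<..<n}. rsig (k i + k j) (x i + x j) powi (v i * v j)"
  let ?e = "exp (\<Sum>i<n. \<Sum>j<n. of_int (v i * v j) * q i j)"
  have d1: "(\<Prod>i<n. sg (z i) powi (a i)) = exp (\<Sum>i<n. of_int (a i) * q i i) * of_real ?A"
    by (simp add: exp_sum prod.distrib[symmetric] s1 power_int_mult_distrib exp_power_int)
  have d2: "(\<Prod>i<n. \<Prod>j\<in>{i<..<n}. sg (z i + z j) powi (v i * v j))
     = exp (\<Sum>i<n. \<Sum>j\<in>{i<..<n}. of_int (v i * v j) * (q i i + q j j + q i j + q j i)) * of_real ?B"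
  proof -
    have "(\<Prod>i<n. \<Prod>j\<in>{i<..<n}. sg (z i + z j) powi (v i * v j))
      = (\<Prod>i<n. \<Prod>j\<in>{i<..<n}. exp (of_int (v i * v j) * (q i i + q j j + q i j + q j i)) * of_real (rsig (k i + k j) (x i + x j) powi (v i * v j)))"
      by (intro prod.cong refl) (simp add: s2 power_int_mult_distrib exp_power_int)
    then show ?thesis by (simp add: exp_sum prod.distrib)
  qed
  have "(\<Prod>i<n. sg (z i) powi (a i)) * (\<Prod>i<n. \<Prod>j\<in>{i<..<n}. sg (z i + z j) powi (v i * v j)) = ?e * (of_real ?A * of_real ?B)"
    unfolding d1 d2 qsum[symmetric] exp_add by (simp add: mult_ac)
  moreover have "sg (\<Sum>i<n. of_int (v i) * z i) = ?e * of_real (rsig (freq n k v) (posn n x v))"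
  proof -
    have "(\<Sum>i<n. of_int (v i) * z i) = of_real (posn n x v) + of_int (freq n k v) * mu / 2"
      by (rule lincomb_eq) (rule z)
    then show ?thesis by (simp only: sigma_rsig phv)
  qed
  ultimately show ?thesis
    unfolding netpoly_def net_sign_def a_def by simp
qed

text \<open>\<open>F\<close> collects every factor whose sign depends only on \<open>v\<close>
  modulo 2; along a line only the value of \<open>rsig\<close> changes sign.\<close>

lemma signs_unif_frame:
  assumes n: "1 \<le> n" and z: "\<And>i. i < n \<Longrightarrow> z i = of_real (x i) + of_int (k i) * mu / 2"
    and indep: "\<And>c i. (\<Sum>i<n. of_int (c i) * z i) \<in> L \<Longrightarrow> i < n \<Longrightarrow> c i = 0"
    and F: "\<And>v. v \<in> Zn n \<Longrightarrow> F v \<noteq> 0"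
    and Fsgn: "\<And>v d t. v \<in> Zn n \<Longrightarrow> d < n \<Longrightarrow> sgn (F (v(d := v d + 2 * t))) = sgn (F v)"
    and W: "\<And>v. v \<in> Zn n \<Longrightarrow> W v = F v * rsig (freq n k v) (posn n x v)"
  shows "signs_unif n W"
proof -
  \<comment> \<open>If some \<open>k i\<close> is odd, its index is chosen; otherwise every
    \<open>freq\<close> is even and any index works.\<close>
  obtain d where d: "d < n" and par: "even (freq n k v) \<or> odd (k d)" for v
  proof (cases "\<exists>i<n. odd (k i)")
    case False
    then have "even (freq n k v)" for v unfolding freq_def by (intro dvd_sum) auto
    then show ?thesis using that[of 0] n by auto
  qed (use that in blast)
  have sub: "v \<in> vbox n V \<Longrightarrow> v \<in> Zn n" for v V unfolding vbox_def Zn_def by auto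
  have rnz: "rsig (freq n k v) (posn n x v) \<noteq> 0" if "v d \<noteq> 0" for v
  proof -
    have "(\<Sum>i<n. of_int (v i) * z i) = of_real (posn n x v) + of_int (freq n k v) * mu / 2"
      by (rule lincomb_eq) (rule z)
    then show ?thesis using indep[of v d] that d unfolding rsig_eq_0_iff by metis
  qed
  have irr: "x d / om \<notin> \<rat>"
  proof
    assume "x d / om \<in> \<rat>"
    then obtain a b :: int where ab: "b > 0" "x d / om = of_int a / of_int b" by (rule Rats_cases')
    then have ax: "of_int b * x d = of_int a * om" using om_pos by (simp add: field_simps)
    \<comment> \<open>With \<open>x d = (a / b) * om\<close>, the multiple
      \<open>2 * b * z d\<close> is a period; the factor 2 clears the half of
      \<open>mu\<close>.\<close>
    define c where "c i = (if i = d then 2 * b else 0)" for i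
    have "(\<Sum>i<n. of_int (c i) * z i) = (\<Sum>i<n. if i = d then of_int (2 * b) * z i else 0)"
      by (intro sum.cong) (auto simp: c_def)
    also have "\<dots> = of_int (2 * b) * z d" using d by simp
    also have "\<dots> = 2 * of_real (of_int b * x d) + of_int (b * k d) * mu" unfolding z[OF d] by (simp add: algebra_simps)
    also have "\<dots> = of_int (2 * a) * of_real om + of_int (b * k d) * mu" unfolding ax by simp
    also have "\<dots> \<in> L" by (intro add_in mult_int_in om_in mu_in)
    finally have "c d = 0" using indep d by blast
    then show False using ab by (simp add: c_def)
  qed
  have fline: "freq n k (v(d := v d + 2 * t)) = freq n k v + 2 * (t * k d)" for v t
  proof -
    have "freq n k (v(d := v d + 2 * t)) = (\<Sum>i<n. v i * k i + (if i = d then 2 * (t * k d) else 0))"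
      unfolding freq_def by (intro sum.cong) (auto simp: algebra_simps)
    then show ?thesis using d by (simp add: freq_def sum.distrib)
  qed
  have pline: "posn n x (v(d := v d + 2 * int j)) = posn n x v + 2 * real j * x d" for v j
  proof -
    have "posn n x (v(d := v d + 2 * int j)) = (\<Sum>i<n. of_int (v i) * x i + (if i = d then 2 * real j * x d else 0))"
      unfolding posn_def by (intro sum.cong) (auto simp: algebra_simps)
    then show ?thesis using d by (simp add: posn_def sum.distrib)
  qed
  show ?thesis
  proof (rule signs_unif_of_line_sums[OF d])
    fix v V assume v: "v \<in> vbox n V"
    then have "v d \<noteq> 0" using d unfolding vbox_def by auto
    then show "W v \<noteq> 0" using W[OF sub[OF v]] F[OF sub[OF v]] rnz by simp
  next
    fix \<delta> :: real assume "\<delta> > 0"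
    then obtain N0 where N0: "\<And>N K X. N \<ge> N0 \<Longrightarrow> even K \<or> odd (k d) \<Longrightarrow>
     (\<And>j::nat. rsig (K + 2 * (int j * k d)) (X + 2 * real j * x d) \<noteq> 0) \<Longrightarrow>
     \<bar>\<Sum>j<N. sgn (rsig (K + 2 * (int j * k d)) (X + 2 * real j * x d))\<bar> \<le> \<delta> * real N"
      using rsig_line_sums[OF irr, where kd = "k d"] by blast
    show "\<exists>N0. \<forall>N\<ge>N0. \<forall>v V. v \<in> vbox n V \<longrightarrow> \<bar>\<Sum>j<N. sgn (W (v(d := v d + 2 * int j)))\<bar> \<le> \<delta> * real N"
    proof (intro exI[of _ N0] allI impI)
      fix N v V assume N: "N0 \<le> N" and v: "v \<in> vbox n V"
      have vZ: "v \<in> Zn n" by (rule sub[OF v])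
      have vd: "1 \<le> v d" using v d unfolding vbox_def by auto
      have upd: "v(d := t) \<in> Zn n" for t using vZ d unfolding Zn_def by auto
      have line: "sgn (W (v(d := v d + 2 * int j)))
         = sgn (F v) * sgn (rsig (freq n k v + 2 * (int j * k d)) (posn n x v + 2 * real j * x d))" for j
        unfolding W[OF upd] sgn_mult Fsgn[OF vZ d] fline pline ..
      have nz: "rsig (freq n k v + 2 * (int j * k d)) (posn n x v + 2 * real j * x d) \<noteq> 0" for j :: nat
        using rnz[of "v(d := v d + 2 * int j)"] vd unfolding fline pline by simp
      have "\<bar>\<Sum>j<N. sgn (W (v(d := v d + 2 * int j)))\<bar>
         = \<bar>\<Sum>j<N. sgn (rsig (freq n k v + 2 * (int j * k d)) (posn n x v + 2 * real j * x d))\<bar>"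
        unfolding line sum_distrib_left[symmetric] abs_mult using F[OF vZ] by (simp add: abs_sgn_eq)
      also have "\<dots> \<le> \<delta> * real N" by (rule N0[OF N par nz])
      finally show "\<bar>\<Sum>j<N. sgn (W (v(d := v d + 2 * int j)))\<bar> \<le> \<delta> * real N" .
    qed
  qed
qed

end

text \<open>Chooses real and imaginary periods and writes each logarithm as
  \<open>x + k * mu / 2\<close>. Independence applied to unit vectors and sums of two of them keeps
  the denominators nonzero.\<close>

lemma (in curve_lat) signs_unif_netpoly:
  assumes n: "1 \<le> n" and P: "\<And>i. i < n \<Longrightarrow> elog (z i) (P i)"
    and indep: "\<And>c i. (\<Sum>i<n. of_int (c i) * z i) \<in> L \<Longrightarrow> i < n \<Longrightarrow> c i = 0"
    and F: "\<And>v. v \<in> Zn n \<Longrightarrow> F v \<noteq> 0"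
    and Fsgn: "\<And>v d t. v \<in> Zn n \<Longrightarrow> d < n \<Longrightarrow> sgn (F (v(d := v d + 2 * t))) = sgn (F v)"
    and W: "\<And>v. v \<in> Zn n \<Longrightarrow> W v = F v * Re (netpoly L n z v)"
  shows "signs_unif n W"
proof -
  obtain om where om: "om > 0" "\<And>x. complex_of_real x \<in> L \<longleftrightarrow> (\<exists>a::int. x = of_int a * om)"
    using real_period by blast
  obtain m where m: "m > 0" "\<And>y. \<i> * complex_of_real y \<in> L \<longleftrightarrow> (\<exists>a::int. y = of_int a * m)"
    using imag_period by blast
  interpret real_frame L w1 w2 E om m
    by unfold_locales (use om m in auto)
  define x where "x i = Re (z i)" for i
  have "\<exists>k::int. z i = of_real (x i) + of_int k * mu / 2" if "i < n" for i
  proof -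
    have "\<i> * complex_of_real (2 * Im (z i)) = z i - cnj (z i)" by (simp add: complex_diff_cnj mult_ac)
    then have "\<i> * complex_of_real (2 * Im (z i)) \<in> L" using elog_diff_cnj[OF P[OF that]] by simp
    then obtain a :: int where "2 * Im (z i) = of_int a * m" unfolding m(2) by blast
    then have "z i = of_real (x i) + of_int a * mu / 2"
      by (simp add: complex_eq_iff x_def mu_def)
    then show ?thesis by blast
  qed
  then obtain k where z: "\<And>i. i < n \<Longrightarrow> z i = of_real (x i) + of_int (k i) * mu / 2" by metis
  let ?a = "\<lambda>i. rsig (k i) (x i)" and ?b = "\<lambda>i j. rsig (k i + k j) (x i + x j)"
  have a: "?a i \<noteq> 0" if "i < n" for i
  proof
    assume "?a i = 0"
    then have "z i \<in> L" unfolding rsig_eq_0_iff z[OF that] .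
    moreover have "(\<Sum>l<n. of_int (unitv i l) * z l) = (\<Sum>l<n. if l = i then z l else 0)"
      by (intro sum.cong) (auto simp: unitv_def)
    ultimately show False using indep[of "unitv i" i] that by (simp add: unitv_def)
  qed
  have b: "?b i j \<noteq> 0" if ij: "i < j" "j < n" for i j
  proof
    assume "?b i j = 0"
    then have "of_real (x i + x j) + of_int (k i + k j) * mu / 2 \<in> L" by (simp only: rsig_eq_0_iff)
    moreover have "of_real (x i + x j) + of_int (k i + k j) * mu / 2 = z i + z j"
      using z[of i] z[of j] ij by (simp add: field_simps)
    moreover have "(\<Sum>l<n. of_int (vadd (unitv i) (unitv j) l) * z l) = (\<Sum>l<n. (if l = i then z l else 0) + (if l = j then z l else 0))"
      using ij by (intro sum.cong) (auto simp: unitv_def vadd_def)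
    ultimately have "(\<Sum>l<n. of_int (vadd (unitv i) (unitv j) l) * z l) \<in> L"
      using ij by (simp add: sum.distrib)
    from indep[OF this, of i] show False using ij by (simp add: unitv_def vadd_def)
  qed
  show ?thesis
  proof (rule signs_unif_frame[where z = z and x = x and k = k and F = "\<lambda>v. F v * net_sign n ?a ?b v"])
    show "1 \<le> n" by (rule n)
    show "z i = of_real (x i) + of_int (k i) * mu / 2" if "i < n" for i by (rule z[OF that])
    show "c i = 0" if "(\<Sum>i<n. of_int (c i) * z i) \<in> L" "i < n" for c i by (rule indep[OF that])
  next
    fix v :: "nat \<Rightarrow> int" assume v: "v \<in> Zn n"
    show "F v * net_sign n ?a ?b v \<noteq> 0" using F[OF v] net_sign_nz[OF a b] by simp
    show "W v = F v * net_sign n ?a ?b v * rsig (freq n k v) (posn n x v)"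
    proof -
      have "netpoly L n z v = of_real (net_sign n ?a ?b v * rsig (freq n k v) (posn n x v))"
        by (rule netpoly_eq) (rule z)
      then show ?thesis unfolding W[OF v] by simp
    qed
    fix d t assume d: "d < n"
    have "sgn (net_sign n ?a ?b (v(d := v d + 2 * t))) = sgn (net_sign n ?a ?b v)"
      by (rule sgn_net_sign_cong[OF _ a b]) auto
    then show "sgn (F (v(d := v d + 2 * t)) * net_sign n ?a ?b (v(d := v d + 2 * t))) = sgn (F v * net_sign n ?a ?b v)"
      by (simp add: sgn_mult Fsgn[OF v d])
  qed
qed

section \<open>Signs of quadratic forms and oddness of nets\<close>

text \<open>For \<open>b = t * e_d\<close>, the law at \<open>(b, b, - b)\<close> and evenness give
  \<open>f (2 * b) = f b ^ 4\<close>. The law at \<open>(v, b, b)\<close> then exhibits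
  \<open>f (v + 2 * b) * f v\<close> as positive.\<close>

lemma sgn_quadratic_form_shift:
  assumes f: "quadratic_form n f" and even: "\<And>v. v \<in> Zn n \<Longrightarrow> f (\<lambda>i. - v i) = f v"
    and v: "v \<in> Zn n" and d: "d < n"
  shows "sgn (f (v(d := v d + 2 * t))) = sgn (f v)"
proof -
  have nz: "\<And>v. v \<in> Zn n \<Longrightarrow> f v \<noteq> 0" using f unfolding quadratic_form_def by blast
  have closed: "vadd a b \<in> Zn n" if "a \<in> Zn n" "b \<in> Zn n" for a b
    using that unfolding Zn_def vadd_def by auto
  have q: "f (vadd (vadd a b) c) * f a * f b * f c = f (vadd a b) * f (vadd b c) * f (vadd c a)"
    if "a \<in> Zn n" "b \<in> Zn n" "c \<in> Zn n" for a b c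
  proof -
    have "f (vadd (vadd a b) c) * inverse (f (vadd a b)) * inverse (f (vadd b c))
        * inverse (f (vadd c a)) * f a * f b * f c = 1"
      using f that unfolding quadratic_form_def by blast
    moreover have "f (vadd a b) \<noteq> 0" "f (vadd b c) \<noteq> 0" "f (vadd c a) \<noteq> 0" using nz closed that by auto
    ultimately show ?thesis by (simp add: field_simps)
  qed
  let ?o = "\<lambda>_::nat. 0::int"
  have o: "?o \<in> Zn n" unfolding Zn_def by simp
  have "f ?o * f ?o * f ?o * f ?o = f ?o * f ?o * f ?o" using q[OF o o o] by (simp add: vadd_def)
  then have f0: "f ?o = 1" using nz[OF o] by simp
  define b where "b = vscale t (unitv d)"
  have b: "b \<in> Zn n" using d unfolding b_def Zn_def vscale_def unitv_def by auto
  define b' where "b' = (\<lambda>i. - b i)"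
  have b': "b' \<in> Zn n" using b unfolding b'_def Zn_def by auto
  have bb: "vadd b b' = ?o" "vadd b' b = ?o" "vadd (vadd b b) b' = b" unfolding b'_def vadd_def by auto
  have "f (vadd b b) = f b * f b * f b * f b"
    using q[OF b b b'] even[OF b] unfolding bb f0 b'_def[symmetric] by simp
  then have "f (vadd b b) = (f b * f b) * (f b * f b)" by simp
  then have pos: "sgn (f (vadd b b)) = 1" using nz[OF b] by (simp add: sgn_mult sgn_if)
  have "vadd (vadd v b) b = v(d := v d + 2 * t)"
    unfolding b_def vadd_def vscale_def unitv_def by auto
  moreover have "vadd b v = vadd v b" unfolding vadd_def by (simp add: add.commute)
  ultimately have "f (v(d := v d + 2 * t)) * f v * (f b * f b) = (f (vadd v b) * f (vadd v b)) * f (vadd b b)"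
    using q[OF v b b] by (simp add: mult_ac)
  also have "\<dots> > 0"
  proof (rule mult_pos_pos)
    show "0 < f (vadd v b) * f (vadd v b)" using not_real_square_gt_zero nz[OF closed[OF v b]] by blast
  qed (use pos in \<open>simp add: sgn_1_pos\<close>)
  finally have "0 < f (v(d := v d + 2 * t)) * f v"
  proof (rule zero_less_mult_pos2)
    show "0 < f b * f b" using not_real_square_gt_zero nz[OF b] by blast
  qed
  then show ?thesis by (auto simp: zero_less_mult_iff)
qed

text \<open>The net relation at \<open>p = q = v\<close> and \<open>r = s = 0\<close>.\<close>

lemma elliptic_net_odd:
  assumes W: "elliptic_net n W" and v: "v \<in> Zn n" and nz: "W v \<noteq> 0"
  shows "W (\<lambda>i. - v i) = - W v"
proof -
  let ?o = "\<lambda>_::nat. 0::int"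
  have o: "?o \<in> Zn n" unfolding Zn_def by simp
  have W0: "W ?o = 0" using W unfolding elliptic_net_def by blast
  have "W (vadd (vadd v v) ?o) * W (vsub v v) * W (vadd ?o ?o) * W ?o
      + W (vadd (vadd v ?o) ?o) * W (vsub v ?o) * W (vadd v ?o) * W v
      + W (vadd (vadd ?o v) ?o) * W (vsub ?o v) * W (vadd v ?o) * W v = 0"
    using W v o unfolding elliptic_net_def by blast
  then have "W v * W v * W v * W v + W v * W (\<lambda>i. - v i) * W v * W v = 0"
    using W0 by (simp add: vadd_def vsub_def)
  then have "(W v * W v * W v) * (W v + W (\<lambda>i. - v i)) = 0" by (simp add: algebra_simps)
  then show ?thesis using nz by simp
qed

lemma (in period_lat) netpoly_minus: "netpoly L n z (\<lambda>i. - v i) = - netpoly L n z v"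
proof -
  have "(\<Sum>i<n. of_int (- v i) * z i) = - (\<Sum>i<n. of_int (v i) * z i)" by (simp add: sum_negf)
  then show ?thesis unfolding netpoly_def by (simp add: sigma_minus)
qed

theorem theorem1p15:
  shows "(\<forall>(E::wcurve) (n::nat) (P::nat \<Rightarrow> real ppoint) (q::real) (u::nat \<Rightarrow> real) (k::nat)
            (L::complex set) (z::nat \<Rightarrow> complex).
           elliptic_curve E \<and> 1 \<le> n \<and> (\<forall>i<n. on_curve E (P i)) \<and> lin_indep E n P \<and>
           attached E n P q u \<and> k \<le> n \<and> (\<forall>i<k. u i < 0) \<and> (\<forall>i. k \<le> i \<and> i < n \<longrightarrow> 0 < u i) \<and>
           period_lattice E L \<and> (\<forall>i<n. weier_pt E L (z i) = map_ppoint complex_of_real (P i))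
           \<longrightarrow> signs_unif n (\<lambda>v. Re (netpoly L n z v)))
       \<and>
       (\<forall>(n::nat) (W::(nat \<Rightarrow> int) \<Rightarrow> real) (E::wcurve) (P::nat \<Rightarrow> real ppoint)
            (f::(nat \<Rightarrow> int) \<Rightarrow> real) (q::real) (u::nat \<Rightarrow> real) (k::nat)
            (L::complex set) (z::nat \<Rightarrow> complex).
           1 \<le> n \<and> elliptic_net n W \<and> nondegenerate n W \<and>
           (\<forall>v\<in>Zn n. v \<noteq> (\<lambda>_. 0) \<longrightarrow> W v \<noteq> 0) \<and>
           elliptic_curve E \<and> (\<forall>i<n. on_curve E (P i)) \<and> quadratic_form n f \<and>
           period_lattice E L \<and> (\<forall>i<n. weier_pt E L (z i) = map_ppoint complex_of_real (P i)) \<and>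
           (\<forall>v\<in>Zn n. complex_of_real (W v) = complex_of_real (f v) * netpoly L n z v) \<and>
           attached E n P q u \<and> k \<le> n \<and> (\<forall>i<k. u i < 0) \<and> (\<forall>i. k \<le> i \<and> i < n \<longrightarrow> 0 < u i)
           \<longrightarrow> signs_unif n W)"
proof -
  have curve: "\<exists>w1 w2. curve_lat L w1 w2 E" if "period_lattice E L" for E L
    using that unfolding period_lattice_def is_lattice_def curve_lat_def curve_lat_axioms_def period_lat_def by blast
  show ?thesis
  proof (intro conjI allI impI; elim conjE)
    fix E n P q u k L z
    assume n: "1 \<le> (n::nat)" and li: "lin_indep E n P" and L: "period_lattice E L"
      and z: "\<forall>i<n. weier_pt E L (z i) = map_ppoint complex_of_real (P i)"
    obtain w1 w2 where "curve_lat L w1 w2 E" using curve[OF L] by blast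
    then interpret curve_lat L w1 w2 E .
    have P: "elog (z i) (P i)" if "i < n" for i using z that by (simp add: elog_def)
    show "signs_unif n (\<lambda>v. Re (netpoly L n z v))"
    proof (rule signs_unif_netpoly[where z = z and P = P and F = "\<lambda>_. 1"])
      show "c i = 0" if "(\<Sum>i<n. of_int (c i) * z i) \<in> L" "i < n" for c i
        using lin_indep_elog[OF li _ that] P by blast
    qed (use n P in auto)
  next
    fix n W E P f q u k L z
    assume n: "1 \<le> (n::nat)" and W: "elliptic_net n W" and W0: "\<forall>v\<in>Zn n. v \<noteq> (\<lambda>_. 0) \<longrightarrow> W v \<noteq> 0"
      and f: "quadratic_form n f" and L: "period_lattice E L"
      and z: "\<forall>i<n. weier_pt E L (z i) = map_ppoint complex_of_real (P i)"
      and Wf: "\<forall>v\<in>Zn n. complex_of_real (W v) = complex_of_real (f v) * netpoly L n z v"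
    obtain w1 w2 where "curve_lat L w1 w2 E" using curve[OF L] by blast
    then interpret curve_lat L w1 w2 E .
    have P: "elog (z i) (P i)" if "i < n" for i using z that by (simp add: elog_def)
    have net_nz: "netpoly L n z v \<noteq> 0" if "v \<in> Zn n" "v \<noteq> (\<lambda>_. 0)" for v
      using Wf W0 that by (metis mult_zero_right of_real_eq_0_iff)
    \<comment> \<open>An integer relation among the logarithms would make the numerator sigma value
      zero, and with it a value of the net away from the origin.\<close>
    have indep: "c i = 0" if c: "(\<Sum>i<n. of_int (c i) * z i) \<in> L" and i: "i < n" for c i
    proof (rule ccontr)
      assume "c i \<noteq> 0"
      define v where "v j = (if j < n then c j else 0)" for j
      have v: "v \<in> Zn n" "v \<noteq> (\<lambda>_. 0)"
        using i \<open>c i \<noteq> 0\<close> unfolding v_def Zn_def by (auto simp: fun_eq_iff)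
      have "(\<Sum>i<n. of_int (v i) * z i) = (\<Sum>i<n. of_int (c i) * z i)"
        by (intro sum.cong) (auto simp: v_def)
      then have "sg (\<Sum>i<n. of_int (v i) * z i) = 0" using c sigma_eq_0_iff by simp
      then have "netpoly L n z v = 0" unfolding netpoly_def by simp
      then show False using net_nz[OF v] by simp
    qed
    have fnz: "f v \<noteq> 0" if "v \<in> Zn n" for v using f that unfolding quadratic_form_def by blast
    \<comment> \<open>Both the net and the net polynomial change sign under \<open>v\<close> to
      \<open>- v\<close>, so their ratio \<open>f\<close> is even.\<close>
    have feven: "f (\<lambda>i. - v i) = f v" if v: "v \<in> Zn n" for v
    proof (cases "v = (\<lambda>_. 0)")
      case False
      have mv: "(\<lambda>i. - v i) \<in> Zn n" using v unfolding Zn_def by auto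
      have e1: "complex_of_real (W (\<lambda>i. - v i)) = of_real (f (\<lambda>i. - v i)) * (- netpoly L n z v)"
        using Wf mv netpoly_minus by simp
      have e2: "complex_of_real (W (\<lambda>i. - v i)) = - (of_real (f v) * netpoly L n z v)"
        using elliptic_net_odd[OF W v] W0 v False Wf by simp
      have "complex_of_real (f (\<lambda>i. - v i)) * netpoly L n z v = of_real (f v) * netpoly L n z v"
        using trans[OF e1[symmetric] e2] by (simp only: mult_minus_right neg_equal_iff_equal)
      then show ?thesis using net_nz[OF v False] by (simp only: mult_cancel_right of_real_eq_iff) simp
    qed simp
    show "signs_unif n W"
    proof (rule signs_unif_netpoly[where z = z and P = P and F = f])
      show "1 \<le> n" by (rule n)
      show "elog (z i) (P i)" if "i < n" for i by (rule P[OF that])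
      show "c i = 0" if "(\<Sum>i<n. of_int (c i) * z i) \<in> L" "i < n" for c i by (rule indep[OF that])
      show "W v = f v * Re (netpoly L n z v)" if "v \<in> Zn n" for v
        using arg_cong[OF bspec[OF Wf that], of Re] by simp
      show "sgn (f (v(d := v d + 2 * t))) = sgn (f v)" if "v \<in> Zn n" "d < n" for v d t
        by (rule sgn_quadratic_form_shift[OF f feven that])
    qed (use fnz in auto)
  qed
qed

end
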